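(* If $\psi\in L^2(K)$ is an $m$-decomposable Parseval frame wavelet, then $$\int_{\mathcal O}\frac{\sum_{k\in\mathbb N_0}\left|\widehat{\psi}(\xi+u(k))\right|^2}{|\xi|}\,d\xi\ \ge\ m\,\frac{q-1}{q}.$$
   Context: Local field setup. $K$ is a local field of positive characteristic, i.e. a locally compact, non-discrete, totally disconnected field of characteristic $p>0$, with absolute value $|\cdot|$. $\mathcal O=\{x\in K:|x|\le 1\}$ is the ring of integers, $\mathfrak P=\{x\in K:|x|<1\}$ its maximal ideal, $\mathfrak p$ a fixed prime element ($\mathfrak P=\mathfrak p\mathcal O$), $\mathcal O^*=\mathcal O\setminus\mathfrak P$, and $\mathcal O/\mathfrak P\cong GF(q)$ with $q=p^c$; $|\mathfrak p|=q^{-1}$. $dx$ is the Haar measure on $(K,+)$ with $|\mathcal O|=1$, where $|E|$ denotes the Haar measure of a measurable set $E$. $\mathbb N_0=\mathbb N\cup\{0\}$. The elements $u(n)$, $n\in\mathbb N_0$: fix $\{1=\epsilon_0,\epsilon_1,\dots,\epsilon_{c-1}\}\subset\mathcal O^*$ whose images in $\mathcal O/\mathfrak P$ form a basis of $GF(q)$ over $GF(p)$. For $0\le n<q$ write $n=\sum_{k=0}^{c-1}a_kp^k$, $0\le a_k<p$, and set $u(n)=\big(\sum_{k=0}^{c-1}a_k\epsilon_k\big)\mathfrak p^{-1}$. For general $n=\sum_{k=0}^s b_kq^k$, $0\le b_k<q$, set $u(n)=\sum_{k=0}^s u(b_k)\mathfrak p^{-k}$. The set $\{u(n)\}_{n\in\mathbb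 N_0}$ is a complete list of distinct coset representatives of $\mathcal O$ in $(K,+)$. Character and Fourier transform: $\chi$ is a fixed character of $(K,+)$, trivial on $\mathcal O$ and nontrivial on $\mathfrak P^{-1}=\mathfrak p^{-1}\mathcal O$; $\chi_y(x)=\chi(yx)$; the setup is such that $\chi_{u(k)}(u(l))=1$ for all $k,l\in\mathbb N_0$. $\widehat f(\xi)=\int_K f(x)\overline{\chi_\xi(x)}\,dx$ for $f\in L^1(K)$, extended to $L^2(K)$. Operators on $L^2(K)$: $D^jf(x)=q^{j/2}f(\mathfrak p^{-j}x)$ for $j\in\mathbb Z$, and $T^kf(x)=f(x-u(k))$ for $k\in\mathbb N_0$. Definitions. $\eta\in L^2(K)$ is a Parseval frame wavelet if $\|f\|^2=\sum_{(j,k)\in\mathbb Z\times\mathbb N_0}|\langle f,D^jT^k\eta\rangle|^2$ for every $f\in L^2(K)$. An $n$-tuple $(\eta_1,\dots,\eta_n)$ of Parseval frame wavelets is a Parseval frame super-wavelet of length $n$ if $\{D^jT^k\eta_1\oplus\cdots\oplus D^jT^k\eta_n: j\in\mathbb Z,\ k\in\mathbb N_0\}$ is a Parseval frame for the $n$-fold direct sum $\bigoplus_{i=1}^n L^2(K)$ (a Parseval frame wavelet is a Parseval frame super-wavelet of length $1$). Two Parseval frame super-wavelets $(\eta_1,\dots,\eta_m)$ and $(\mu_1,\dots,\mu_n)$ are equivalent if there is a unitary operator $U:\bigoplus_{i=1}^m L^2(K)\to\bigoplus_{i=1}^n L^2(K)$ with $U(D^kT^l\eta_1\oplus\cdots\oplus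 D^kT^l\eta_m)=D^kT^l\mu_1\oplus\cdots\oplus D^kT^l\mu_n$ for all $l\in\mathbb N_0$, $k\in\mathbb Z$. A Parseval frame wavelet is $n$-decomposable ($n>1$) if it is equivalent to a Parseval frame super-wavelet of length $n$. The integral in the claim is of a nonnegative function and may be $+\infty$. *)

theory Defs
  imports "HOL-Analysis.Analysis"
begin

section \<open>Local fields of positive characteristic\<close>

class topological_field = field + t2_space + topological_ab_group_add + topological_semigroup_mult +
  assumes tendsto_inverse_nhds: "a \<noteq> 0 \<Longrightarrow> (inverse \<longlongrightarrow> inverse a) (nhds a)"

definition integer_ring :: "('a::field \<Rightarrow> real) \<Rightarrow> 'a set" where
  "integer_ring absv = {x. absv x \<le> 1}"

definition max_ideal :: "('a::field \<Rightarrow> real) \<Rightarrow> 'a set" where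
  "max_ideal absv = {x. absv x < 1}"

text \<open>
  Parameters of the following locales: the absolute value \<open>absv\<close>, the prime element \<open>\<pp>\<close>, the
  degree \<open>c\<close> of the residue field over its prime field, the elements \<open>\<epsilon> 0, ..., \<epsilon> (c - 1)\<close> lifting
  a basis of that extension, the Haar measure \<open>\<mu>\<close> and the additive character \<open>chi\<close>. The letter
  \<open>p\<close> of the literature is \<open>CHAR('a)\<close>, and \<open>q = CHAR('a) ^ c\<close>.
\<close>

locale local_field =
  fixes absv :: "'a::topological_field \<Rightarrow> real"
  assumes char_pos: "CHAR('a) > 0"
    and locally_compact: "locally compact (UNIV :: 'a set)"
    and non_discrete: "\<not> (\<forall>S :: 'a set. open S)"
    and totally_disconnected: "\<And>x :: 'a. connected_component_set UNIV x = {x}"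
    and absv_nonneg: "\<And>x. absv x \<ge> 0"
    and absv_eq_0_iff: "\<And>x. absv x = 0 \<longleftrightarrow> x = 0"
    and absv_mult: "\<And>x y. absv (x * y) = absv x * absv y"
    and absv_ultrametric: "\<And>x y. absv (x + y) \<le> max (absv x) (absv y)"
    and absv_topology: "\<And>S. open S \<longleftrightarrow> (\<forall>x\<in>S. \<exists>e>0. \<forall>y. absv (y - x) < e \<longrightarrow> y \<in> S)"

text \<open>
  The residue field is rendered through the additive cosets of the maximal ideal; a field with
  \<open>p ^ c\<close> elements is \<open>GF(p ^ c)\<close>. Coefficients in \<open>GF(p)\<close> are represented by integers, two
  integers being the same coefficient if they are congruent modulo \<open>p\<close>. The value of
  \<open>absv \<pp>\<close> normalises the absolute value.
\<close>

locale local_field_basis = local_field absv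
  for absv :: "'a::topological_field \<Rightarrow> real" +
  fixes \<pp> :: 'a and c :: nat and \<epsilon> :: "nat \<Rightarrow> 'a"
  assumes prime_element: "max_ideal absv = (\<lambda>x. \<pp> * x) ` integer_ring absv"
    and c_pos: "c > 0"
    and card_residue_field:
      "card ((\<lambda>x. (\<lambda>y. x + y) ` max_ideal absv) ` integer_ring absv) = CHAR('a) ^ c"
    and absv_prime_element: "absv \<pp> = 1 / real (CHAR('a) ^ c)"
    and eps_0: "\<epsilon> 0 = 1"
    and eps_units: "\<And>k. k < c \<Longrightarrow> \<epsilon> k \<in> integer_ring absv - max_ideal absv"
    and eps_independent:
      "\<And>a :: nat \<Rightarrow> int. (\<Sum>k<c. of_int (a k) * \<epsilon> k) \<in> max_ideal absv \<Longrightarrow>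
         (\<forall>k<c. int CHAR('a) dvd a k)"
    and eps_spanning:
      "\<And>x. x \<in> integer_ring absv \<Longrightarrow>
         (\<exists>a :: nat \<Rightarrow> int. x - (\<Sum>k<c. of_int (a k) * \<epsilon> k) \<in> max_ideal absv)"

definition u_digit :: "'a::field \<Rightarrow> nat \<Rightarrow> (nat \<Rightarrow> 'a) \<Rightarrow> nat \<Rightarrow> 'a" where
  "u_digit \<pp> c \<epsilon> n =
     (\<Sum>k<c. of_nat ((n div CHAR('a) ^ k) mod CHAR('a)) * \<epsilon> k) * inverse \<pp>"

text \<open>
  All base-\<open>q\<close> digits of \<open>n\<close> at positions beyond \<open>n\<close> vanish and \<open>u_digit \<pp> c \<epsilon> 0 = 0\<close>, so that
  summing over positions up to \<open>n\<close> gives the sum over the actual expansion.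
\<close>

definition u :: "'a::field \<Rightarrow> nat \<Rightarrow> (nat \<Rightarrow> 'a) \<Rightarrow> nat \<Rightarrow> 'a" where
  "u \<pp> c \<epsilon> n =
     (let q = CHAR('a) ^ c in \<Sum>k\<le>n. u_digit \<pp> c \<epsilon> ((n div q ^ k) mod q) * inverse \<pp> ^ k)"

text \<open>
  A local field is second countable, so a translation invariant Borel measure for which the
  compact open ring of integers has measure 1 is automatically a Radon measure.
\<close>

locale local_field_setting = local_field_basis absv \<pp> c \<epsilon>
  for absv :: "'a::topological_field \<Rightarrow> real" and \<pp> :: 'a and c :: nat and \<epsilon> :: "nat \<Rightarrow> 'a" +
  fixes \<mu> :: "'a measure" and chi :: "'a \<Rightarrow> complex"
  assumes haar_sets: "sets \<mu> = sets borel"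
    and haar_invariant: "\<And>x E. E \<in> sets borel \<Longrightarrow> emeasure \<mu> ((\<lambda>y. x + y) ` E) = emeasure \<mu> E"
    and haar_normalised: "emeasure \<mu> (integer_ring absv) = 1"
    and char_continuous: "continuous_on UNIV chi"
    and char_norm: "\<And>x. norm (chi x) = 1"
    and char_add: "\<And>x y. chi (x + y) = chi x * chi y"
    and char_trivial: "\<And>x. x \<in> integer_ring absv \<Longrightarrow> chi x = 1"
    and char_nontrivial: "\<exists>x\<in>integer_ring absv. chi (inverse \<pp> * x) \<noteq> 1"
    and char_u: "\<And>k l. chi (u \<pp> c \<epsilon> k * u \<pp> c \<epsilon> l) = 1"


section \<open>Square integrable functions and the Fourier transform\<close>

text \<open>Elements of \<open>L\<^sup>2\<close> are represented by functions; equality is equality almost everywhere.\<close>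

definition L2 :: "'a measure \<Rightarrow> ('a \<Rightarrow> complex) set" where
  "L2 \<mu> = {f \<in> borel_measurable \<mu>. integrable \<mu> (\<lambda>x. (norm (f x))\<^sup>2)}"

definition L2_inner :: "'a measure \<Rightarrow> ('a \<Rightarrow> complex) \<Rightarrow> ('a \<Rightarrow> complex) \<Rightarrow> complex" where
  "L2_inner \<mu> f g = (\<integral>x. f x * cnj (g x) \<partial>\<mu>)"

definition L2_norm :: "'a measure \<Rightarrow> ('a \<Rightarrow> complex) \<Rightarrow> real" where
  "L2_norm \<mu> f = sqrt (\<integral>x. (norm (f x))\<^sup>2 \<partial>\<mu>)"

definition fourier_L1 ::
  "'a::field measure \<Rightarrow> ('a \<Rightarrow> complex) \<Rightarrow> ('a \<Rightarrow> complex) \<Rightarrow> 'a \<Rightarrow> complex" where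
  "fourier_L1 \<mu> chi f \<xi> = (\<integral>x. f x * cnj (chi (\<xi> * x)) \<partial>\<mu>)"

text \<open>Extension of the Fourier integral by continuity from \<open>L\<^sup>1 \<inter> L\<^sup>2\<close> to \<open>L\<^sup>2\<close>:\<close>

definition is_fourier_L2 ::
  "'a::field measure \<Rightarrow> ('a \<Rightarrow> complex) \<Rightarrow> ('a \<Rightarrow> complex) \<Rightarrow> ('a \<Rightarrow> complex) \<Rightarrow> bool" where
  "is_fourier_L2 \<mu> chi f g \<longleftrightarrow> g \<in> L2 \<mu> \<and>
     (\<exists>F :: nat \<Rightarrow> 'a \<Rightarrow> complex.
        (\<forall>n. integrable \<mu> (F n) \<and> F n \<in> L2 \<mu> \<and> fourier_L1 \<mu> chi (F n) \<in> L2 \<mu>) \<and>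
        (\<lambda>n. L2_norm \<mu> (\<lambda>x. F n x - f x)) \<longlonglongrightarrow> 0 \<and>
        (\<lambda>n. L2_norm \<mu> (\<lambda>\<xi>. fourier_L1 \<mu> chi (F n) \<xi> - g \<xi>)) \<longlonglongrightarrow> 0)"

definition fourier ::
  "'a::field measure \<Rightarrow> ('a \<Rightarrow> complex) \<Rightarrow> ('a \<Rightarrow> complex) \<Rightarrow> 'a \<Rightarrow> complex" where
  "fourier \<mu> chi f = (SOME g. is_fourier_L2 \<mu> chi f g)"


section \<open>Finite direct sums\<close>

text \<open>
  An element of the \<open>n\<close>-fold direct sum of \<open>L\<^sup>2\<close> is a family indexed by natural numbers of which
  only the members with index below \<open>n\<close> matter.
\<close>

definition dsum :: "'a measure \<Rightarrow> nat \<Rightarrow> (nat \<Rightarrow> 'a \<Rightarrow> complex) set" where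
  "dsum \<mu> n = {F. \<forall>i<n. F i \<in> L2 \<mu>}"

definition dsum_eq ::
  "'a measure \<Rightarrow> nat \<Rightarrow> (nat \<Rightarrow> 'a \<Rightarrow> complex) \<Rightarrow> (nat \<Rightarrow> 'a \<Rightarrow> complex) \<Rightarrow> bool" where
  "dsum_eq \<mu> n F G \<longleftrightarrow> (\<forall>i<n. AE x in \<mu>. F i x = G i x)"

definition dsum_inner ::
  "'a measure \<Rightarrow> nat \<Rightarrow> (nat \<Rightarrow> 'a \<Rightarrow> complex) \<Rightarrow> (nat \<Rightarrow> 'a \<Rightarrow> complex) \<Rightarrow> complex" where
  "dsum_inner \<mu> n F G = (\<Sum>i<n. L2_inner \<mu> (F i) (G i))"

definition dsum_norm :: "'a measure \<Rightarrow> nat \<Rightarrow> (nat \<Rightarrow> 'a \<Rightarrow> complex) \<Rightarrow> real" where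
  "dsum_norm \<mu> n F = sqrt (\<Sum>i<n. (L2_norm \<mu> (F i))\<^sup>2)"

definition unitary_dsum ::
  "'a measure \<Rightarrow> nat \<Rightarrow> nat \<Rightarrow> ((nat \<Rightarrow> 'a \<Rightarrow> complex) \<Rightarrow> (nat \<Rightarrow> 'a \<Rightarrow> complex)) \<Rightarrow> bool" where
  "unitary_dsum \<mu> m n U \<longleftrightarrow>
     (\<forall>F\<in>dsum \<mu> m. U F \<in> dsum \<mu> n) \<and>
     (\<forall>F\<in>dsum \<mu> m. \<forall>G\<in>dsum \<mu> m. dsum_eq \<mu> m F G \<longrightarrow> dsum_eq \<mu> n (U F) (U G)) \<and>
     (\<forall>F\<in>dsum \<mu> m. \<forall>G\<in>dsum \<mu> m. \<forall>a b.
        dsum_eq \<mu> n (U (\<lambda>i x. a * F i x + b * G i x)) (\<lambda>i x. a * U F i x + b * U G i x)) \<and>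
     (\<forall>F\<in>dsum \<mu> m. \<forall>G\<in>dsum \<mu> m. dsum_inner \<mu> n (U F) (U G) = dsum_inner \<mu> m F G) \<and>
     (\<forall>G\<in>dsum \<mu> n. \<exists>F\<in>dsum \<mu> m. dsum_eq \<mu> n (U F) G)"


section \<open>Wavelets and super-wavelets\<close>

definition dilation :: "'a::field \<Rightarrow> nat \<Rightarrow> int \<Rightarrow> ('a \<Rightarrow> complex) \<Rightarrow> 'a \<Rightarrow> complex" where
  "dilation \<pp> c j f x =
     complex_of_real (real (CHAR('a) ^ c) powr (real_of_int j / 2)) * f (\<pp> powi (- j) * x)"

definition translation ::
  "'a::field \<Rightarrow> nat \<Rightarrow> (nat \<Rightarrow> 'a) \<Rightarrow> nat \<Rightarrow> ('a \<Rightarrow> complex) \<Rightarrow> 'a \<Rightarrow> complex" where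
  "translation \<pp> c \<epsilon> k f x = f (x - u \<pp> c \<epsilon> k)"

definition affine ::
  "'a::field \<Rightarrow> nat \<Rightarrow> (nat \<Rightarrow> 'a) \<Rightarrow> int \<Rightarrow> nat \<Rightarrow> ('a \<Rightarrow> complex) \<Rightarrow> 'a \<Rightarrow> complex" where
  "affine \<pp> c \<epsilon> j k f = dilation \<pp> c j (translation \<pp> c \<epsilon> k f)"

definition parseval_frame_wavelet ::
  "'a::field measure \<Rightarrow> 'a \<Rightarrow> nat \<Rightarrow> (nat \<Rightarrow> 'a) \<Rightarrow> ('a \<Rightarrow> complex) \<Rightarrow> bool" where
  "parseval_frame_wavelet \<mu> \<pp> c \<epsilon> \<eta> \<longleftrightarrow> \<eta> \<in> L2 \<mu> \<and>
     (\<forall>f\<in>L2 \<mu>. ((\<lambda>(j :: int, k :: nat). (norm (L2_inner \<mu> f (affine \<pp> c \<epsilon> j k \<eta>)))\<^sup>2)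
        has_sum (L2_norm \<mu> f)\<^sup>2) UNIV)"

definition parseval_frame_super_wavelet ::
  "'a::field measure \<Rightarrow> 'a \<Rightarrow> nat \<Rightarrow> (nat \<Rightarrow> 'a) \<Rightarrow> nat \<Rightarrow> (nat \<Rightarrow> 'a \<Rightarrow> complex) \<Rightarrow> bool" where
  "parseval_frame_super_wavelet \<mu> \<pp> c \<epsilon> n \<eta> \<longleftrightarrow>
     n \<ge> 1 \<and> (\<forall>i<n. parseval_frame_wavelet \<mu> \<pp> c \<epsilon> (\<eta> i)) \<and>
     (\<forall>F\<in>dsum \<mu> n.
        ((\<lambda>(j :: int, k :: nat). (norm (dsum_inner \<mu> n F (\<lambda>i. affine \<pp> c \<epsilon> j k (\<eta> i))))\<^sup>2)
        has_sum (dsum_norm \<mu> n F)\<^sup>2) UNIV)"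

definition super_wavelet_equivalent ::
  "'a::field measure \<Rightarrow> 'a \<Rightarrow> nat \<Rightarrow> (nat \<Rightarrow> 'a) \<Rightarrow>
     nat \<Rightarrow> (nat \<Rightarrow> 'a \<Rightarrow> complex) \<Rightarrow> nat \<Rightarrow> (nat \<Rightarrow> 'a \<Rightarrow> complex) \<Rightarrow> bool" where
  "super_wavelet_equivalent \<mu> \<pp> c \<epsilon> m \<eta> n \<nu> \<longleftrightarrow>
     (\<exists>U. unitary_dsum \<mu> m n U \<and>
        (\<forall>(k :: int) (l :: nat).
           dsum_eq \<mu> n (U (\<lambda>i. affine \<pp> c \<epsilon> k l (\<eta> i))) (\<lambda>i. affine \<pp> c \<epsilon> k l (\<nu> i))))"

definition decomposable ::
  "'a::field measure \<Rightarrow> 'a \<Rightarrow> nat \<Rightarrow> (nat \<Rightarrow> 'a) \<Rightarrow> nat \<Rightarrow> ('a \<Rightarrow> complex) \<Rightarrow> bool" where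
  "decomposable \<mu> \<pp> c \<epsilon> n \<psi> \<longleftrightarrow> n > 1 \<and>
     (\<exists>\<nu>. parseval_frame_super_wavelet \<mu> \<pp> c \<epsilon> n \<nu> \<and>
        super_wavelet_equivalent \<mu> \<pp> c \<epsilon> 1 (\<lambda>_. \<psi>) n \<nu>)"

end

theory Submission
  imports Defs
begin

text \<open>
  Write \<open>\<Lambda>\<close> for the set of the elements \<open>u(k)\<close>, \<open>\<OO>\<close> for the ring of integers, \<open>\<PP>\<^sup>n = \<pp>\<^sup>n\<OO>\<close>, and let the
  weight \<open>\<Omega>\<close> be the \<open>\<Lambda>\<close>-periodic function that is \<open>1 / |\<xi>|\<close> on \<open>\<OO>\<close>. Folding the integral over \<open>\<OO>\<close> along
  \<open>\<Lambda>\<close> turns the left-hand side of the claim into the mass \<open>\<integral> \<Omega> |f^|\<^sup>2\<close> over the whole field, with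
  \<open>f = \<psi>\<close> (\<open>periodization_integral_ge\<close>). Two facts about this mass prove the claim.

  The mass depends on the correlations \<open>\<langle>f, T\<^sup>k f\<rangle>\<close> only. Indeed \<open>\<Omega>\<close> is a nonnegative combination of
  indicators of the sets \<open>\<PP>\<^sup>n + \<Lambda>\<close>. Since the character is trivial on \<open>\<Lambda>\<Lambda>\<close>, each of these
  indicators is the average of the characters \<open>\<chi>(u(k)\<xi>)\<close>, \<open>k < q\<^sup>n\<close>, and by Plancherel the integral of
  \<open>|f^|\<^sup>2\<close> against such a character is a correlation (\<open>translation_correlation_sum\<close>). A unitary operator that
  intertwines the affine systems preserves correlations; so if \<open>\<psi>\<close> is equivalent to
  \<open>(\<nu>\<^sub>1, ..., \<nu>\<^sub>m)\<close>, then the mass of \<open>\<psi>\<close> is the sum of the masses of the \<open>\<nu>\<^sub>i\<close>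
  (\<open>equivalent_layer_density_integral\<close>).

  The mass of a single Parseval frame wavelet \<open>\<eta>\<close> is at least \<open>(q - 1) / q\<close> (\<open>wavelet_mass\<close>). As
  \<open>\<Omega>(\<xi>) \<ge> 1 / |\<xi>|\<close>, it suffices to bound \<open>\<integral> |\<eta>^(\<xi>)|\<^sup>2 / |\<xi>| d\<xi>\<close>. Test the frame identity on
  the function whose Fourier transform is (a multiple of) the indicator of a ball \<open>B = a + \<PP>\<^sup>N\<close> of
  units. The coefficients at scale \<open>j\<close> are Fourier coefficients of \<open>\<eta>^\<close> restricted to \<open>\<pp>\<^sup>jB\<close>, and
  Bessel's inequality bounds their square sum by the mass of \<open>|\<eta>^|\<^sup>2\<close> on \<open>\<pp>\<^sup>jB\<close>. This loses
  something only if \<open>\<pp>\<^sup>jB\<close> is larger than \<open>\<OO>\<close>, that is for \<open>j < -N\<close>, and after normalisation the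
  loss is at most \<open>q\<^sup>-\<^sup>N\<close> times the mass of \<open>|\<eta>^|\<^sup>2\<close> on \<open>\<pp>\<^sup>jB\<close>. The result is
  \<open>q\<^sup>-\<^sup>N \<le> \<Sum>\<^sub>j \<integral> (1 / |\<xi>| + q\<^sup>-\<^sup>N) |\<eta>^(\<xi>)|\<^sup>2 d\<xi>\<close> with the integrals taken over the sets \<open>\<pp>\<^sup>jB\<close>
  (\<open>wavelet_orbit_bound\<close>). The sets \<open>\<pp>\<^sup>jB\<close> for all \<open>j\<close> and all balls \<open>B\<close> of units of this radius are
  disjoint, and these balls have total measure \<open>(q - 1) / q\<close>; adding up and letting \<open>N\<close> tend to infinity gives
  the bound.

  The Fourier theory behind this rests on one orthonormal basis: the functions
  \<open>\<chi>(u(k)x)\<close> restricted to the coset \<open>u(l) + \<OO>\<close>. The Fourier transform permutes this basis up to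
  complex conjugation and the exchange of \<open>k\<close> and \<open>l\<close>, which yields its existence on \<open>L\<^sup>2\<close> and the
  Plancherel formula at once.
\<close>

section \<open>Square-integrable functions\<close>

lemma L2_measurable: "f \<in> L2 M \<Longrightarrow> f \<in> borel_measurable M"
  and L2_integrable: "f \<in> L2 M \<Longrightarrow> integrable M (\<lambda>x. (norm (f x))\<^sup>2)"
  by (auto simp: L2_def)

lemma borel_measurable_cnj [measurable]: "cnj \<in> borel_measurable borel"
  by (intro borel_measurable_continuous_onI continuous_intros)

lemma L2_product_integrable:
  assumes f: "f \<in> L2 M" and g: "g \<in> L2 M"
  shows "integrable M (\<lambda>x. f x * cnj (g x))"
proof (rule Bochner_Integration.integrable_bound)
  show "integrable M (\<lambda>x. (norm (f x))\<^sup>2 + (norm (g x))\<^sup>2)"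
    using assms by (intro Bochner_Integration.integrable_add L2_integrable)
  note [measurable] = assms[THEN L2_measurable]
  show "(\<lambda>x. f x * cnj (g x)) \<in> borel_measurable M" by measurable
  have "norm a * norm b \<le> (norm a)\<^sup>2 + (norm b)\<^sup>2" for a b :: complex
  proof -
    have "0 \<le> norm a * norm b" by simp
    then show ?thesis using sum_squares_bound[of "norm a" "norm b"] by linarith
  qed
  then show "AE x in M. norm (f x * cnj (g x)) \<le> norm ((norm (f x))\<^sup>2 + (norm (g x))\<^sup>2)"
    by (simp add: norm_mult)
qed

lemma L2_bound:
  assumes g: "g \<in> L2 M" and f: "f \<in> borel_measurable M" and "\<And>x. norm (f x) \<le> norm (g x)"
  shows "f \<in> L2 M"
proof -
  have "integrable M (\<lambda>x. (norm (f x))\<^sup>2)"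
  proof (rule Bochner_Integration.integrable_bound[OF L2_integrable[OF g]])
    show "(\<lambda>x. (norm (f x))\<^sup>2) \<in> borel_measurable M" using f by measurable
  qed (auto intro!: power_mono assms(3))
  with f show ?thesis by (simp add: L2_def)
qed

lemma L2_scale: "f \<in> L2 M \<Longrightarrow> (\<lambda>x. a * f x) \<in> L2 M"
  by (auto simp: L2_def norm_mult power_mult_distrib)

lemma L2_cnj: "f \<in> L2 M \<Longrightarrow> (\<lambda>x. cnj (f x)) \<in> L2 M"
  by (rule L2_bound[of f]) (auto dest: L2_measurable)

lemma cnj_indicator [simp]: "cnj (indicator A x) = indicator A x"
  by (simp add: indicator_def)

lemma L2_restrict:
  assumes f: "f \<in> L2 M" and [measurable]: "A \<in> sets M"
  shows "(\<lambda>x. indicator A x * f x) \<in> L2 M"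
proof (rule L2_bound[OF f])
  note [measurable] = L2_measurable[OF f]
  show "(\<lambda>x. indicator A x * f x) \<in> borel_measurable M" by measurable
qed (simp add: indicator_def)

lemma L2_add:
  assumes f: "f \<in> L2 M" and g: "g \<in> L2 M"
  shows "(\<lambda>x. f x + g x) \<in> L2 M"
proof -
  have "integrable M (\<lambda>x. (norm (f x + g x))\<^sup>2)"
  proof (rule Bochner_Integration.integrable_bound)
    show "integrable M (\<lambda>x. 2 * (norm (f x))\<^sup>2 + 2 * (norm (g x))\<^sup>2)"
      using assms by (intro Bochner_Integration.integrable_add integrable_mult_right L2_integrable)
    note [measurable] = assms[THEN L2_measurable]
    show "(\<lambda>x. (norm (f x + g x))\<^sup>2) \<in> borel_measurable M" by measurable
    have "(norm (a + b))\<^sup>2 \<le> 2 * (norm a)\<^sup>2 + 2 * (norm b)\<^sup>2" for a b :: complex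
    proof -
      have "(norm (a + b))\<^sup>2 \<le> (norm a + norm b)\<^sup>2"
        by (intro power_mono norm_triangle_ineq) auto
      also have "\<dots> \<le> 2 * (norm a)\<^sup>2 + 2 * (norm b)\<^sup>2"
        using sum_squares_bound[of "norm a" "norm b"] by (simp add: power2_sum)
      finally show ?thesis .
    qed
    then show "AE x in M. norm ((norm (f x + g x))\<^sup>2) \<le> norm (2 * (norm (f x))\<^sup>2 + 2 * (norm (g x))\<^sup>2)"
      by simp
  qed
  then show ?thesis using assms[THEN L2_measurable] by (auto simp: L2_def)
qed

lemma L2_diff:
  assumes "f \<in> L2 M" and "g \<in> L2 M"
  shows "(\<lambda>x. f x - g x) \<in> L2 M"
  using L2_add[OF assms(1) L2_scale[OF assms(2), of "-1"]] by simp

lemma L2_zero: "(\<lambda>x. 0) \<in> L2 M"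
  by (simp add: L2_def)

lemma L2_sum: "(\<And>i. i \<in> I \<Longrightarrow> f i \<in> L2 M) \<Longrightarrow> (\<lambda>x. \<Sum>i\<in>I. f i x) \<in> L2 M"
  by (induction I rule: infinite_finite_induct) (auto intro: L2_zero L2_add)

lemma L2_inner_commute: "L2_inner M g f = cnj (L2_inner M f g)"
  by (simp add: L2_inner_def flip: Bochner_Integration.integral_cnj) (simp add: mult.commute)

lemma L2_inner_cnj: "L2_inner M (\<lambda>x. cnj (f x)) (\<lambda>x. cnj (g x)) = cnj (L2_inner M f g)"
  by (simp add: L2_inner_def flip: Bochner_Integration.integral_cnj)

lemma L2_inner_add_left:
  "f \<in> L2 M \<Longrightarrow> f' \<in> L2 M \<Longrightarrow> g \<in> L2 M \<Longrightarrow>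
     L2_inner M (\<lambda>x. f x + f' x) g = L2_inner M f g + L2_inner M f' g"
  by (simp add: L2_inner_def distrib_right L2_product_integrable)

lemma L2_inner_diff_left:
  "f \<in> L2 M \<Longrightarrow> f' \<in> L2 M \<Longrightarrow> g \<in> L2 M \<Longrightarrow>
     L2_inner M (\<lambda>x. f x - f' x) g = L2_inner M f g - L2_inner M f' g"
  by (simp add: L2_inner_def left_diff_distrib L2_product_integrable)

lemma L2_inner_scale_left: "L2_inner M (\<lambda>x. a * f x) g = a * L2_inner M f g"
  by (simp add: L2_inner_def mult.assoc)

lemma L2_inner_scale_right: "L2_inner M f (\<lambda>x. a * g x) = cnj a * L2_inner M f g"
  by (metis L2_inner_commute L2_inner_scale_left complex_cnj_mult)

lemma L2_inner_sum_left:
  "(\<And>i. i \<in> I \<Longrightarrow> f i \<in> L2 M) \<Longrightarrow> g \<in> L2 M \<Longrightarrow>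
     L2_inner M (\<lambda>x. \<Sum>i\<in>I. f i x) g = (\<Sum>i\<in>I. L2_inner M (f i) g)"
  by (simp add: L2_inner_def sum_distrib_right L2_product_integrable)

lemma L2_inner_cong_AE:
  assumes "AE x in M. f x = f' x" "AE x in M. g x = g' x"
    and "f \<in> L2 M" "f' \<in> L2 M" "g \<in> L2 M" "g' \<in> L2 M"
  shows "L2_inner M f g = L2_inner M f' g'"
  unfolding L2_inner_def
proof (rule integral_cong_AE)
  note [measurable] = assms(3-)[THEN L2_measurable]
  show "(\<lambda>x. f x * cnj (g x)) \<in> borel_measurable M" "(\<lambda>x. f' x * cnj (g' x)) \<in> borel_measurable M"
    by measurable
  show "AE x in M. f x * cnj (g x) = f' x * cnj (g' x)"
    using assms(1,2) by eventually_elim simp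
qed

lemma L2_norm_nonneg: "L2_norm M f \<ge> 0"
  by (simp add: L2_norm_def)

lemma L2_norm_squared: "(L2_norm M f)\<^sup>2 = (\<integral>x. (norm (f x))\<^sup>2 \<partial>M)"
  by (simp add: L2_norm_def)

lemma L2_inner_self: "L2_inner M f f = of_real ((L2_norm M f)\<^sup>2)"
  by (simp add: L2_inner_def L2_norm_squared complex_norm_square[symmetric]
      flip: integral_complex_of_real of_real_power)

lemma L2_norm_squared_nn_integral:
  "f \<in> L2 M \<Longrightarrow> ennreal ((L2_norm M f)\<^sup>2) = (\<integral>\<^sup>+x. ennreal ((norm (f x))\<^sup>2) \<partial>M)"
  by (simp add: L2_norm_squared nn_integral_eq_integral L2_integrable)

lemma L2_norm_minus_commute: "L2_norm M (\<lambda>x. f x - g x) = L2_norm M (\<lambda>x. g x - f x)"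
  by (simp add: L2_norm_def norm_minus_commute)

lemma L2_Cauchy_Schwarz:
  assumes f: "f \<in> L2 M" and g: "g \<in> L2 M"
  shows "norm (L2_inner M f g) \<le> L2_norm M f * L2_norm M g"
proof -
  note [measurable] = assms[THEN L2_measurable]
  have "ennreal (norm (L2_inner M f g)) \<le> (\<integral>\<^sup>+x. norm (f x * cnj (g x)) \<partial>M)"
    unfolding L2_inner_def by (rule integral_norm_bound_ennreal[OF L2_product_integrable[OF f g]])
  also have "\<dots> = (\<integral>\<^sup>+x. ennreal (norm (f x)) * ennreal (norm (g x)) \<partial>M)"
    by (simp add: norm_mult ennreal_mult)
  finally have "(ennreal (norm (L2_inner M f g)))\<^sup>2 \<le> (\<integral>\<^sup>+x. ennreal (norm (f x)) * ennreal (norm (g x)) \<partial>M)\<^sup>2"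
    by (simp add: power_mono)
  also have "\<dots> \<le> (\<integral>\<^sup>+x. (ennreal (norm (f x)))\<^sup>2 \<partial>M) * (\<integral>\<^sup>+x. (ennreal (norm (g x)))\<^sup>2 \<partial>M)"
    by (intro Cauchy_Schwarz_nn_integral) measurable
  also have "\<dots> = ennreal ((L2_norm M f * L2_norm M g)\<^sup>2)"
    using assms by (simp add: ennreal_power L2_norm_squared_nn_integral[symmetric] ennreal_mult power_mult_distrib)
  finally have "(norm (L2_inner M f g))\<^sup>2 \<le> (L2_norm M f * L2_norm M g)\<^sup>2"
    by (simp add: ennreal_power)
  then show ?thesis
    by (rule power2_le_imp_le) (simp add: L2_norm_nonneg)
qed

lemma L2_norm_add_squared:
  assumes f: "f \<in> L2 M" and g: "g \<in> L2 M"
  shows "(L2_norm M (\<lambda>x. f x + g x))\<^sup>2 = (L2_norm M f)\<^sup>2 + 2 * Re (L2_inner M f g) + (L2_norm M g)\<^sup>2"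
proof -
  let ?h = "\<lambda>x. f x + g x"
  have "complex_of_real ((L2_norm M ?h)\<^sup>2) = L2_inner M f ?h + L2_inner M g ?h"
    unfolding L2_inner_self[symmetric] by (rule L2_inner_add_left) (use assms in \<open>auto intro: L2_add\<close>)
  also have "L2_inner M f ?h = cnj (L2_inner M ?h f)" by (rule L2_inner_commute)
  also have "L2_inner M g ?h = cnj (L2_inner M ?h g)" by (rule L2_inner_commute)
  finally have "Re (complex_of_real ((L2_norm M ?h)\<^sup>2)) = Re (L2_inner M ?h f) + Re (L2_inner M ?h g)"
    by simp
  then have "(L2_norm M ?h)\<^sup>2 = Re (L2_inner M ?h f) + Re (L2_inner M ?h g)"
    by (simp only: Re_complex_of_real)
  also have "\<dots> = (L2_norm M f)\<^sup>2 + Re (L2_inner M g f) + Re (L2_inner M f g) + (L2_norm M g)\<^sup>2"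
    using assms by (simp add: L2_inner_add_left L2_inner_self)
  also have "Re (L2_inner M g f) = Re (L2_inner M f g)"
    by (subst L2_inner_commute) simp
  finally show ?thesis by simp
qed

lemma L2_norm_triangle:
  assumes f: "f \<in> L2 M" and g: "g \<in> L2 M"
  shows "L2_norm M (\<lambda>x. f x + g x) \<le> L2_norm M f + L2_norm M g"
proof (rule power2_le_imp_le)
  have "Re (L2_inner M f g) \<le> L2_norm M f * L2_norm M g"
    using L2_Cauchy_Schwarz[OF assms] complex_Re_le_cmod order_trans by blast
  then show "(L2_norm M (\<lambda>x. f x + g x))\<^sup>2 \<le> (L2_norm M f + L2_norm M g)\<^sup>2"
    by (simp add: L2_norm_add_squared assms power2_sum)
qed (simp add: L2_norm_nonneg)

lemma L2_inner_tendsto: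
  assumes F: "\<And>n. F n \<in> L2 M" and f: "f \<in> L2 M" and g: "g \<in> L2 M"
    and lim: "(\<lambda>n. L2_norm M (\<lambda>x. F n x - f x)) \<longlonglongrightarrow> 0"
  shows "(\<lambda>n. L2_inner M (F n) g) \<longlonglongrightarrow> L2_inner M f g"
proof -
  have "(\<lambda>n. L2_inner M (F n) g - L2_inner M f g) \<longlonglongrightarrow> 0"
  proof (rule Lim_null_comparison)
    show "\<forall>\<^sub>F n in sequentially. norm (L2_inner M (F n) g - L2_inner M f g)
            \<le> L2_norm M (\<lambda>x. F n x - f x) * L2_norm M g"
      using L2_Cauchy_Schwarz[OF L2_diff[OF F f] g] by (simp add: L2_inner_diff_left F f g)
    show "(\<lambda>n. L2_norm M (\<lambda>x. F n x - f x) * L2_norm M g) \<longlonglongrightarrow> 0"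
      using tendsto_mult_left_zero[OF lim] .
  qed
  then show ?thesis by (simp add: LIM_zero_iff)
qed

text \<open>
  Riesz and Fischer. Along a subsequence with increments \<open>d\<^sub>k\<close> of norm below \<open>4\<^sup>-\<^sup>k\<close> the function
  \<open>\<Sum>\<^sub>k 4\<^sup>k |d\<^sub>k|\<^sup>2\<close> has finite integral, hence is finite almost everywhere, which forces \<open>|d\<^sub>k|\<close> to decay
  geometrically and the subsequence to converge pointwise. Fatou's lemma turns pointwise into norm convergence.
\<close>

lemma L2_complete:
  assumes F: "\<And>n. F n \<in> L2 M"
    and cauchy: "\<And>e. e > 0 \<Longrightarrow> \<exists>N. \<forall>m\<ge>N. \<forall>n\<ge>N. L2_norm M (\<lambda>x. F m x - F n x) < e"
  obtains G where "G \<in> L2 M" "(\<lambda>n. L2_norm M (\<lambda>x. F n x - G x)) \<longlonglongrightarrow> 0"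
proof -
  note [measurable] = L2_measurable[OF F]
  have "\<exists>r. \<forall>k. (\<forall>m\<ge>r k. \<forall>n\<ge>r k. L2_norm M (\<lambda>x. F m x - F n x) < (1/4) ^ k) \<and> k \<le> r k \<and> r k \<le> r (Suc k)"
  proof -
    have "\<forall>k. \<exists>N. \<forall>m\<ge>N. \<forall>n\<ge>N. L2_norm M (\<lambda>x. F m x - F n x) < (1/4) ^ k"
      using cauchy by simp
    then obtain N where N: "\<And>k. \<forall>m\<ge>N k. \<forall>n\<ge>N k. L2_norm M (\<lambda>x. F m x - F n x) < (1/4) ^ k"
      by metis
    define r where "r k = (\<Sum>i\<le>k. N i) + k" for k
    have "N k \<le> r k" for k
      by (simp add: r_def trans_le_add1 member_le_sum)
    moreover have "k \<le> r k" "r k \<le> r (Suc k)" for k by (auto simp: r_def)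
    ultimately show ?thesis using N by (meson order_trans)
  qed
  then obtain r where r: "\<And>k m n. m \<ge> r k \<Longrightarrow> n \<ge> r k \<Longrightarrow> L2_norm M (\<lambda>x. F m x - F n x) < (1/4) ^ k"
    and rk: "\<And>k. k \<le> r k" and rS: "\<And>k. r k \<le> r (Suc k)"
    by blast
  define d where "d k x = F (r (Suc k)) x - F (r k) x" for k x
  have dL2: "d k \<in> L2 M" for k unfolding d_def by (intro L2_diff F)
  note [measurable] = L2_measurable[OF dL2]
  have "(\<integral>\<^sup>+x. (\<Sum>k. ennreal (4 ^ k * (norm (d k x))\<^sup>2)) \<partial>M)
      = (\<Sum>k. \<integral>\<^sup>+x. ennreal (4 ^ k * (norm (d k x))\<^sup>2) \<partial>M)"
    by (rule nn_integral_suminf) measurable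
  also have "\<dots> \<le> (\<Sum>k. ennreal ((1/4) ^ k))"
  proof (intro suminf_le)
    fix k
    have "(\<integral>\<^sup>+x. ennreal (4 ^ k * (norm (d k x))\<^sup>2) \<partial>M) = ennreal (4 ^ k * (L2_norm M (d k))\<^sup>2)"
      by (simp add: ennreal_mult nn_integral_cmult L2_norm_squared_nn_integral dL2)
    also have "\<dots> \<le> ennreal (4 ^ k * ((1/4) ^ k)\<^sup>2)"
    proof (intro ennreal_leI mult_left_mono power_mono L2_norm_nonneg)
      show "L2_norm M (d k) \<le> (1/4) ^ k"
        unfolding d_def using r[of k "r (Suc k)" "r k"] rS[of k] by simp
    qed auto
    also have "4 ^ k * ((1/4) ^ k)\<^sup>2 = (1/4 :: real) ^ k"
      by (simp add: power2_eq_square field_simps flip: power_mult_distrib)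
    finally show "(\<integral>\<^sup>+x. ennreal (4 ^ k * (norm (d k x))\<^sup>2) \<partial>M) \<le> ennreal ((1/4) ^ k)" .
  qed auto
  also have "\<dots> < \<infinity>"
    by (subst suminf_ennreal2) (auto intro!: summable_geometric)
  finally have "AE x in M. (\<Sum>k. ennreal (4 ^ k * (norm (d k x))\<^sup>2)) \<noteq> \<infinity>"
    by (intro nn_integral_noteq_infinite) auto
  then have conv: "AE x in M. (\<lambda>k. F (r k) x) \<longlonglongrightarrow> lim (\<lambda>k. F (r k) x)"
  proof eventually_elim
    case (elim x)
    define C where "C = enn2real (\<Sum>k. ennreal (4 ^ k * (norm (d k x))\<^sup>2))"
    have bd: "norm (d k x) \<le> sqrt C * (1/2) ^ k" for k
    proof -
      have "t k \<le> suminf t" for t :: "nat \<Rightarrow> ennreal"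
        using sum_le_suminf[OF summableI, of "{k}" t] by simp
      then have "ennreal (4 ^ k * (norm (d k x))\<^sup>2) \<le> (\<Sum>k. ennreal (4 ^ k * (norm (d k x))\<^sup>2))" .
      then have "4 ^ k * (norm (d k x))\<^sup>2 \<le> C"
      proof -
        assume le: "ennreal (4 ^ k * (norm (d k x))\<^sup>2) \<le> (\<Sum>k. ennreal (4 ^ k * (norm (d k x))\<^sup>2))"
        have "0 \<le> C" unfolding C_def by (rule enn2real_nonneg)
        moreover have "(\<Sum>k. ennreal (4 ^ k * (norm (d k x))\<^sup>2)) = ennreal C"
          unfolding C_def by (rule ennreal_enn2real[symmetric]) (use elim in \<open>simp only: infinity_ennreal_def top.not_eq_extremum\<close>)
        ultimately show ?thesis using le by (simp only: ennreal_le_iff)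
      qed
      then have "sqrt (4 ^ k * (norm (d k x))\<^sup>2) \<le> sqrt C" by simp
      then have "2 ^ k * norm (d k x) \<le> sqrt C"
        by (simp add: real_sqrt_mult real_sqrt_power)
      then show ?thesis by (simp add: field_simps)
    qed
    have "summable (\<lambda>k. d k x)"
      by (rule summable_comparison_test'[where g="\<lambda>k. sqrt C * (1/2) ^ k" and N=0])
         (use bd in \<open>auto intro!: summable_mult summable_geometric\<close>)
    then have "convergent (\<lambda>n. \<Sum>k<n. d k x)" by (simp add: summable_iff_convergent)
    moreover have "(\<Sum>k<n. d k x) = F (r n) x - F (r 0) x" for n
      unfolding d_def by (rule sum_lessThan_telescope)
    ultimately have "convergent (\<lambda>n. F (r n) x - F (r 0) x)" by simp
    then have "convergent (\<lambda>n. (F (r n) x - F (r 0) x) + F (r 0) x)"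
      by (intro convergent_add convergent_const)
    then show ?case by (simp add: convergent_LIMSEQ_iff)
  qed
  define G where "G x = lim (\<lambda>k. F (r k) x)" for x
  have [measurable]: "G \<in> borel_measurable M"
    unfolding G_def by measurable
  \<comment> \<open>Fatou, applied to the distances from \<open>F n\<close> to the subsequence\<close>
  have main: "(\<integral>\<^sup>+x. ennreal ((norm (F n x - G x))\<^sup>2) \<partial>M) \<le> ennreal (((1/4) ^ k)\<^sup>2)" if n: "n \<ge> r k" for n k
  proof -
    have "(\<integral>\<^sup>+x. ennreal ((norm (F n x - G x))\<^sup>2) \<partial>M)
        = (\<integral>\<^sup>+x. liminf (\<lambda>j. ennreal ((norm (F n x - F (r j) x))\<^sup>2)) \<partial>M)"
    proof (rule nn_integral_cong_AE, use conv in eventually_elim)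
      case (elim x)
      have "(\<lambda>j. ennreal ((norm (F n x - F (r j) x))\<^sup>2)) \<longlonglongrightarrow> ennreal ((norm (F n x - G x))\<^sup>2)"
        unfolding G_def by (intro tendsto_intros elim)
      then show ?case by (metis lim_imp_Liminf sequentially_bot)
    qed
    also have "\<dots> \<le> liminf (\<lambda>j. \<integral>\<^sup>+x. ennreal ((norm (F n x - F (r j) x))\<^sup>2) \<partial>M)"
      by (rule nn_integral_liminf) measurable
    also have "\<dots> \<le> liminf (\<lambda>j. ennreal (((1/4) ^ k)\<^sup>2))"
    proof (rule Liminf_mono, rule eventually_sequentiallyI[of "r k"])
      fix j assume "j \<ge> r k"
      then have "r j \<ge> r k" using rk[of j] by linarith
      then show "(\<integral>\<^sup>+x. ennreal ((norm (F n x - F (r j) x))\<^sup>2) \<partial>M) \<le> ennreal (((1/4) ^ k)\<^sup>2)"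
        using r[of k n "r j"] n
        by (subst L2_norm_squared_nn_integral[symmetric])
           (auto intro!: L2_diff F ennreal_leI power_mono simp: L2_norm_nonneg less_imp_le)
    qed
    also have "\<dots> = ennreal (((1/4) ^ k)\<^sup>2)" by (simp add: Liminf_const)
    finally show ?thesis .
  qed
  \<comment> \<open>the same bound, for one index, shows that the limit is square-integrable\<close>
  have diffL2: "(\<lambda>x. F (r 0) x - G x) \<in> L2 M"
    unfolding L2_def using main[of 0 "r 0"]
    by (auto intro!: integrableI_bounded simp: less_top[symmetric] top_unique)
  have GL2: "G \<in> L2 M"
    using L2_diff[OF F[of "r 0"] diffL2] by simp
  have "(\<lambda>n. L2_norm M (\<lambda>x. F n x - G x)) \<longlonglongrightarrow> 0"
  proof (rule LIMSEQ_I)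
    fix e :: real assume "e > 0"
    then obtain k where k: "(1/4 :: real) ^ k < e"
      using real_arch_pow_inv[of e "1/4"] by auto
    have "norm (L2_norm M (\<lambda>x. F n x - G x) - 0) < e" if "n \<ge> r k" for n
    proof -
      have "(L2_norm M (\<lambda>x. F n x - G x))\<^sup>2 \<le> ((1/4) ^ k)\<^sup>2"
        using main[OF that] by (subst (asm) L2_norm_squared_nn_integral[symmetric]) (auto intro!: L2_diff F GL2)
      then have "L2_norm M (\<lambda>x. F n x - G x) \<le> (1/4) ^ k"
        by (rule power2_le_imp_le) simp
      with k show ?thesis by (simp add: L2_norm_nonneg)
    qed
    then show "\<exists>N. \<forall>n\<ge>N. norm (L2_norm M (\<lambda>x. F n x - G x) - 0) < e" by blast
  qed
  with GL2 show ?thesis by (rule that)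
qed

section \<open>Orthonormal sequences\<close>

definition orthonormal :: "'a measure \<Rightarrow> (nat \<Rightarrow> 'a \<Rightarrow> complex) \<Rightarrow> bool" where
  "orthonormal M e \<longleftrightarrow> (\<forall>i. e i \<in> L2 M) \<and> (\<forall>i j. L2_inner M (e i) (e j) = of_bool (i = j))"

text \<open>
  With \<open>orthonormal\<close> this characterises an orthonormal basis: nothing but zero is orthogonal to the sequence.
\<close>

definition total_sequence :: "'a measure \<Rightarrow> (nat \<Rightarrow> 'a \<Rightarrow> complex) \<Rightarrow> bool" where
  "total_sequence M e \<longleftrightarrow>
     (\<forall>f\<in>L2 M. (\<forall>i. L2_inner M f (e i) = 0) \<longrightarrow> (AE x in M. f x = 0))"

lemma orthonormal_expansion_inner:
  assumes e: "orthonormal M e"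
  shows "L2_inner M (\<lambda>x. \<Sum>i\<in>I. c i * e i x) (e j) = (if finite I \<and> j \<in> I then c j else 0)"
proof (cases "finite I")
  case True
  have "L2_inner M (\<lambda>x. \<Sum>i\<in>I. c i * e i x) (e j) = (\<Sum>i\<in>I. c i * L2_inner M (e i) (e j))"
    using e by (subst L2_inner_sum_left) (auto simp: orthonormal_def intro: L2_scale simp: L2_inner_scale_left)
  also have "\<dots> = (\<Sum>i\<in>I. if i = j then c i else 0)"
    using e by (intro sum.cong) (auto simp: orthonormal_def)
  finally show ?thesis using True by simp
qed (simp add: L2_inner_def)

lemma orthonormal_expansion_L2:
  "orthonormal M e \<Longrightarrow> (\<lambda>x. \<Sum>i\<in>I. c i * e i x) \<in> L2 M"
  by (auto intro!: L2_sum L2_scale simp: orthonormal_def)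

lemma orthonormal_expansion_norm:
  assumes e: "orthonormal M e" and I: "finite I"
  shows "(L2_norm M (\<lambda>x. \<Sum>i\<in>I. c i * e i x))\<^sup>2 = (\<Sum>i\<in>I. (norm (c i))\<^sup>2)"
proof -
  let ?S = "\<lambda>x. \<Sum>i\<in>I. c i * e i x"
  have "L2_inner M ?S ?S = (\<Sum>i\<in>I. c i * L2_inner M (e i) ?S)"
    using e orthonormal_expansion_L2[OF e]
    by (subst L2_inner_sum_left) (auto simp: orthonormal_def intro: L2_scale simp: L2_inner_scale_left)
  also have "\<dots> = (\<Sum>i\<in>I. c i * cnj (c i))"
  proof (intro sum.cong refl)
    fix i assume "i \<in> I"
    then show "c i * L2_inner M (e i) ?S = c i * cnj (c i)"
      by (subst L2_inner_commute) (simp add: orthonormal_expansion_inner[OF e] I)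
  qed
  also have "\<dots> = of_real (\<Sum>i\<in>I. (norm (c i))\<^sup>2)"
    by (simp only: of_real_sum complex_norm_square)
  finally have "complex_of_real ((L2_norm M ?S)\<^sup>2) = of_real (\<Sum>i\<in>I. (norm (c i))\<^sup>2)"
    by (simp only: L2_inner_self)
  then show ?thesis by (simp only: of_real_eq_iff)
qed

lemma Bessel_inequality:
  assumes e: "orthonormal M e" and f: "f \<in> L2 M" and I: "finite I"
  shows "(\<Sum>i\<in>I. (norm (L2_inner M f (e i)))\<^sup>2) \<le> (L2_norm M f)\<^sup>2"
proof -
  define c where "c i = L2_inner M f (e i)" for i
  define S where "S = (\<lambda>x. \<Sum>i\<in>I. c i * e i x)"
  have S: "S \<in> L2 M" unfolding S_def by (rule orthonormal_expansion_L2[OF e])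
  have Sf: "L2_inner M S f = of_real (\<Sum>i\<in>I. (norm (c i))\<^sup>2)"
  proof -
    have "L2_inner M S f = (\<Sum>i\<in>I. c i * L2_inner M (e i) f)"
      using e f unfolding S_def
      by (subst L2_inner_sum_left) (auto simp: orthonormal_def intro: L2_scale simp: L2_inner_scale_left)
    also have "\<dots> = (\<Sum>i\<in>I. c i * cnj (c i))"
      unfolding c_def by (intro sum.cong refl) (subst L2_inner_commute, simp)
    finally show ?thesis by (simp only: of_real_sum complex_norm_square)
  qed
  have "0 \<le> (L2_norm M (\<lambda>x. f x + (-1) * S x))\<^sup>2" by simp
  also have "\<dots> = (L2_norm M f)\<^sup>2 + 2 * Re (L2_inner M f (\<lambda>x. (-1) * S x)) + (L2_norm M (\<lambda>x. (-1) * S x))\<^sup>2"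
    by (rule L2_norm_add_squared[OF f L2_scale[OF S]])
  also have "L2_inner M f (\<lambda>x. (-1) * S x) = - cnj (L2_inner M S f)"
    by (simp add: L2_inner_scale_right[of M f "-1" S, simplified] flip: L2_inner_commute)
  also have "L2_norm M (\<lambda>x. (-1) * S x) = L2_norm M S" by (simp add: L2_norm_def)
  also have "(L2_norm M S)\<^sup>2 = (\<Sum>i\<in>I. (norm (c i))\<^sup>2)"
    unfolding S_def by (rule orthonormal_expansion_norm[OF e I])
  finally show ?thesis unfolding Sf by (simp add: c_def)
qed

lemma orthonormal_series_converges:
  assumes e: "orthonormal M e" and c: "summable (\<lambda>i. (norm (c i))\<^sup>2)"
  obtains G where "G \<in> L2 M" "(\<lambda>n. L2_norm M (\<lambda>x. (\<Sum>i<n. c i * e i x) - G x)) \<longlonglongrightarrow> 0"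
proof (rule L2_complete[of "\<lambda>n x. \<Sum>i<n. c i * e i x" M])
  fix \<epsilon> :: real assume "\<epsilon> > 0"
  then obtain N where N: "\<And>m n. m \<ge> N \<Longrightarrow> norm (\<Sum>i\<in>{m..<n}. (norm (c i))\<^sup>2) < \<epsilon>\<^sup>2"
    using c unfolding summable_Cauchy by (meson zero_less_power)
  have *: "L2_norm M (\<lambda>x. (\<Sum>i<n. c i * e i x) - (\<Sum>i<m. c i * e i x)) < \<epsilon>" if "m \<ge> N" "m \<le> n" for m n
  proof (rule power_less_imp_less_base)
    have "(\<lambda>x. (\<Sum>i<n. c i * e i x) - (\<Sum>i<m. c i * e i x)) = (\<lambda>x. \<Sum>i\<in>{m..<n}. c i * e i x)"
      using that by (simp add: lessThan_atLeast0 sum_diff_nat_ivl)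
    then have "(L2_norm M (\<lambda>x. (\<Sum>i<n. c i * e i x) - (\<Sum>i<m. c i * e i x)))\<^sup>2 = (\<Sum>i\<in>{m..<n}. (norm (c i))\<^sup>2)"
      by (simp add: orthonormal_expansion_norm[OF e])
    also have "\<dots> < \<epsilon>\<^sup>2" using N[of m n] that by (simp add: sum_nonneg)
    finally show "(L2_norm M (\<lambda>x. (\<Sum>i<n. c i * e i x) - (\<Sum>i<m. c i * e i x)))\<^sup>2 < \<epsilon>\<^sup>2" .
  qed (use \<open>\<epsilon> > 0\<close> in auto)
  show "\<exists>N. \<forall>m\<ge>N. \<forall>n\<ge>N. L2_norm M (\<lambda>x. (\<Sum>i<m. c i * e i x) - (\<Sum>i<n. c i * e i x)) < \<epsilon>"
  proof (intro exI[of _ N] allI impI)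
    fix m n assume "m \<ge> N" "n \<ge> N"
    then show "L2_norm M (\<lambda>x. (\<Sum>i<m. c i * e i x) - (\<Sum>i<n. c i * e i x)) < \<epsilon>"
      using *[of m n] *[of n m]
      by (cases "m \<le> n") (auto simp: L2_norm_minus_commute[of M "\<lambda>x. \<Sum>i<m. c i * e i x"])
  qed
qed (use orthonormal_expansion_L2[OF e] that in auto)

lemma orthonormal_coeffs_summable:
  assumes e: "orthonormal M e" and f: "f \<in> L2 M"
  shows "summable (\<lambda>i. (norm (L2_inner M f (e i)))\<^sup>2)"
  by (rule summableI_nonneg_bounded[where x="(L2_norm M f)\<^sup>2"]) (auto intro!: Bessel_inequality[OF e f])

lemma orthonormal_limit_coeff:
  assumes e: "orthonormal M e" and G: "G \<in> L2 M"
    and lim: "(\<lambda>n. L2_norm M (\<lambda>x. (\<Sum>i<n. c i * e i x) - G x)) \<longlonglongrightarrow> 0"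
  shows "L2_inner M G (e j) = c j"
proof -
  have "(\<lambda>n. L2_inner M (\<lambda>x. \<Sum>i<n. c i * e i x) (e j)) \<longlonglongrightarrow> L2_inner M G (e j)"
    using e by (intro L2_inner_tendsto orthonormal_expansion_L2 lim G) (auto simp: orthonormal_def)
  moreover have "(\<lambda>n. L2_inner M (\<lambda>x. \<Sum>i<n. c i * e i x) (e j)) \<longlonglongrightarrow> c j"
    by (rule tendsto_eventually, rule eventually_sequentiallyI[of "Suc j"])
       (simp add: orthonormal_expansion_inner[OF e])
  ultimately show ?thesis by (rule LIMSEQ_unique)
qed

text \<open>
  The expansion has a limit by completeness of \<open>L\<^sup>2\<close>; the difference of the limit and \<open>f\<close> is
  orthogonal to the sequence, so totality makes it vanish.
\<close>

lemma orthonormal_basis_expansion: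
  assumes e: "orthonormal M e" and t: "total_sequence M e" and f: "f \<in> L2 M"
  shows "(\<lambda>n. L2_norm M (\<lambda>x. (\<Sum>i<n. L2_inner M f (e i) * e i x) - f x)) \<longlonglongrightarrow> 0"
proof -
  define c where "c i = L2_inner M f (e i)" for i
  have "summable (\<lambda>i. (norm (c i))\<^sup>2)"
    unfolding c_def by (rule orthonormal_coeffs_summable[OF e f])
  from orthonormal_series_converges[OF e this] obtain G
    where G: "G \<in> L2 M" "(\<lambda>n. L2_norm M (\<lambda>x. (\<Sum>i<n. c i * e i x) - G x)) \<longlonglongrightarrow> 0" .
  have "L2_inner M (\<lambda>x. f x - G x) (e j) = 0" for j
    using e f G(1) orthonormal_limit_coeff[OF e G] by (subst L2_inner_diff_left) (auto simp: orthonormal_def c_def)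
  with t L2_diff[OF f G(1)] have "AE x in M. f x - G x = 0"
    unfolding total_sequence_def by blast
  then have AE: "AE x in M. f x = G x" by simp
  have "L2_norm M (\<lambda>x. (\<Sum>i<n. c i * e i x) - f x) = L2_norm M (\<lambda>x. (\<Sum>i<n. c i * e i x) - G x)" for n
  proof -
    note [measurable] = L2_measurable[OF f] L2_measurable[OF G(1)] L2_measurable[OF orthonormal_expansion_L2[OF e]]
    show ?thesis unfolding L2_norm_def
      by (intro arg_cong[where f=sqrt] integral_cong_AE) (use AE in auto)
  qed
  with G(2) show ?thesis by (simp add: c_def)
qed

lemma Parseval_identity:
  assumes e: "orthonormal M e" and t: "total_sequence M e" and f: "f \<in> L2 M" and g: "g \<in> L2 M"
  shows "(\<lambda>i. L2_inner M f (e i) * cnj (L2_inner M g (e i))) sums L2_inner M f g"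
proof -
  have "(\<lambda>n. L2_inner M (\<lambda>x. \<Sum>i<n. L2_inner M f (e i) * e i x) g) \<longlonglongrightarrow> L2_inner M f g"
    by (intro L2_inner_tendsto orthonormal_expansion_L2 orthonormal_basis_expansion e t f g)
  moreover have "L2_inner M (\<lambda>x. \<Sum>i<n. L2_inner M f (e i) * e i x) g
      = (\<Sum>i<n. L2_inner M f (e i) * cnj (L2_inner M g (e i)))" for n
  proof -
    have "L2_inner M (\<lambda>x. \<Sum>i<n. L2_inner M f (e i) * e i x) g = (\<Sum>i<n. L2_inner M f (e i) * L2_inner M (e i) g)"
      using e g by (subst L2_inner_sum_left) (auto simp: orthonormal_def intro: L2_scale simp: L2_inner_scale_left)
    then show ?thesis by (simp flip: L2_inner_commute)
  qed
  ultimately show ?thesis by (simp add: sums_def)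
qed

section \<open>Sums over digit expansions\<close>

lemma digits_exist:
  assumes "\<And>k. k < c \<Longrightarrow> d k < (p :: nat)"
  shows "\<exists>b<p ^ c. \<forall>k<c. (b div p ^ k) mod p = d k"
  using assms
proof (induction c arbitrary: d)
  case (Suc c)
  obtain b where b: "b < p ^ c" "\<forall>k<c. (b div p ^ k) mod p = d (Suc k)"
    using Suc.IH[of "\<lambda>k. d (Suc k)"] Suc.prems by auto
  have d0: "d 0 < p" using Suc.prems by simp
  have "d 0 + p * b < p * Suc b" using d0 by simp
  also have "\<dots> \<le> p * p ^ c" using b(1) by (intro mult_le_mono2) simp
  finally have "d 0 + p * b < p ^ Suc c" by simp
  moreover have "((d 0 + p * b) div p ^ k) mod p = d k" if "k < Suc c" for k
    using that b(2) d0 by (cases k) (auto simp: div_mult2_eq)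
  ultimately show ?case by blast
qed auto

text \<open>
  The digits of \<open>b div p\<close> are those of \<open>b\<close> without the first one, so induction on the length applies.
\<close>

lemma digits_inject:
  assumes "b < (p :: nat) ^ c" "b' < p ^ c" "\<And>k. k < c \<Longrightarrow> (b div p ^ k) mod p = (b' div p ^ k) mod p"
  shows "b = b'"
  using assms
proof (induction c arbitrary: b b')
  case (Suc c)
  have "b div p = b' div p"
  proof (rule Suc.IH)
    show "b div p < p ^ c" "b' div p < p ^ c"
      using Suc.prems(1,2) by (auto simp: less_mult_imp_div_less mult.commute)
    show "(b div p div p ^ k) mod p = (b' div p div p ^ k) mod p" if "k < c" for k
      using Suc.prems(3)[of "Suc k"] that by (simp add: div_mult2_eq)
  qed
  moreover have "b mod p = b' mod p" using Suc.prems(3)[of 0] by simp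
  ultimately show ?case by (metis mult_div_mod_eq)
qed auto

lemma sum_lessThan_mult:
  "(\<Sum>n<q * Q. f n) = (\<Sum>m<Q. \<Sum>b<(q::nat). f (b + q * m) :: 'b::comm_monoid_add)"
proof (induction Q)
  case (Suc Q)
  have "(\<Sum>n<q * Suc Q. f n) = (\<Sum>n\<in>{0..<q * Q}. f n) + (\<Sum>n\<in>{q * Q..<q * Suc Q}. f n)"
    by (subst sum.atLeastLessThan_concat) (auto simp: lessThan_atLeast0)
  also have "(\<Sum>n\<in>{q * Q..<q * Suc Q}. f n) = (\<Sum>b<q. f (b + q * Q))"
    using sum.shift_bounds_nat_ivl[of f 0 "q * Q" q] by (simp add: lessThan_atLeast0 add.commute)
  finally show ?case using Suc by (simp add: lessThan_atLeast0)
qed simp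

text \<open>
  Distributivity: choosing the digits of \<open>b\<close> is choosing one summand in every factor.
\<close>

lemma sum_digit_products:
  fixes z :: "nat \<Rightarrow> complex"
  shows "(\<Sum>b<p ^ c. \<Prod>j<c. z j ^ ((b div p ^ j) mod p)) = (\<Prod>j<c. \<Sum>a<p. z j ^ a)"
proof (induction c arbitrary: z)
  case (Suc c)
  have "(\<Sum>b<p ^ Suc c. \<Prod>j<Suc c. z j ^ ((b div p ^ j) mod p))
      = (\<Sum>m<p ^ c. \<Sum>a<p. \<Prod>j<Suc c. z j ^ (((a + p * m) div p ^ j) mod p))"
    by (simp add: sum_lessThan_mult)
  also have "\<dots> = (\<Sum>m<p ^ c. \<Sum>a<p. z 0 ^ a * (\<Prod>j<c. z (Suc j) ^ ((m div p ^ j) mod p)))"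
    by (intro sum.cong refl) (simp add: prod.lessThan_Suc_shift div_mult2_eq del: prod.lessThan_Suc)
  also have "\<dots> = (\<Sum>a<p. z 0 ^ a) * (\<Sum>m<p ^ c. \<Prod>j<c. z (Suc j) ^ ((m div p ^ j) mod p))"
    by (simp add: sum_product sum.swap[of _ "{..<p}"])
  also have "\<dots> = (\<Prod>j<Suc c. \<Sum>a<p. z j ^ a)"
    by (simp add: Suc.IH prod.lessThan_Suc_shift del: prod.lessThan_Suc)
  finally show ?case .
qed simp

lemma geometric_sum_root_of_unity:
  fixes z :: complex
  assumes "z ^ p = 1"
  shows "(\<Sum>a<p. z ^ a) = (if z = 1 then of_nat p else 0)"
  using assms by (simp add: geometric_sum)

section \<open>The absolute value and the fractional ideals\<close>

context local_field_setting
begin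

definition q :: nat where "q = CHAR('a) ^ c"
abbreviation rep :: "nat \<Rightarrow> 'a" where "rep k \<equiv> u \<pp> c \<epsilon> k"
abbreviation digit :: "nat \<Rightarrow> 'a" where "digit k \<equiv> u_digit \<pp> c \<epsilon> k"

text \<open>
  The fractional ideal \<open>\<pp>\<^sup>n\<OO>\<close>, defined through the absolute value so that ultrametricity gives its
  additive properties directly; \<open>pp_powi_mult_mem_iff\<close> is the description as a multiple of \<open>\<OO>\<close>.
\<close>

definition pideal :: "int \<Rightarrow> 'a set" where
  "pideal n = {x. absv x \<le> real q powi (- n)}"

lemma CHAR_ge_2: "CHAR('a) \<ge> 2"
  using prime_CHAR_semidom[OF char_pos] prime_ge_2_nat by blast

lemma q_ge_2: "q \<ge> 2"
proof -
  have "CHAR('a) ^ 1 \<le> CHAR('a) ^ c"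
    using c_pos CHAR_ge_2 by (intro power_increasing) auto
  then show ?thesis using CHAR_ge_2 by (simp add: q_def)
qed

lemma q_gt_1: "real q > 1" and q_pos: "real q > 0" and q_neq_0: "real q \<noteq> 0"
  using q_ge_2 by auto

lemma q_powi_less_iff [simp]: "real q powi a < real q powi b \<longleftrightarrow> a < b"
  using power_int_strict_increasing[of a b "real q"] power_int_strict_increasing[of b a "real q"] q_gt_1
  by (cases a b rule: linorder_cases) auto

lemma q_powi_le_iff [simp]: "real q powi a \<le> real q powi b \<longleftrightarrow> a \<le> b"
  by (simp flip: not_less)

lemma absv_0 [simp]: "absv 0 = 0" by (simp add: absv_eq_0_iff)

lemma absv_1 [simp]: "absv 1 = 1"
  using absv_mult[of 1 1] absv_eq_0_iff[of 1] by simp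

lemma absv_minus [simp]: "absv (- x) = absv x"
proof -
  have "absv (-1) * absv (-1) = 1" using absv_mult[of "-1" "-1"] by simp
  then have "absv (-1) = 1"
    using absv_nonneg[of "-1"] by (auto simp: square_eq_1_iff)
  then show ?thesis using absv_mult[of "-1" x] by simp
qed

lemma absv_inverse: "absv (inverse x) = inverse (absv x)"
  using absv_mult[of x "inverse x"] by (cases "x = 0") (auto simp: absv_eq_0_iff field_simps)

lemma absv_power: "absv (x ^ n) = absv x ^ n"
  by (induction n) (auto simp: absv_mult)

lemma absv_powi: "absv (x powi n) = absv x powi n"
  by (simp add: power_int_def absv_power absv_inverse)

lemma absv_pp: "absv \<pp> = inverse (real q)"
  using absv_prime_element by (simp add: q_def field_simps)

lemma pp_neq_0 [simp]: "\<pp> \<noteq> 0"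
  using absv_pp q_neq_0 absv_eq_0_iff[of \<pp>] by auto

lemma absv_pp_powi: "absv (\<pp> powi n) = real q powi (- n)"
  by (simp add: absv_powi absv_pp power_int_inverse power_int_minus)

text \<open>
  The value group is generated by \<open>q\<close>: after multiplication by a power of \<open>\<pp>\<close> the absolute value lies in \<open>[1, q)\<close>,
  and a value strictly above 1 would make the inverse an element of the maximal ideal with absolute value
  above \<open>|\<pp>|\<close>.
\<close>

lemma absv_value:
  assumes "x \<noteq> 0"
  obtains n :: int where "absv x = real q powi n"
proof -
  have pos: "absv x > 0" using assms absv_nonneg[of x] absv_eq_0_iff[of x] by linarith
  define k where "k = \<lfloor>log (real q) (absv x)\<rfloor>"
  have "real q powr k \<le> absv x \<and> absv x < real q powr (k + 1)"
    using floor_log_eq_powr_iff[OF pos q_gt_1, of k] by (simp add: k_def)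
  then have k: "real q powi k \<le> absv x" "absv x < real q powi (k + 1)"
    using q_pos by (auto simp: powr_real_of_int' simp del: of_int_add simp flip: of_int_add)
  define y where "y = x * \<pp> powi k"
  have y: "absv y = absv x / real q powi k"
    by (simp add: y_def absv_mult absv_pp_powi power_int_minus divide_inverse)
  have qk: "real q powi k > 0" using q_pos by simp
  have y1: "1 \<le> absv y" using k(1) qk by (simp add: y)
  have y2: "absv y < real q"
    using k(2) qk q_neq_0 by (simp add: y power_int_add divide_less_eq mult.commute)
  have "absv y = 1"
  proof (rule ccontr)
    assume "absv y \<noteq> 1"
    with y1 have "inverse y \<in> max_ideal absv"
      by (simp add: max_ideal_def absv_inverse inverse_less_1_iff)
    then obtain z where z: "inverse y = \<pp> * z" "absv z \<le> 1"
      unfolding prime_element by (auto simp: integer_ring_def)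
    then have "inverse (absv y) \<le> inverse (real q)"
      using q_pos absv_nonneg[of z] by (simp flip: absv_inverse) (simp add: absv_mult absv_pp mult_left_le)
    then have "real q \<le> absv y" using y1 q_pos by (subst (asm) inverse_le_iff_le) auto
    with y2 show False by simp
  qed
  then have "absv x = real q powi k" using qk by (simp add: y field_simps)
  then show ?thesis by (rule that)
qed

lemma pideal_0: "pideal 0 = integer_ring absv"
  by (simp add: pideal_def integer_ring_def)

lemma mem_pideal_absv_powi: "absv x = real q powi m \<Longrightarrow> x \<in> pideal n \<longleftrightarrow> m \<le> - n"
  by (simp add: pideal_def)

lemma pideal_1: "pideal 1 = max_ideal absv"
proof (intro set_eqI)
  fix x show "x \<in> pideal 1 \<longleftrightarrow> x \<in> max_ideal absv"
  proof (cases "x = 0")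
    case False
    then obtain m where m: "absv x = real q powi m" by (rule absv_value)
    have "real q powi m < 1 \<longleftrightarrow> m < 0"
      using q_powi_less_iff[of m 0] by simp
    then show ?thesis using m mem_pideal_absv_powi[OF m, of 1] by (auto simp: max_ideal_def)
  qed (use q_pos in \<open>auto simp: pideal_def max_ideal_def\<close>)
qed

lemma zero_mem_pideal [simp]: "0 \<in> pideal n"
  using q_pos by (simp add: pideal_def)

lemma pideal_add: "x \<in> pideal n \<Longrightarrow> y \<in> pideal n \<Longrightarrow> x + y \<in> pideal n"
  unfolding pideal_def using absv_ultrametric[of x y] by auto

lemma pideal_minus_iff [simp]: "- x \<in> pideal n \<longleftrightarrow> x \<in> pideal n"
  by (simp add: pideal_def)

lemma pideal_diff: "x \<in> pideal n \<Longrightarrow> y \<in> pideal n \<Longrightarrow> x - y \<in> pideal n"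
  using pideal_add[of x n "- y"] by simp

lemma pideal_sum: "(\<And>i. i \<in> I \<Longrightarrow> f i \<in> pideal n) \<Longrightarrow> (\<Sum>i\<in>I. f i) \<in> pideal n"
  by (induction I rule: infinite_finite_induct) (auto intro: pideal_add)

lemma pideal_mult: "x \<in> pideal m \<Longrightarrow> y \<in> pideal n \<Longrightarrow> x * y \<in> pideal (m + n)"
  unfolding pideal_def using q_neq_0 absv_nonneg
  by (auto simp: absv_mult power_int_add power_int_minus power_int_diff divide_inverse intro!: mult_mono)

lemma pideal_antimono: "m \<le> n \<Longrightarrow> pideal n \<subseteq> pideal m"
proof
  fix x assume "m \<le> n" "x \<in> pideal n"
  moreover have "real q powi (- n) \<le> real q powi (- m)"
    using \<open>m \<le> n\<close> by simp
  ultimately show "x \<in> pideal m" by (auto simp: pideal_def simp del: q_powi_le_iff)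
qed

lemma pp_powi_mem: "\<pp> powi n \<in> pideal n"
  by (simp add: pideal_def absv_pp_powi)

lemma pp_powi_mult_mem_iff: "\<pp> powi n * x \<in> pideal m \<longleftrightarrow> x \<in> pideal (m - n)"
proof
  assume "\<pp> powi n * x \<in> pideal m"
  then have "\<pp> powi (- n) * (\<pp> powi n * x) \<in> pideal (- n + m)"
    by (rule pideal_mult[OF pp_powi_mem])
  then show "x \<in> pideal (m - n)" by (simp add: power_int_minus flip: mult.assoc)
next
  assume "x \<in> pideal (m - n)"
  from pideal_mult[OF pp_powi_mem[of n] this] show "\<pp> powi n * x \<in> pideal m" by simp
qed

lemma pp_mult_mem_iff: "\<pp> * x \<in> pideal m \<longleftrightarrow> x \<in> pideal (m - 1)"
  using pp_powi_mult_mem_iff[of 1 x m] by simp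

lemma inverse_pp_mult_mem_iff: "inverse \<pp> * x \<in> pideal m \<longleftrightarrow> x \<in> pideal (m + 1)"
  using pp_powi_mult_mem_iff[of "-1" x m] by (simp add: power_int_minus)

lemma of_nat_mem_pideal: "of_nat n \<in> pideal 0"
proof (induction n)
  case (Suc n)
  have "1 \<in> pideal 0" by (simp add: pideal_def)
  with Suc show ?case by (simp add: pideal_add)
qed simp

lemma eps_mem: "k < c \<Longrightarrow> \<epsilon> k \<in> pideal 0"
  using eps_units[of k] by (simp add: pideal_0)

lemma mem_some_pideal: "\<exists>N::nat. x \<in> pideal (- int N)"
proof -
  obtain N where "absv x < real q ^ N" using real_arch_pow[OF q_gt_1] by blast
  then show ?thesis by (intro exI[of _ N]) (simp add: pideal_def)
qed

section \<open>The coset representatives\<close>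

text \<open>
  Multiplication by \<open>\<pp>\<close> moves the digits \<open>u(0), ..., u(q - 1)\<close> into \<open>\<OO>\<close>, where they represent the
  residue field.
\<close>

lemma pp_digit: "\<pp> * digit b = (\<Sum>k<c. of_nat ((b div CHAR('a) ^ k) mod CHAR('a)) * \<epsilon> k)"
  by (simp add: u_digit_def)

lemma pp_digit_mem: "\<pp> * digit b \<in> pideal 0"
  unfolding pp_digit
  using pideal_mult[OF of_nat_mem_pideal eps_mem] by (auto intro!: pideal_sum)

lemma digit_mem: "digit b \<in> pideal (- 1)"
  using pp_digit_mem[of b] by (simp add: pp_mult_mem_iff)

lemma digit_0 [simp]: "digit 0 = 0"
  by (simp add: u_digit_def)

lemma digit_representative:
  assumes "y \<in> pideal 0"
  obtains b where "b < q" "y - \<pp> * digit b \<in> pideal 1"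
proof -
  let ?p = "CHAR('a)"
  obtain a :: "nat \<Rightarrow> int" where a: "y - (\<Sum>k<c. of_int (a k) * \<epsilon> k) \<in> max_ideal absv"
    using eps_spanning assms by (auto simp: pideal_0)
  define d where "d k = nat (a k mod int ?p)" for k
  have d: "d k < ?p" for k using char_pos by (simp add: d_def nat_less_iff)
  have ad: "(of_int (a k) :: 'a) = of_nat (d k)" for k
  proof -
    have "int (d k) = a k mod int ?p" using char_pos by (simp add: d_def)
    then have "a k = int ?p * (a k div int ?p) + int (d k)" by (simp add: mult_div_mod_eq)
    then have "(of_int (a k) :: 'a) = of_int (int ?p * (a k div int ?p) + int (d k))" by metis
    then show ?thesis by simp
  qed
  obtain b where b: "b < ?p ^ c" "\<forall>k<c. (b div ?p ^ k) mod ?p = d k"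
    using digits_exist[of c d ?p] d by blast
  have "(\<Sum>k<c. of_int (a k) * \<epsilon> k) = \<pp> * digit b"
    unfolding pp_digit using b(2) by (intro sum.cong) (auto simp: ad)
  with a b(1) show ?thesis by (intro that[of b]) (auto simp: q_def pideal_1)
qed

lemma digit_unique:
  assumes "b < q" "b' < q" "\<pp> * digit b - \<pp> * digit b' \<in> pideal 1"
  shows "b = b'"
proof (rule digits_inject[of b "CHAR('a)" c b'])
  let ?p = "CHAR('a)"
  let ?a = "\<lambda>k. int ((b div ?p ^ k) mod ?p) - int ((b' div ?p ^ k) mod ?p)"
  have "(\<Sum>k<c. of_int (?a k) * \<epsilon> k) = \<pp> * digit b - \<pp> * digit b'"
    unfolding pp_digit by (simp add: left_diff_distrib sum_subtractf)
  with assms(3) have "\<forall>k<c. int ?p dvd ?a k"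
    by (intro eps_independent) (simp add: pideal_1)
  then have "int ((b div ?p ^ k) mod ?p) mod int ?p = int ((b' div ?p ^ k) mod ?p) mod int ?p" if "k < c" for k
    using that by (subst mod_eq_dvd_iff) blast
  then show "(b div ?p ^ k) mod ?p = (b' div ?p ^ k) mod ?p" if "k < c" for k
    using that by (simp flip: zmod_int)
qed (use assms in \<open>auto simp: q_def\<close>)

text \<open>
  The upper limit of the defining sum may be any bound for \<open>n\<close>, because \<open>n < q\<^sup>n\<close> makes the later digits vanish.
  Inductions on the number of digits need this freedom.
\<close>

lemma rep_eq:
  assumes "n \<le> N"
  shows "rep n = (\<Sum>k<N. digit ((n div q ^ k) mod q) * inverse \<pp> ^ k)"
proof -
  have z: "n div q ^ k = 0" if "n \<le> k" for k
  proof -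
    have "k < 2 ^ k" by (rule less_exp)
    also have "(2::nat) ^ k \<le> q ^ k" using q_ge_2 by (rule power_mono) simp
    finally show ?thesis using that by simp
  qed
  have "rep n = (\<Sum>k\<le>n. digit ((n div q ^ k) mod q) * inverse \<pp> ^ k)"
    unfolding u_def q_def Let_def ..
  also have "\<dots> = (\<Sum>k<n. digit ((n div q ^ k) mod q) * inverse \<pp> ^ k)"
    using z[of n] by (intro sum.mono_neutral_right) (auto simp: not_less dest: le_antisym)
  also have "\<dots> = (\<Sum>k<N. digit ((n div q ^ k) mod q) * inverse \<pp> ^ k)"
    using assms z by (intro sum.mono_neutral_left) auto
  finally show ?thesis .
qed

text \<open>
  Everything about the \<open>u(n)\<close> below is proved by induction along this recursion, which splits off the last
  digit.
\<close>

lemma rep_rec: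
  assumes "b < q"
  shows "rep (b + q * m) = digit b + inverse \<pp> * rep m"
proof -
  define N where "N = b + q * m"
  have "m \<le> N" using q_ge_2 by (simp add: N_def trans_le_add2)
  have "rep (b + q * m) = (\<Sum>k<Suc N. digit (((b + q * m) div q ^ k) mod q) * inverse \<pp> ^ k)"
    by (rule rep_eq) (simp add: N_def)
  also have "\<dots> = digit b + (\<Sum>k<N. digit (((b + q * m) div q ^ Suc k) mod q) * inverse \<pp> ^ Suc k)"
    using assms by (subst sum.lessThan_Suc_shift) simp
  also have "(\<Sum>k<N. digit (((b + q * m) div q ^ Suc k) mod q) * inverse \<pp> ^ Suc k)
      = inverse \<pp> * (\<Sum>k<N. digit ((m div q ^ k) mod q) * inverse \<pp> ^ k)"
    using assms by (simp add: sum_distrib_left div_mult2_eq mult_ac)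
  also have "(\<Sum>k<N. digit ((m div q ^ k) mod q) * inverse \<pp> ^ k) = rep m"
    by (rule rep_eq[symmetric]) (use \<open>m \<le> N\<close> in simp)
  finally show ?thesis .
qed

lemma rep_0 [simp]: "rep 0 = 0"
  using rep_eq[of 0 0] by simp

text \<open>
  Multiplying by \<open>\<pp>\<close> shortens the expansion by one digit; the remainder in \<open>\<OO>\<close> is a
  residue class and thus a digit.
\<close>

lemma rep_exists_below:
  "x \<in> pideal (- int n) \<Longrightarrow> \<exists>k<q ^ n. x - rep k \<in> pideal 0"
proof (induction n arbitrary: x)
  case (Suc n)
  have "- int n - 1 = - int (Suc n)" by simp
  then have "\<pp> * x \<in> pideal (- int n)" using Suc.prems by (simp only: pp_mult_mem_iff)
  then obtain m where m: "m < q ^ n" "\<pp> * x - rep m \<in> pideal 0" using Suc.IH by blast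
  then obtain b where b: "b < q" "\<pp> * x - rep m - \<pp> * digit b \<in> pideal 1"
    using digit_representative by blast
  have "\<pp> * x - rep m - \<pp> * digit b = \<pp> * (x - rep (b + q * m))"
    unfolding rep_rec[OF b(1)] by (simp add: field_simps)
  with b(2) have "x - rep (b + q * m) \<in> pideal 0" by (simp only: pp_mult_mem_iff) simp
  moreover have "b + q * m < q ^ Suc n"
  proof -
    have "b + q * m < q * Suc m" using b(1) by simp
    also have "\<dots> \<le> q * q ^ n" using m(1) by (intro mult_le_mono2) simp
    finally show ?thesis by simp
  qed
  ultimately show ?case by blast
qed auto

lemma rep_exists: obtains k where "x - rep k \<in> pideal 0"
  using mem_some_pideal[of x] rep_exists_below by metis

text \<open>
  After multiplication by \<open>\<pp>\<close> the last digits become integral, so the remaining parts agree by induction; the last digits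
  then represent the same residue class.
\<close>

lemma rep_unique:
  assumes "rep k - rep l \<in> pideal 0"
  shows "k = l"
proof -
  have "k < q ^ n \<Longrightarrow> l < q ^ n \<Longrightarrow> rep k - rep l \<in> pideal 0 \<Longrightarrow> k = l" for n
  proof (induction n arbitrary: k l)
    case (Suc n)
    define b m b' m' where "b = k mod q" "m = k div q" "b' = l mod q" "m' = l div q"
    note d = this
    have k: "k = b + q * m" and l: "l = b' + q * m'" and b: "b < q" "b' < q"
      using q_ge_2 by (auto simp: d)
    have m: "m < q ^ n" "m' < q ^ n"
      using Suc.prems by (auto simp: d less_mult_imp_div_less mult.commute)
    have e: "\<pp> * (rep k - rep l) = (\<pp> * digit b - \<pp> * digit b') + (rep m - rep m')"
      unfolding k l rep_rec[OF b(1)] rep_rec[OF b(2)] by (simp add: field_simps)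
    have e1: "\<pp> * (rep k - rep l) \<in> pideal 1" using Suc.prems(3) by (simp add: pp_mult_mem_iff)
    then have "\<pp> * (rep k - rep l) \<in> pideal 0" using pideal_antimono[of 0 1] by auto
    then have "\<pp> * (rep k - rep l) - (\<pp> * digit b - \<pp> * digit b') \<in> pideal 0"
      by (intro pideal_diff pp_digit_mem)
    then have "rep m - rep m' \<in> pideal 0" by (simp add: e)
    with Suc.IH m have mm: "m = m'" by blast
    with e e1 have "\<pp> * digit b - \<pp> * digit b' \<in> pideal 1" by simp
    with digit_unique b have "b = b'" by blast
    with mm show ?case by (simp add: k l)
  qed auto
  moreover have "k < q ^ (k + l + 1)" "l < q ^ (k + l + 1)"
  proof -
    have "k + l + 1 < 2 ^ (k + l + 1)" by (rule less_exp)
    also have "(2::nat) ^ (k + l + 1) \<le> q ^ (k + l + 1)" using q_ge_2 by (rule power_mono) simp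
    finally show "k < q ^ (k + l + 1)" "l < q ^ (k + l + 1)" by auto
  qed
  ultimately show ?thesis using assms by blast
qed

lemma rep_mem_below: "k < q ^ n \<Longrightarrow> rep k \<in> pideal (- int n)"
proof (induction n arbitrary: k)
  case (Suc n)
  define b m where "b = k mod q" "m = k div q"
  have k: "k = b + q * m" and b: "b < q" using q_ge_2 by (auto simp: b_m_def)
  have "rep m \<in> pideal (- int n)"
    using Suc by (auto simp: b_m_def less_mult_imp_div_less mult.commute)
  then have "inverse \<pp> * rep m \<in> pideal (- int (Suc n))"
    by (simp add: inverse_pp_mult_mem_iff)
  moreover have "digit b \<in> pideal (- int (Suc n))"
    using digit_mem[of b] pideal_antimono[of "- int (Suc n)" "- 1"] by auto
  ultimately show ?case unfolding k rep_rec[OF b] by (intro pideal_add)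
qed auto

section \<open>Character sums\<close>

lemma chi_0 [simp]: "chi 0 = 1"
  by (rule char_trivial) (simp add: integer_ring_def)

lemma chi_pideal: "x \<in> pideal 0 \<Longrightarrow> chi x = 1"
  using char_trivial by (simp add: pideal_0)

lemma chi_sum: "chi (\<Sum>i\<in>I. f i) = (\<Prod>i\<in>I. chi (f i))"
  by (induction I rule: infinite_finite_induct) (auto simp: char_add)

lemma chi_of_nat_mult: "chi (of_nat n * x) = chi x ^ n"
  by (induction n) (auto simp: char_add distrib_right)

lemma chi_neq_0 [simp]: "chi x \<noteq> 0"
  using char_norm[of x] by auto

lemma chi_minus: "chi (- x) = cnj (chi x)"
proof -
  have "chi x * chi (- x) = 1" by (simp flip: char_add)
  moreover have "chi x * cnj (chi x) = 1"
    using char_norm[of x] by (metis complex_norm_square of_real_1 one_power2)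
  ultimately show ?thesis by (metis chi_neq_0 mult_left_cancel)
qed

lemma chi_diff: "chi (x - y) = chi x * cnj (chi y)"
  using char_add[of x "- y"] by (simp add: chi_minus)

text \<open>
  If all these values were 1, then \<open>y \<mapsto> \<chi>(\<pp>\<^sup>-\<^sup>1xy)\<close> would be trivial on \<open>\<OO>\<close>, because the \<open>\<epsilon>\<^sub>j\<close> generate \<open>\<OO>\<close>
  modulo \<open>\<PP>\<close>. As \<open>x\<close> is a unit, \<open>\<chi>\<close> would be trivial on \<open>\<pp>\<^sup>-\<^sup>1\<OO>\<close>.
\<close>

lemma chi_nontrivial_unit:
  assumes "x \<in> pideal 0" "x \<notin> pideal 1"
  shows "\<exists>j<c. chi (\<epsilon> j * inverse \<pp> * x) \<noteq> 1"
proof (rule ccontr)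
  assume "\<not> ?thesis"
  then have *: "chi (\<epsilon> j * inverse \<pp> * x) = 1" if "j < c" for j using that by blast
  obtain t where t: "t \<in> pideal 0" "chi (inverse \<pp> * t) \<noteq> 1"
    using char_nontrivial by (auto simp: pideal_0)
  have x: "absv x = 1" using assms by (auto simp: pideal_0 pideal_1 integer_ring_def max_ideal_def)
  then have x0: "x \<noteq> 0" by auto
  \<comment> \<open>an element at which the character would have to take the nontrivial value\<close>
  define y where "y = t * inverse x"
  have "y \<in> pideal 0"
    using t(1) by (simp add: y_def pideal_def absv_mult absv_inverse x)
  then obtain b where b: "y - \<pp> * digit b \<in> pideal 1" by (rule digit_representative)
  have "\<pp> * digit b * (inverse \<pp> * x)
      = (\<Sum>k<c. of_nat ((b div CHAR('a) ^ k) mod CHAR('a)) * (\<epsilon> k * inverse \<pp> * x))"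
    unfolding pp_digit by (simp add: sum_distrib_right mult.assoc)
  then have d: "chi (\<pp> * digit b * (inverse \<pp> * x)) = 1"
    by (simp add: chi_sum chi_of_nat_mult *)
  have "(y - \<pp> * digit b) * (inverse \<pp> * x) \<in> pideal (1 + (- 1))"
    using assms(1) by (intro pideal_mult b) (simp add: inverse_pp_mult_mem_iff)
  then have "chi ((y - \<pp> * digit b) * (inverse \<pp> * x)) = 1" by (simp add: chi_pideal)
  with d have "chi (y * (inverse \<pp> * x)) = 1"
    by (simp add: left_diff_distrib chi_diff)
  moreover have "y * (inverse \<pp> * x) = inverse \<pp> * t" using x0 by (simp add: y_def)
  ultimately show False using t(2) by simp
qed

text \<open>
  The sum factors over the \<open>c\<close> base-\<open>p\<close> digits. Each factor is a geometric sum in a \<open>p\<close>-th root of unity, hence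
  \<open>p\<close> or 0, and for a unit \<open>x\<close> some root is nontrivial.
\<close>

lemma digit_character_sum:
  assumes "x \<in> pideal 0"
  shows "(\<Sum>b<q. chi (digit b * x)) = (if x \<in> pideal 1 then of_nat q else 0)"
proof -
  define z where "z j = chi (\<epsilon> j * inverse \<pp> * x)" for j
  have zp: "z j ^ CHAR('a) = 1" for j
    unfolding z_def by (simp flip: chi_of_nat_mult)
  have "chi (digit b * x) = (\<Prod>j<c. z j ^ ((b div CHAR('a) ^ j) mod CHAR('a)))" for b
  proof -
    have "digit b * x = (\<Sum>k<c. of_nat ((b div CHAR('a) ^ k) mod CHAR('a)) * (\<epsilon> k * inverse \<pp> * x))"
      by (simp add: u_digit_def sum_distrib_right mult.assoc)
    then show ?thesis by (simp add: chi_sum chi_of_nat_mult z_def)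
  qed
  then have "(\<Sum>b<q. chi (digit b * x)) = (\<Prod>j<c. \<Sum>a<CHAR('a). z j ^ a)"
    by (simp add: q_def sum_digit_products)
  also have "\<dots> = (\<Prod>j<c. if z j = 1 then of_nat CHAR('a) else 0)"
    by (simp add: geometric_sum_root_of_unity zp)
  also have "\<dots> = (if x \<in> pideal 1 then of_nat q else 0)"
  proof (cases "x \<in> pideal 1")
    case True
    have "z j = 1" if "j < c" for j
    proof -
      have "\<epsilon> j * (inverse \<pp> * x) \<in> pideal (0 + 0)"
        using True that by (intro pideal_mult eps_mem) (simp_all add: inverse_pp_mult_mem_iff)
      then show ?thesis by (simp add: z_def chi_pideal mult.assoc)
    qed
    then show ?thesis using True by (simp add: q_def)
  next
    case False
    then show ?thesis using chi_nontrivial_unit[OF assms] by (auto simp: z_def)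
  qed
  finally show ?thesis .
qed

text \<open>
  The elements \<open>u(k)\<close>, \<open>k < q\<^sup>n\<close>, represent \<open>\<PP>\<^sup>-\<^sup>n / \<OO>\<close>, whose dual is \<open>\<OO> / \<PP>\<^sup>n\<close>; this is the
  orthogonality relation between the two, proved one digit at a time.
\<close>

lemma character_sum:
  "x \<in> pideal 0 \<Longrightarrow> (\<Sum>k<q ^ n. chi (rep k * x)) = (if x \<in> pideal (int n) then of_nat (q ^ n) else 0)"
proof (induction n arbitrary: x)
  case (Suc n)
  let ?y = "inverse \<pp> * x"
  have "(\<Sum>k<q ^ Suc n. chi (rep k * x)) = (\<Sum>m<q ^ n. \<Sum>b<q. chi (rep (b + q * m) * x))"
    by (simp add: sum_lessThan_mult)
  also have "\<dots> = (\<Sum>m<q ^ n. \<Sum>b<q. chi (digit b * x) * chi (rep m * ?y))"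
  proof (intro sum.cong refl)
    fix m b assume "b \<in> {..<q}"
    then have "rep (b + q * m) = digit b + inverse \<pp> * rep m" by (intro rep_rec) simp
    then show "chi (rep (b + q * m) * x) = chi (digit b * x) * chi (rep m * ?y)"
      by (simp only: distrib_right char_add) (simp only: mult_ac)
  qed
  also have "\<dots> = (\<Sum>b<q. chi (digit b * x)) * (\<Sum>m<q ^ n. chi (rep m * ?y))"
    by (simp add: sum_product sum.swap[of _ "{..<q}"])
  also have "\<dots> = (if x \<in> pideal (int (Suc n)) then of_nat (q ^ Suc n) else 0)"
  proof (cases "x \<in> pideal 1")
    case True
    then have "?y \<in> pideal 0" by (simp add: inverse_pp_mult_mem_iff)
    with Suc.IH[of ?y] True Suc.prems show ?thesis
      by (simp add: digit_character_sum inverse_pp_mult_mem_iff add.commute)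
  next
    case False
    then have "x \<notin> pideal (int (Suc n))" using pideal_antimono[of 1 "int (Suc n)"] by auto
    with False show ?thesis by (simp add: digit_character_sum Suc.prems)
  qed
  finally show ?case .
qed simp

text \<open>
  The characters \<open>\<chi>(u(k)\<cdot>)\<close> are \<open>\<Lambda>\<close>-periodic; here the normalisation \<open>\<chi>(u(k)u(l)) = 1\<close> enters.
\<close>

lemma chi_rep_periodic: "chi (rep k * (x - rep l)) = chi (rep k * x)"
  by (simp add: right_diff_distrib chi_diff char_u)

section \<open>Cosets generate the Borel sets\<close>

definition coset :: "'a \<Rightarrow> int \<Rightarrow> 'a set" where
  "coset a n = {x. x - a \<in> pideal n}"

lemma coset_0: "coset 0 n = pideal n"
  by (simp add: coset_def)

lemma mem_coset_self [simp]: "a \<in> coset a n"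
  by (simp add: coset_def)

lemma coset_eq: "b \<in> coset a n \<Longrightarrow> coset b n = coset a n"
proof (intro set_eqI)
  fix x assume "b \<in> coset a n"
  then have b: "b - a \<in> pideal n" by (simp add: coset_def)
  show "x \<in> coset b n \<longleftrightarrow> x \<in> coset a n"
    using pideal_add[OF _ b, of "x - b"] pideal_diff[OF _ b, of "x - a"] by (auto simp: coset_def)
qed

lemma coset_mono: "m \<le> n \<Longrightarrow> coset a n \<subseteq> coset a m"
  using pideal_antimono[of m n] by (auto simp: coset_def)

lemma coset_disjoint_or_subset:
  assumes "m \<le> n"
  shows "coset a n \<inter> coset b m = {} \<or> coset a n \<subseteq> coset b m"
proof (cases "coset a n \<inter> coset b m = {}")
  case False
  then obtain x where x: "x \<in> coset a n" "x \<in> coset b m" by blast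
  have "coset a n = coset x n" using coset_eq[OF x(1)] by simp
  also have "\<dots> \<subseteq> coset x m" by (rule coset_mono[OF assms])
  also have "\<dots> = coset b m" by (rule coset_eq[OF x(2)])
  finally show ?thesis by blast
qed simp

lemma open_coset: "open (coset a n)"
  unfolding absv_topology
proof (intro ballI exI conjI allI impI)
  fix x y assume x: "x \<in> coset a n" and y: "absv (y - x) < real q powi (- n)"
  have "(y - x) + (x - a) \<in> pideal n"
    using x y by (intro pideal_add) (auto simp: coset_def pideal_def)
  then show "y \<in> coset a n" by (simp add: coset_def)
qed (use q_pos in simp)

lemma open_contains_coset:
  assumes "open S" "x \<in> S"
  obtains n :: nat where "coset x (int n) \<subseteq> S"
proof -
  obtain e where e: "e > 0" "\<And>y. absv (y - x) < e \<Longrightarrow> y \<in> S"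
    using assms unfolding absv_topology by blast
  obtain n where n: "(inverse (real q)) ^ n < e"
    using real_arch_pow_inv[OF e(1), of "inverse (real q)"] q_gt_1 by (auto simp: inverse_less_1_iff)
  have "real q powi (- int n) < e" using n by (simp add: power_int_minus power_inverse)
  then have "coset x (int n) \<subseteq> S"
    using e(2) by (auto simp: coset_def pideal_def)
  then show ?thesis by (rule that)
qed

text \<open>
  For every \<open>n\<close> there are only countably many cosets of \<open>\<PP>\<^sup>n\<close>.
\<close>

lemma coset_representative: obtains k where "coset x n = coset (\<pp> powi n * rep k) n"
proof -
  obtain k where "\<pp> powi (- n) * x - rep k \<in> pideal 0" by (rule rep_exists)
  then have "\<pp> powi n * (\<pp> powi (- n) * x - rep k) \<in> pideal n"
    by (simp add: pp_powi_mult_mem_iff)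
  then have "x \<in> coset (\<pp> powi n * rep k) n"
    by (simp add: coset_def right_diff_distrib power_int_minus flip: mult.assoc)
  then show ?thesis using coset_eq that by blast
qed

text \<open>
  The empty set is included to obtain closure under intersection: two cosets are nested or disjoint.
\<close>

definition small_cosets :: "'a set set" where
  "small_cosets = insert {} {coset a (int n) | a n. True}"

lemma Int_stable_small_cosets: "Int_stable small_cosets"
proof (rule Int_stableI)
  have *: "coset a (int n) \<inter> coset b (int m) \<in> small_cosets" for a b m n
  proof (cases "m \<le> n")
    case True
    then show ?thesis using coset_disjoint_or_subset[of "int m" "int n" a b]
      by (auto simp: small_cosets_def Int_absorb2)
  next
    case False
    then show ?thesis using coset_disjoint_or_subset[of "int n" "int m" b a]
      by (auto simp: small_cosets_def Int_absorb1 Int_commute)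
  qed
  show "A \<inter> B \<in> small_cosets" if "A \<in> small_cosets" "B \<in> small_cosets" for A B
  proof -
    have "A = {} \<or> (\<exists>a n. A = coset a (int n))" "B = {} \<or> (\<exists>b m. B = coset b (int m))"
      using that by (auto simp: small_cosets_def)
    moreover have "{} \<in> small_cosets" by (simp add: small_cosets_def)
    ultimately show ?thesis using * by (elim disjE exE) simp_all
  qed
qed

text \<open>
  Every open set is a union of cosets, and by \<open>coset_representative\<close> of countably many.
\<close>

lemma sets_borel_cosets: "sets (borel :: 'a measure) = sigma_sets UNIV small_cosets"
proof
  have "S \<in> sigma_sets UNIV small_cosets" if S: "open S" for S :: "'a set"
  proof -
    define I where "I = {(n, k). coset (\<pp> powi int n * rep k) (int n) \<subseteq> S}"
    have "S = (\<Union>(n, k)\<in>I. coset (\<pp> powi int n * rep k) (int n))"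
    proof (intro equalityI subsetI)
      fix x assume "x \<in> S"
      then obtain n where "coset x (int n) \<subseteq> S" using open_contains_coset[OF S] by blast
      moreover obtain k where "coset x (int n) = coset (\<pp> powi int n * rep k) (int n)"
        by (rule coset_representative)
      ultimately show "x \<in> (\<Union>(n, k)\<in>I. coset (\<pp> powi int n * rep k) (int n))"
        unfolding I_def using mem_coset_self[of x "int n"] by blast
    qed (auto simp: I_def)
    moreover have "(\<Union>i\<in>I. (\<lambda>(n, k). coset (\<pp> powi int n * rep k) (int n)) i) \<in> sigma_sets UNIV small_cosets"
      by (intro sigma_sets_UNION) (auto simp: small_cosets_def intro!: sigma_sets.Basic)
    ultimately show ?thesis by simp
  qed
  then show "sets (borel :: 'a measure) \<subseteq> sigma_sets UNIV small_cosets"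
    unfolding borel_def by (auto intro!: sigma_sets_mono)
  have "small_cosets \<subseteq> sets (borel :: 'a measure)"
    using open_coset by (auto simp: small_cosets_def)
  then show "sigma_sets UNIV small_cosets \<subseteq> sets (borel :: 'a measure)"
    using sets.sigma_sets_subset[of small_cosets "borel :: 'a measure"] by simp
qed

lemma UN_unit_cosets: "(\<Union>k. coset (rep k) 0) = UNIV"
  using rep_exists by (auto simp: coset_def) metis

lemma unit_cosets_disjoint: "disjoint_family (\<lambda>k. coset (rep k) 0)"
  unfolding disjoint_family_on_def
proof (intro ballI impI)
  fix k l :: nat assume "k \<noteq> l"
  have "False" if "x \<in> coset (rep k) 0" "x \<in> coset (rep l) 0" for x
  proof -
    have "(x - rep l) - (x - rep k) \<in> pideal 0" using that by (intro pideal_diff[of "x - rep l"]) (simp_all only: coset_def mem_Collect_eq)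
    then have "k = l" by (intro rep_unique) simp
    with \<open>k \<noteq> l\<close> show False by simp
  qed
  then show "coset (rep k) 0 \<inter> coset (rep l) 0 = {}" by blast
qed

section \<open>Haar measure\<close>

lemmas [measurable_cong] = haar_sets

lemma space_haar [simp]: "space \<mu> = UNIV"
  using sets_eq_imp_space_eq[OF haar_sets] by simp

lemma measurable_coset [measurable]: "coset a n \<in> sets \<mu>"
  unfolding haar_sets by (intro borel_open open_coset)

lemma measurable_pideal [measurable]: "pideal n \<in> sets \<mu>"
  using measurable_coset[of 0 n] by (simp add: coset_0)

lemma measurable_chi [measurable]: "chi \<in> borel_measurable borel"
  by (intro borel_measurable_continuous_onI char_continuous)

lemma measurable_mult_left [measurable]: "(\<lambda>x. a * x) \<in> borel_measurable (borel :: 'a measure)"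
  by (intro borel_measurable_continuous_onI, unfold continuous_on_def) (intro ballI tendsto_mult tendsto_const tendsto_ident_at)

lemma measurable_add_left [measurable]: "(\<lambda>x. a + x) \<in> borel_measurable (borel :: 'a measure)"
  by (intro borel_measurable_continuous_onI continuous_intros)

lemma measurable_diff_right [measurable]: "(\<lambda>x. x - a) \<in> borel_measurable (borel :: 'a measure)"
  by (intro borel_measurable_continuous_onI continuous_intros)

lemma distr_translation: "distr \<mu> \<mu> (\<lambda>x. a + x) = \<mu>"
proof (rule measure_eqI)
  fix E assume "E \<in> sets (distr \<mu> \<mu> (\<lambda>x. a + x))"
  then have E: "E \<in> sets borel" by (simp add: haar_sets)
  have "(\<lambda>x. a + x) -` E = (\<lambda>x. - a + x) ` E"
    by (auto simp: image_iff algebra_simps)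
  then show "emeasure (distr \<mu> \<mu> (\<lambda>x. a + x)) E = emeasure \<mu> E"
    using E haar_invariant[OF E, of "- a"] by (subst emeasure_distr) (auto simp: haar_sets)
qed simp

lemma nn_integral_translation:
  assumes [measurable]: "f \<in> borel_measurable \<mu>"
  shows "(\<integral>\<^sup>+x. f (a + x) \<partial>\<mu>) = (\<integral>\<^sup>+x. f x \<partial>\<mu>)"
  using nn_integral_distr[of "\<lambda>x. a + x" \<mu> \<mu> f] by (simp add: distr_translation)

lemma integral_translation:
  fixes f :: "'a \<Rightarrow> complex"
  assumes [measurable]: "f \<in> borel_measurable \<mu>"
  shows "(\<integral>x. f (a + x) \<partial>\<mu>) = (\<integral>x. f x \<partial>\<mu>)"
  using integral_distr[of "\<lambda>x. a + x" \<mu> \<mu> f] by (simp add: distr_translation)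

lemma integrable_translation:
  fixes f :: "'a \<Rightarrow> 'b::{banach,second_countable_topology}"
  assumes "integrable \<mu> f"
  shows "integrable \<mu> (\<lambda>x. f (a + x))"
  using assms integrable_distr[of "\<lambda>x. a + x" \<mu> \<mu> f] by (simp add: distr_translation)

lemma emeasure_coset_pideal: "emeasure \<mu> (coset a n) = emeasure \<mu> (pideal n)"
proof -
  have "coset a n = (\<lambda>y. a + y) ` pideal n"
  proof (intro set_eqI iffI)
    fix x assume "x \<in> coset a n"
    then show "x \<in> (\<lambda>y. a + y) ` pideal n" by (intro image_eqI[of _ _ "x - a"]) (auto simp: coset_def)
  qed (auto simp: coset_def)
  then show ?thesis using haar_invariant[of "pideal n" a] measurable_pideal[of n] by (simp add: haar_sets)
qed

lemma pp_powi_cancel: "\<pp> powi m * (\<pp> powi (- m) * x) = x"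
  by (simp add: power_int_minus flip: mult.assoc)

text \<open>
  Scaled by \<open>\<pp>\<^sup>n\<^sup>+\<^sup>N\<close>, the elements \<open>u(k)\<close>, \<open>k < q\<^sup>N\<close>, represent the cosets of \<open>\<PP>\<^sup>n\<^sup>+\<^sup>N\<close> in \<open>\<PP>\<^sup>n\<close>.
\<close>

lemma pideal_partition:
  "pideal n = (\<Union>k<q ^ N. coset (\<pp> powi (n + int N) * rep k) (n + int N))"
proof (intro equalityI subsetI)
  fix x assume "x \<in> pideal n"
  then have "\<pp> powi (- (n + int N)) * x \<in> pideal (- int N)" by (simp add: pp_powi_mult_mem_iff)
  then obtain k where k: "k < q ^ N" "\<pp> powi (- (n + int N)) * x - rep k \<in> pideal 0"
    using rep_exists_below by blast
  then have "\<pp> powi (n + int N) * (\<pp> powi (- (n + int N)) * x - rep k) \<in> pideal (n + int N)"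
    by (simp only: pp_powi_mult_mem_iff) simp
  then have "x \<in> coset (\<pp> powi (n + int N) * rep k) (n + int N)"
    unfolding coset_def right_diff_distrib pp_powi_cancel by simp
  with k show "x \<in> (\<Union>k<q ^ N. coset (\<pp> powi (n + int N) * rep k) (n + int N))" by blast
next
  fix x assume "x \<in> (\<Union>k<q ^ N. coset (\<pp> powi (n + int N) * rep k) (n + int N))"
  then obtain k where k: "k < q ^ N" "x - \<pp> powi (n + int N) * rep k \<in> pideal (n + int N)"
    by (auto simp: coset_def)
  have "\<pp> powi (n + int N) * rep k \<in> pideal n"
    using rep_mem_below[OF k(1)] by (simp add: pp_powi_mult_mem_iff)
  moreover have "x - \<pp> powi (n + int N) * rep k \<in> pideal n"
    using k(2) pideal_antimono[of n "n + int N"] by auto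
  ultimately have "(x - \<pp> powi (n + int N) * rep k) + \<pp> powi (n + int N) * rep k \<in> pideal n"
    by (intro pideal_add)
  then show "x \<in> pideal n" by simp
qed

lemma scaled_cosets_disjoint: "disjoint_family (\<lambda>k. coset (\<pp> powi n * rep k) n)"
  unfolding disjoint_family_on_def
proof (intro ballI impI)
  fix k l :: nat assume "k \<noteq> l"
  have "False" if "x \<in> coset (\<pp> powi n * rep k) n" "x \<in> coset (\<pp> powi n * rep l) n" for x
  proof -
    have "(x - \<pp> powi n * rep l) - (x - \<pp> powi n * rep k) \<in> pideal n"
      using that by (intro pideal_diff[of "x - \<pp> powi n * rep l"]) (simp_all only: coset_def mem_Collect_eq)
    then have "\<pp> powi n * (rep k - rep l) \<in> pideal n" by (simp add: algebra_simps)
    then have "k = l" by (intro rep_unique) (simp add: pp_powi_mult_mem_iff)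
    with \<open>k \<noteq> l\<close> show False by simp
  qed
  then show "coset (\<pp> powi n * rep k) n \<inter> coset (\<pp> powi n * rep l) n = {}" by blast
qed

lemma emeasure_pideal_step: "emeasure \<mu> (pideal n) = of_nat (q ^ N) * emeasure \<mu> (pideal (n + int N))"
proof -
  have "emeasure \<mu> (pideal n) = (\<Sum>k<q ^ N. emeasure \<mu> (coset (\<pp> powi (n + int N) * rep k) (n + int N)))"
    unfolding pideal_partition[of n N]
    by (rule sum_emeasure[symmetric])
       (auto intro: disjoint_family_on_mono[OF _ scaled_cosets_disjoint])
  then show ?thesis by (simp add: emeasure_coset_pideal)
qed

text \<open>
  For \<open>n \<ge> 0\<close> the ring \<open>\<OO>\<close> is divided into \<open>q\<^sup>n\<close> translates of \<open>\<PP>\<^sup>n\<close>; for \<open>n < 0\<close> the roles are exchanged.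
\<close>

lemma emeasure_pideal: "emeasure \<mu> (pideal n) = ennreal (real q powi (- n))"
proof (cases "n \<ge> 0")
  case True
  then obtain N where n: "n = int N" using nonneg_int_cases by blast
  have "1 = of_nat (q ^ N) * emeasure \<mu> (pideal n)"
    using emeasure_pideal_step[of 0 N] haar_normalised by (simp add: pideal_0 n)
  then have e: "ennreal (real (q ^ N)) * emeasure \<mu> (pideal n) = ennreal (real (q ^ N)) * ennreal (inverse (real (q ^ N)))"
    using q_pos by (simp add: ennreal_mult[symmetric] ennreal_of_nat_eq_real_of_nat del: of_nat_power)
  have "emeasure \<mu> (pideal n) = ennreal (inverse (real (q ^ N)))"
    using e q_pos by (subst (asm) ennreal_mult_cancel_left) auto
  then show ?thesis by (simp add: n power_int_minus)
next
  case False
  then obtain N where n: "n = - int N" by (metis int_cases4 less_imp_le neg_0_le_iff_le of_nat_0_le_iff not_le)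
  show ?thesis
    using emeasure_pideal_step[of n N] haar_normalised
    by (simp add: pideal_0 n ennreal_of_nat_eq_real_of_nat del: of_nat_power)
qed

lemma emeasure_coset: "emeasure \<mu> (coset a n) = ennreal (real q powi (- n))"
  by (simp add: emeasure_coset_pideal emeasure_pideal)

lemma measure_coset: "measure \<mu> (coset a n) = real q powi (- n)"
  using q_pos by (simp add: measure_def emeasure_coset)

lemma sigma_finite_haar: "sigma_finite_measure \<mu>"
proof
  show "\<exists>A. countable A \<and> A \<subseteq> sets \<mu> \<and> \<Union>A = space \<mu> \<and> (\<forall>a\<in>A. emeasure \<mu> a \<noteq> \<infinity>)"
    by (intro exI[of _ "range (\<lambda>k. coset (rep k) 0)"]) (auto simp: UN_unit_cosets emeasure_coset)
qed

sublocale haar: sigma_finite_measure \<mu>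
  by (rule sigma_finite_haar)

text \<open>
  Both measures are invariant and agree on cosets, which form an intersection-stable generator of the Borel sets.
\<close>

lemma distr_scaling: "distr \<mu> \<mu> (\<lambda>x. \<pp> powi j * x) = density \<mu> (\<lambda>_. ennreal (real q powi j))"
proof (rule measure_eqI_generator_eq[where E=small_cosets and \<Omega>=UNIV and A="\<lambda>k. coset (rep k) 0"])
  have c: "emeasure (distr \<mu> \<mu> (\<lambda>x. \<pp> powi j * x)) (coset a n) = ennreal (real q powi (j - n))" for a n
  proof -
    have "\<pp> powi j * x - a \<in> pideal n \<longleftrightarrow> x - \<pp> powi (- j) * a \<in> pideal (n - j)" for x
    proof -
      have "\<pp> powi j * x - a = \<pp> powi j * (x - \<pp> powi (- j) * a)"
        by (simp add: right_diff_distrib power_int_minus flip: mult.assoc)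
      then show ?thesis by (simp only: pp_powi_mult_mem_iff)
    qed
    then have "(\<lambda>x. \<pp> powi j * x) -` coset a n = coset (\<pp> powi (- j) * a) (n - j)"
      by (auto simp: coset_def)
    then show ?thesis by (subst emeasure_distr) (auto simp: emeasure_coset)
  qed
  have d: "emeasure (density \<mu> (\<lambda>_. ennreal (real q powi j))) (coset a n) = ennreal (real q powi (j - n))" for a n
    using q_pos by (simp add: emeasure_density_const emeasure_coset power_int_diff power_int_minus
        divide_inverse flip: ennreal_mult)
  show "emeasure (distr \<mu> \<mu> (\<lambda>x. \<pp> powi j * x)) X = emeasure (density \<mu> (\<lambda>_. ennreal (real q powi j))) X"
    if "X \<in> small_cosets" for X
    using that by (auto simp: small_cosets_def c d)
  show "emeasure (distr \<mu> \<mu> (\<lambda>x. \<pp> powi j * x)) (coset (rep k) 0) \<noteq> \<infinity>" for k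
    by (simp add: c)
  show "range (\<lambda>k. coset (rep k) 0) \<subseteq> small_cosets"
    unfolding small_cosets_def by (metis (mono_tags, lifting) image_subsetI insertI2 mem_Collect_eq of_nat_0)
qed (auto simp: Int_stable_small_cosets UN_unit_cosets haar_sets sets_borel_cosets)

lemma integral_scaling:
  fixes f :: "'a \<Rightarrow> complex"
  assumes [measurable]: "f \<in> borel_measurable \<mu>"
  shows "(\<integral>x. f (\<pp> powi j * x) \<partial>\<mu>) = of_real (real q powi j) * (\<integral>x. f x \<partial>\<mu>)"
proof -
  have "(\<integral>x. f (\<pp> powi j * x) \<partial>\<mu>) = (\<integral>x. f x \<partial>distr \<mu> \<mu> (\<lambda>x. \<pp> powi j * x))"
    by (rule integral_distr[symmetric]) measurable
  also have "\<dots> = (\<integral>x. (real q powi j) *\<^sub>R f x \<partial>\<mu>)"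
    unfolding distr_scaling by (rule integral_density) (use q_pos in auto)
  finally show ?thesis by (simp add: scaleR_conv_of_real)
qed

section \<open>Integrals of characters over cosets\<close>

lemma integrable_bounded_on_coset:
  fixes f :: "'a \<Rightarrow> complex"
  assumes [measurable]: "f \<in> borel_measurable \<mu>" and "\<And>x. norm (f x) \<le> B"
  shows "integrable \<mu> (\<lambda>x. indicator (coset a n) x * f x)"
proof (rule Bochner_Integration.integrable_bound)
  show "integrable \<mu> (\<lambda>x. B * indicator (coset a n) x :: real)"
    by (auto simp: emeasure_coset)
  have "B \<ge> 0" using assms(2) norm_ge_zero order_trans by blast
  then show "AE x in \<mu>. norm (indicator (coset a n) x * f x) \<le> norm (B * indicator (coset a n) x :: real)"
    using assms(2) by (auto simp: indicator_def)
qed measurable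

text \<open>
  Orthogonality: if the character is nontrivial on the ideal, translating by an element on which it differs
  from 1 multiplies the integral by a constant different from 1.
\<close>

lemma integral_char_pideal:
  "(\<integral>x. indicator (pideal n) x * chi (y * x) \<partial>\<mu>)
     = (if y \<in> pideal (- n) then of_real (real q powi (- n)) else 0)"
proof (cases "y \<in> pideal (- n)")
  case True
  have "indicator (pideal n) x * chi (y * x) = complex_of_real (indicator (pideal n) x)" for x
    using pideal_mult[OF True, of x n] by (auto simp: indicator_def chi_pideal)
  then have "(\<integral>x. indicator (pideal n) x * chi (y * x) \<partial>\<mu>) = of_real (\<integral>x. indicator (pideal n) x \<partial>\<mu>)"
    by simp
  then show ?thesis using True measure_coset[of 0 n] by (simp add: coset_0)
next
  case False
  then have "y \<noteq> 0" by auto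
  then obtain m where m: "absv y = real q powi m" by (rule absv_value)
  obtain s where s: "s \<in> pideal 0" "chi (inverse \<pp> * s) \<noteq> 1"
    using char_nontrivial by (auto simp: pideal_0)
  have "m > n" using False mem_pideal_absv_powi[OF m, of "- n"] by auto
  \<comment> \<open>chosen so that \<open>y * t\<close> is the point where \<open>chi\<close> is nontrivial\<close>
  define t where "t = inverse y * (inverse \<pp> * s)"
  have "inverse y \<in> pideal m" by (simp add: pideal_def absv_inverse m power_int_minus)
  then have "t \<in> pideal (m + (- 1))"
    unfolding t_def using s(1) by (intro pideal_mult) (auto simp: inverse_pp_mult_mem_iff)
  then have t: "t \<in> pideal n" using pideal_antimono[of n "m + (- 1)"] \<open>m > n\<close> by auto
  have yt: "y * t = inverse \<pp> * s" using \<open>y \<noteq> 0\<close> by (simp add: t_def)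
  have tx: "t + x \<in> pideal n \<longleftrightarrow> x \<in> pideal n" for x
    using pideal_add[OF t, of x] pideal_diff[OF _ t, of "t + x"] by auto
  let ?I = "\<integral>x. indicator (pideal n) x * chi (y * x) \<partial>\<mu>"
  have "?I = (\<integral>x. indicator (pideal n) (t + x) * chi (y * (t + x)) \<partial>\<mu>)"
    by (rule integral_translation[symmetric]) measurable
  also have "\<dots> = (\<integral>x. chi (y * t) * (indicator (pideal n) x * chi (y * x)) \<partial>\<mu>)"
    by (intro Bochner_Integration.integral_cong refl) (auto simp: indicator_def tx distrib_left char_add)
  also have "\<dots> = chi (y * t) * ?I" by simp
  finally have "?I = 0" using s(2) yt by simp
  then show ?thesis using False by simp
qed

lemma integral_char_coset:
  "(\<integral>x. indicator (coset a n) x * chi (y * x) \<partial>\<mu>)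
     = (if y \<in> pideal (- n) then chi (y * a) * of_real (real q powi (- n)) else 0)"
proof -
  have "(\<integral>x. indicator (coset a n) x * chi (y * x) \<partial>\<mu>)
      = (\<integral>x. indicator (coset a n) (a + x) * chi (y * (a + x)) \<partial>\<mu>)"
    by (rule integral_translation[symmetric]) measurable
  also have "\<dots> = (\<integral>x. chi (y * a) * (indicator (pideal n) x * chi (y * x)) \<partial>\<mu>)"
    by (intro Bochner_Integration.integral_cong refl) (auto simp: indicator_def coset_def distrib_left char_add)
  also have "\<dots> = chi (y * a) * (\<integral>x. indicator (pideal n) x * chi (y * x) \<partial>\<mu>)" by simp
  finally show ?thesis by (simp add: integral_char_pideal)
qed

lemma indicator_coset_char_sum:
  assumes "x - a \<in> pideal 0"
  shows "indicator (coset a (int n)) x = (\<Sum>k<q ^ n. chi (rep k * (x - a))) / of_nat (q ^ n)"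
  using character_sum[OF assms, of n] q_pos by (simp add: coset_def indicator_def)

text \<open>
  The sets over which the integral of \<open>f\<close> (cut off to one coset of \<open>\<OO>\<close>) vanishes form a Dynkin system; containing
  the cosets, it contains all Borel sets.
\<close>

lemma AE_zero_if_coset_integrals_zero:
  fixes f :: "'a \<Rightarrow> complex"
  assumes int: "\<And>k. integrable \<mu> (\<lambda>x. indicator (coset (rep k) 0) x * f x)"
    and zero: "\<And>a n. (\<integral>x. indicator (coset a (int n)) x * f x \<partial>\<mu>) = 0"
  shows "AE x in \<mu>. f x = 0"
proof -
  have "AE x in \<mu>. indicator (coset (rep k) 0) x * f x = 0" for k
  proof -
    define h where "h x = indicator (coset (rep k) 0) x * f x" for x
    have hi: "integrable \<mu> h" using int[of k] by (simp add: h_def[abs_def])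
    have h0: "(\<integral>x. h x \<partial>\<mu>) = 0" using zero[of "rep k" 0] by (simp add: h_def)
    have sint: "set_integrable \<mu> A h" if "A \<in> sets \<mu>" for A
      unfolding set_integrable_def by (rule integrable_mult_indicator[OF that hi])
    have sets: "sets \<mu> = sigma_sets UNIV small_cosets" by (simp add: haar_sets sets_borel_cosets)
    have "small_cosets \<subseteq> Pow UNIV" by simp
    have "(\<integral>x\<in>A. h x \<partial>\<mu>) = 0" if "A \<in> sigma_sets UNIV small_cosets" for A
      using Int_stable_small_cosets \<open>small_cosets \<subseteq> Pow UNIV\<close> that
    proof (induction rule: sigma_sets_induct_disjoint)
      case (basic A)
      then consider "A = {}" | a n where "A = coset a (int n)" by (auto simp: small_cosets_def)
      then show ?case
      proof cases
        case 2
        consider "coset a (int n) \<inter> coset (rep k) 0 = {}" | "coset a (int n) \<subseteq> coset (rep k) 0"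
          using coset_disjoint_or_subset[of 0 "int n" a "rep k"] by auto
        then show ?thesis
        proof cases
          case 1
          then have "(\<lambda>x. indicator A x *\<^sub>R h x) = (\<lambda>x. 0)" by (auto simp: h_def 2 indicator_def fun_eq_iff)
          then show ?thesis by (simp only: set_lebesgue_integral_def) simp
        next
          case 22: 2
          then have "indicator A x *\<^sub>R h x = indicator (coset a (int n)) x * f x" for x
            by (auto simp: h_def 2 indicator_def)
          then show ?thesis by (simp add: set_lebesgue_integral_def zero)
        qed
      qed (simp add: set_lebesgue_integral_def)
    next
      case (compl A)
      have "(\<integral>x\<in>UNIV - A. h x \<partial>\<mu>) = (\<integral>x. h x - indicator A x *\<^sub>R h x \<partial>\<mu>)"
        unfolding set_lebesgue_integral_def
        by (intro Bochner_Integration.integral_cong refl) (auto simp: indicator_def)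
      also have "\<dots> = (\<integral>x. h x \<partial>\<mu>) - (\<integral>x\<in>A. h x \<partial>\<mu>)"
        unfolding set_lebesgue_integral_def
        using compl hi sint[of A] by (intro Bochner_Integration.integral_diff) (auto simp: sets set_integrable_def)
      finally show ?case using compl h0 by simp
    next
      case (union A)
      have "(\<integral>x\<in>(\<Union>i. A i). h x \<partial>\<mu>) = (\<Sum>i. \<integral>x\<in>A i. h x \<partial>\<mu>)"
        using union(1,2) by (intro lebesgue_integral_countable_add sint)
          (auto simp: sets disjoint_family_on_def intro!: sigma_sets.Union)
      then show ?case using union(3) by simp
    qed (simp add: set_lebesgue_integral_def)
    then have "AE x in \<mu>. h x = 0"
      using hi by (intro haar.density_unique_banach) (auto simp: sets)
    then show ?thesis by (simp add: h_def)
  qed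
  then have "AE x in \<mu>. \<forall>k. indicator (coset (rep k) 0) x * f x = 0"
    unfolding AE_all_countable by blast
  then show ?thesis
  proof eventually_elim
    case (elim x)
    obtain k where "x - rep k \<in> pideal 0" by (rule rep_exists)
    then show ?case using elim[rule_format, of k] by (simp add: coset_def indicator_def)
  qed
qed

lemma measurable_diff_borel:
  assumes "f \<in> borel_measurable \<mu>"
  shows "(\<lambda>x. f (x - a)) \<in> borel_measurable \<mu>"
proof -
  have "(\<lambda>x. x - a) \<in> measurable \<mu> \<mu>" by measurable
  from measurable_compose[OF this assms] show ?thesis .
qed

section \<open>The Gabor basis\<close>

text \<open>
  Frequency \<open>u(k)\<close>, position \<open>u(l)\<close>.
\<close>

definition gabor :: "nat \<Rightarrow> nat \<Rightarrow> 'a \<Rightarrow> complex" where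
  "gabor k l x = indicator (coset (rep l) 0) x * chi (rep k * x)"

definition time_gabor :: "nat \<Rightarrow> 'a \<Rightarrow> complex" where
  "time_gabor i = (case prod_decode i of (k, l) \<Rightarrow> gabor k l)"

text \<open>
  The Fourier transforms of the functions \<open>time_gabor i\<close>, see \<open>fourier_L1_time_gabor\<close>.
\<close>

definition freq_gabor :: "nat \<Rightarrow> 'a \<Rightarrow> complex" where
  "freq_gabor i = (case prod_decode i of (k, l) \<Rightarrow> \<lambda>\<xi>. cnj (gabor l k \<xi>))"

lemma bounded_coset_L2:
  assumes [measurable]: "f \<in> borel_measurable \<mu>" and "\<And>x. norm (f x) \<le> B"
  shows "(\<lambda>x. indicator (coset a n) x * f x) \<in> L2 \<mu>"
proof -
  have "(norm (f x))\<^sup>2 \<le> B\<^sup>2" for x by (rule power_mono) (auto simp: assms(2))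
  then have "integrable \<mu> (\<lambda>x. indicator (coset a n) x * complex_of_real ((norm (f x))\<^sup>2))"
    by (intro integrable_bounded_on_coset[where B="B\<^sup>2"]) (auto simp: norm_power)
  then have "integrable \<mu> (\<lambda>x. norm (indicator (coset a n) x * complex_of_real ((norm (f x))\<^sup>2)))"
    by (rule integrable_norm)
  moreover have "norm (indicator (coset a n) x * complex_of_real ((norm (f x))\<^sup>2))
      = (norm (indicator (coset a n) x * f x))\<^sup>2" for x
    by (auto simp: indicator_def norm_power)
  ultimately have "integrable \<mu> (\<lambda>x. (norm (indicator (coset a n) x * f x))\<^sup>2)" by simp
  then show ?thesis by (simp add: L2_def)
qed

lemma integrable_char_coset: "integrable \<mu> (\<lambda>x. indicator (coset b n) x * chi (a * x))"
  by (rule integrable_bounded_on_coset[where B=1]) (auto simp: char_norm)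

lemma char_coset_L2: "(\<lambda>x. indicator (coset b n) x * chi (a * x)) \<in> L2 \<mu>"
  by (rule bounded_coset_L2[where B=1]) (auto simp: char_norm)

lemma gabor_L2: "gabor k l \<in> L2 \<mu>"
  unfolding gabor_def[abs_def] by (rule char_coset_L2)

lemma gabor_integrable: "integrable \<mu> (gabor k l)"
  unfolding gabor_def[abs_def] by (rule integrable_char_coset)

lemma L2_integrable_coset:
  assumes f: "f \<in> L2 \<mu>"
  shows "integrable \<mu> (\<lambda>x. indicator (coset a n) x * f x)"
proof -
  have "(\<lambda>x. indicator (coset a n) x * 1) \<in> L2 \<mu>"
    by (rule bounded_coset_L2[where B=1]) auto
  from L2_product_integrable[OF f this] show ?thesis
    by (simp add: mult.commute)
qed

lemma coset_translate_char:
  "(\<integral>x. indicator (coset b n) x * chi (a * x) * cnj (chi (\<xi> * x)) \<partial>\<mu>)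
     = indicator (coset a (- n)) \<xi> * (chi ((a - \<xi>) * b) * of_real (real q powi (- n)))"
proof -
  have "(\<integral>x. indicator (coset b n) x * chi (a * x) * cnj (chi (\<xi> * x)) \<partial>\<mu>)
      = (\<integral>x. indicator (coset b n) x * chi ((a - \<xi>) * x) \<partial>\<mu>)"
    by (simp add: left_diff_distrib chi_diff mult.assoc)
  moreover have "a - \<xi> \<in> pideal (- n) \<longleftrightarrow> \<xi> \<in> coset a (- n)"
    using pideal_minus_iff[of "a - \<xi>" "- n"] by (simp add: coset_def)
  ultimately show ?thesis by (cases "\<xi> \<in> coset a (- n)") (simp_all add: integral_char_coset)
qed

lemma fourier_L1_char_coset:
  "fourier_L1 \<mu> chi (\<lambda>x. indicator (coset b n) x * chi (a * x)) \<xi>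
     = indicator (coset a (- n)) \<xi> * (chi ((a - \<xi>) * b) * of_real (real q powi (- n)))"
  unfolding fourier_L1_def by (rule coset_translate_char)

text \<open>
  Time and frequency exchange their roles; the phase \<open>\<chi>(u(k)u(l))\<close> that would appear is 1.
\<close>

lemma fourier_L1_gabor: "fourier_L1 \<mu> chi (gabor k l) \<xi> = cnj (gabor l k \<xi>)"
  unfolding gabor_def[of k l, abs_def] fourier_L1_char_coset
  by (simp add: gabor_def left_diff_distrib right_diff_distrib chi_diff char_u indicator_def mult.commute)

lemma gabor_inner: "L2_inner \<mu> (gabor k l) (gabor k' l') = of_bool (k = k' \<and> l = l')"
proof (cases "l = l'")
  case True
  have "L2_inner \<mu> (gabor k l) (gabor k' l')
      = (\<integral>x. indicator (coset (rep l) 0) x * chi (rep k * x) * cnj (chi (rep k' * x)) \<partial>\<mu>)"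
    unfolding L2_inner_def gabor_def True
    by (intro Bochner_Integration.integral_cong refl) (auto simp: indicator_def)
  also have "\<dots> = indicator (coset (rep k) 0) (rep k') * chi ((rep k - rep k') * rep l)"
    using coset_translate_char[of "rep l" 0 "rep k" "rep k'"] by simp
  also have "\<dots> = of_bool (k = k')"
    using rep_unique[of k' k] by (auto simp: coset_def indicator_def)
  finally show ?thesis using True by simp
next
  case False
  then have "coset (rep l) 0 \<inter> coset (rep l') 0 = {}"
    using unit_cosets_disjoint by (auto simp: disjoint_family_on_def)
  then have "(\<lambda>x. gabor k l x * cnj (gabor k' l' x)) = (\<lambda>x. 0)"
    by (auto simp: gabor_def indicator_def fun_eq_iff)
  then show ?thesis using False by (simp only: L2_inner_def) simp
qed

lemma time_gabor_orthonormal: "orthonormal \<mu> time_gabor"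
proof -
  have "L2_inner \<mu> (time_gabor i) (time_gabor j) = of_bool (i = j)" for i j
  proof -
    obtain k l k' l' where d: "prod_decode i = (k, l)" "prod_decode j = (k', l')" by fastforce
    then have "i = j \<longleftrightarrow> k = k' \<and> l = l'" by (metis prod.inject prod_decode_inverse)
    then show ?thesis by (simp add: time_gabor_def d gabor_inner)
  qed
  moreover have "time_gabor i \<in> L2 \<mu>" for i
    by (simp add: time_gabor_def gabor_L2 split: prod.split)
  ultimately show ?thesis by (simp add: orthonormal_def)
qed

lemma freq_gabor_orthonormal: "orthonormal \<mu> freq_gabor"
proof -
  have "L2_inner \<mu> (freq_gabor i) (freq_gabor j) = of_bool (i = j)" for i j
  proof -
    obtain k l k' l' where d: "prod_decode i = (k, l)" "prod_decode j = (k', l')" by fastforce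
    then have "i = j \<longleftrightarrow> k = k' \<and> l = l'" by (metis prod.inject prod_decode_inverse)
    then show ?thesis by (auto simp: freq_gabor_def d L2_inner_cnj gabor_inner)
  qed
  moreover have "freq_gabor i \<in> L2 \<mu>" for i
    by (simp add: freq_gabor_def gabor_L2 L2_cnj split: prod.split)
  ultimately show ?thesis by (simp add: orthonormal_def)
qed

text \<open>
  By \<open>character_sum\<close> the indicator of a coset of \<open>\<PP>\<^sup>n\<close> is a finite combination of Gabor functions, so \<open>f\<close> has
  vanishing integral over every small coset.
\<close>

lemma gabor_total:
  assumes f: "f \<in> L2 \<mu>" and orth: "\<And>k l. L2_inner \<mu> f (gabor k l) = 0"
  shows "AE x in \<mu>. f x = 0"
proof (rule AE_zero_if_coset_integrals_zero)
  show "integrable \<mu> (\<lambda>x. indicator (coset (rep k) 0) x * f x)" for k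
    by (rule L2_integrable_coset[OF f])
  fix a n
  obtain l where l: "a - rep l \<in> pideal 0" by (rule rep_exists)
  then have "coset a 0 = coset (rep l) 0" by (intro coset_eq) (simp add: coset_def)
  then have C: "x - a \<in> pideal 0 \<longleftrightarrow> x \<in> coset (rep l) 0" for x by (auto simp: coset_def)
  have eq: "indicator (coset a (int n)) x * f x
      = (\<Sum>k<q ^ n. (chi (rep k * a) / of_nat (q ^ n)) * (f x * cnj (gabor k l x)))" for x
  proof (cases "x \<in> coset (rep l) 0")
    case True
    \<comment> \<open>the conjugate of the character sum is needed, since the inner product conjugates the Gabor function\<close>
    have "indicator (coset a (int n)) x = cnj (indicator (coset a (int n)) x)"
      by (simp add: indicator_def)
    also have "\<dots> = (\<Sum>k<q ^ n. cnj (chi (rep k * (x - a)))) / of_nat (q ^ n)"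
      using True C by (subst indicator_coset_char_sum) auto
    also have "\<dots> = (\<Sum>k<q ^ n. chi (rep k * a) / of_nat (q ^ n) * cnj (gabor k l x))"
      using True by (simp add: gabor_def right_diff_distrib left_diff_distrib chi_diff sum_divide_distrib mult.commute)
    finally show ?thesis by (simp add: sum_distrib_right sum_distrib_left mult_ac)
  next
    case False
    then have "x \<notin> coset a (int n)" using C coset_mono[of 0 "int n" a] by (auto simp: coset_def)
    with False show ?thesis by (simp add: gabor_def)
  qed
  have "(\<integral>x. indicator (coset a (int n)) x * f x \<partial>\<mu>)
      = (\<Sum>k<q ^ n. (chi (rep k * a) / of_nat (q ^ n)) * L2_inner \<mu> f (gabor k l))"
    unfolding eq L2_inner_def
    by (subst Bochner_Integration.integral_sum) (auto intro!: integrable_mult_right L2_product_integrable f gabor_L2)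
  then show "(\<integral>x. indicator (coset a (int n)) x * f x \<partial>\<mu>) = 0" by (simp add: orth)
qed

lemma time_gabor_total: "total_sequence \<mu> time_gabor"
  unfolding total_sequence_def
proof (intro ballI impI gabor_total)
  fix f k l assume "\<forall>i. L2_inner \<mu> f (time_gabor i) = 0"
  then show "L2_inner \<mu> f (gabor k l) = 0"
    by (metis (no_types, lifting) case_prod_conv prod_encode_inverse time_gabor_def)
qed

lemma freq_gabor_total: "total_sequence \<mu> freq_gabor"
  unfolding total_sequence_def
proof (intro ballI impI)
  fix f assume f: "f \<in> L2 \<mu>" and 0: "\<forall>i. L2_inner \<mu> f (freq_gabor i) = 0"
  have "L2_inner \<mu> (\<lambda>x. cnj (f x)) (gabor l k) = 0" for k l
  proof -
    have "L2_inner \<mu> (\<lambda>x. cnj (cnj (f x))) (\<lambda>x. cnj (gabor l k x)) = 0"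
      using 0[rule_format, of "prod_encode (k, l)"] by (simp add: freq_gabor_def)
    then show ?thesis by (simp only: L2_inner_cnj complex_cnj_zero_iff)
  qed
  then have "AE x in \<mu>. cnj (f x) = 0" by (rule gabor_total[OF L2_cnj[OF f]])
  then show "AE x in \<mu>. f x = 0" by simp
qed

section \<open>The Fourier transform\<close>

text \<open>
  Continuity gives measurability with respect to the Borel sets of the product topology, whereas Fubini's theorem needs the
  product sigma-algebra. Replacing \<open>x\<close> by a representative of its coset modulo \<open>\<PP>\<^sup>n\<close>, one of countably many, gives a
  measurable function, and for fixed \<open>\<xi>\<close> the value of the character is correct as soon as \<open>n\<close> is large.
\<close>

lemma measurable_char_pair: "(\<lambda>(x, \<xi>). chi (\<xi> * x)) \<in> borel_measurable (\<mu> \<Otimes>\<^sub>M \<mu>)"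
proof -
  define idx where "idx n x = (THE k. x \<in> coset (\<pp> powi int n * rep k) (int n))" for n :: nat and x
  have idx: "idx n x = k \<longleftrightarrow> x \<in> coset (\<pp> powi int n * rep k) (int n)" for n x k
  proof -
    have u: "k = k'" if "x \<in> coset (\<pp> powi int n * rep k) (int n)" "x \<in> coset (\<pp> powi int n * rep k') (int n)" for k k'
      using scaled_cosets_disjoint[of "int n"] that unfolding disjoint_family_on_def by blast
    obtain k0 where "coset x (int n) = coset (\<pp> powi int n * rep k0) (int n)" by (rule coset_representative)
    then have k0: "x \<in> coset (\<pp> powi int n * rep k0) (int n)" using mem_coset_self by blast
    then have "idx n x = k0" unfolding idx_def using u by blast
    with k0 u show ?thesis by blast
  qed
  have [measurable]: "idx n \<in> measurable \<mu> (count_space UNIV)" for n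
  proof (rule measurable_count_space_eq2_countable[THEN iffD2, OF _])
    have "idx n -` {k} \<inter> space \<mu> = coset (\<pp> powi int n * rep k) (int n)" for k
      by (auto simp del: power_int_of_nat simp flip: idx)
    then show "idx n \<in> space \<mu> \<rightarrow> UNIV \<and> (\<forall>a\<in>UNIV. idx n -` {a} \<inter> space \<mu> \<in> sets \<mu>)" by simp
  qed
  have m: "(\<lambda>(x, \<xi>). chi (\<xi> * (\<pp> powi int n * rep (idx n x)))) \<in> borel_measurable (\<mu> \<Otimes>\<^sub>M \<mu>)" for n
  proof -
    have 1: "(\<lambda>p. chi ((\<pp> powi int n * rep k) * snd p)) \<in> borel_measurable (\<mu> \<Otimes>\<^sub>M \<mu>)" for k
      by measurable
    have 2: "(\<lambda>p. idx n (fst p)) \<in> measurable (\<mu> \<Otimes>\<^sub>M \<mu>) (count_space UNIV)" by measurable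
    have "(\<lambda>p. chi ((\<pp> powi int n * rep (idx n (fst p))) * snd p)) \<in> borel_measurable (\<mu> \<Otimes>\<^sub>M \<mu>)"
      by (rule measurable_compose_countable[OF 1 2])
    then show ?thesis by (simp add: case_prod_beta' mult_ac)
  qed
  show ?thesis
  proof (rule borel_measurable_LIMSEQ_metric[OF m])
    fix p :: "'a \<times> 'a"
    obtain x \<xi> where p: "p = (x, \<xi>)" by fastforce
    obtain N where N: "\<xi> \<in> pideal (- int N)" using mem_some_pideal by blast
    have "chi (\<xi> * (\<pp> powi int n * rep (idx n x))) = chi (\<xi> * x)" if "n \<ge> N" for n
    proof -
      have "x - \<pp> powi int n * rep (idx n x) \<in> pideal (int n)"
        using idx[of n x "idx n x"] by (simp add: coset_def)
      with N have "\<xi> * (x - \<pp> powi int n * rep (idx n x)) \<in> pideal (- int N + int n)"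
        by (rule pideal_mult)
      then have "\<xi> * (x - \<pp> powi int n * rep (idx n x)) \<in> pideal 0"
        using pideal_antimono[of 0 "- int N + int n"] that by auto
      then have "chi (\<xi> * x) * cnj (chi (\<xi> * (\<pp> powi int n * rep (idx n x)))) = 1"
        by (metis chi_pideal chi_diff right_diff_distrib)
      moreover have "chi (\<xi> * (\<pp> powi int n * rep (idx n x))) * cnj (chi (\<xi> * (\<pp> powi int n * rep (idx n x)))) = 1"
        by (metis chi_diff chi_0 diff_self)
      ultimately show ?thesis by (metis mult_right_cancel zero_neq_one mult_zero_right)
    qed
    then show "(\<lambda>n. case p of (x, \<xi>) \<Rightarrow> chi (\<xi> * (\<pp> powi int n * rep (idx n x)))) \<longlonglongrightarrow> (case p of (x, \<xi>) \<Rightarrow> chi (\<xi> * x))"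
      unfolding p by (intro tendsto_eventually eventually_sequentiallyI[of N]) simp
  qed
qed

sublocale haar_pair: pair_sigma_finite \<mu> \<mu> ..

text \<open>
  Fubini: integrating the kernel against the Gabor function first gives the Fourier transform of the latter.
\<close>

lemma multiplication_formula_gabor:
  assumes F: "integrable \<mu> F"
  shows "L2_inner \<mu> (fourier_L1 \<mu> chi F) (\<lambda>\<xi>. cnj (gabor l k \<xi>)) = L2_inner \<mu> F (gabor k l)"
proof -
  note [measurable] = borel_measurable_integrable[OF F] measurable_char_pair
    borel_measurable_integrable[OF gabor_integrable]
  have [measurable]: "(\<lambda>p. chi (snd p * fst p)) \<in> borel_measurable (\<mu> \<Otimes>\<^sub>M \<mu>)"
    using measurable_char_pair by (simp add: case_prod_beta')
  define h where "h x \<xi> = F x * cnj (chi (\<xi> * x)) * gabor l k \<xi>" for x \<xi>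
  have hm: "(\<lambda>(x, \<xi>). h x \<xi>) \<in> borel_measurable (\<mu> \<Otimes>\<^sub>M \<mu>)"
    unfolding h_def case_prod_beta' by measurable
  have hi: "integrable (\<mu> \<Otimes>\<^sub>M \<mu>) (\<lambda>(x, \<xi>). h x \<xi>)"
  proof (rule haar_pair.Fubini_integrable[OF hm])
    have n: "norm (h x \<xi>) = norm (F x) * norm (gabor l k \<xi>)" for x \<xi>
      by (simp add: h_def norm_mult char_norm)
    show "integrable \<mu> (\<lambda>x. \<integral>\<xi>. norm (case (x, \<xi>) of (x, \<xi>) \<Rightarrow> h x \<xi>) \<partial>\<mu>)"
      by (simp add: n F)
    show "AE x in \<mu>. integrable \<mu> (\<lambda>\<xi>. case (x, \<xi>) of (x, \<xi>) \<Rightarrow> h x \<xi>)"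
    proof (rule AE_I2)
      fix x
      have "integrable \<mu> (\<lambda>\<xi>. F x * (cnj (chi (x * \<xi>)) * gabor l k \<xi>))"
      proof (intro integrable_mult_right Bochner_Integration.integrable_bound[OF gabor_integrable[of l k]])
        show "(\<lambda>\<xi>. cnj (chi (x * \<xi>)) * gabor l k \<xi>) \<in> borel_measurable \<mu>" by measurable
      qed (simp add: norm_mult char_norm)
      then show "integrable \<mu> (\<lambda>\<xi>. case (x, \<xi>) of (x, \<xi>) \<Rightarrow> h x \<xi>)"
        by (simp add: h_def mult_ac)
    qed
  qed
  have "L2_inner \<mu> (fourier_L1 \<mu> chi F) (\<lambda>\<xi>. cnj (gabor l k \<xi>)) = (\<integral>\<xi>. (\<integral>x. h x \<xi> \<partial>\<mu>) \<partial>\<mu>)"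
    by (simp add: L2_inner_def fourier_L1_def h_def)
  also have "\<dots> = (\<integral>x. (\<integral>\<xi>. h x \<xi> \<partial>\<mu>) \<partial>\<mu>)"
    by (rule haar_pair.Fubini_integral[OF hi])
  also have "\<dots> = (\<integral>x. F x * cnj (gabor k l x) \<partial>\<mu>)"
  proof (intro Bochner_Integration.integral_cong refl)
    fix x
    have "(\<integral>\<xi>. h x \<xi> \<partial>\<mu>) = F x * fourier_L1 \<mu> chi (gabor l k) x"
      by (simp add: h_def fourier_L1_def mult.assoc mult.commute[of x]) (simp add: mult.commute)
    then show "(\<integral>\<xi>. h x \<xi> \<partial>\<mu>) = F x * cnj (gabor k l x)" by (simp add: fourier_L1_gabor)
  qed
  finally show ?thesis by (simp add: L2_inner_def)
qed

lemma multiplication_formula: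
  assumes "integrable \<mu> F"
  shows "L2_inner \<mu> (fourier_L1 \<mu> chi F) (freq_gabor i) = L2_inner \<mu> F (time_gabor i)"
  using multiplication_formula_gabor[OF assms]
  by (simp add: freq_gabor_def time_gabor_def split: prod.split)

text \<open>
  The coefficients of \<open>g\<close> do not depend on the approximating sequence: the multiplication formula holds along the
  sequence and passes to the limit.
\<close>

lemma fourier_L2_coeff:
  assumes f: "f \<in> L2 \<mu>" and g: "is_fourier_L2 \<mu> chi f g"
  shows "L2_inner \<mu> g (freq_gabor i) = L2_inner \<mu> f (time_gabor i)"
proof -
  obtain F where g2: "g \<in> L2 \<mu>"
    and F: "\<And>n. integrable \<mu> (F n)" "\<And>n. F n \<in> L2 \<mu>" "\<And>n. fourier_L1 \<mu> chi (F n) \<in> L2 \<mu>"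
    and lim: "(\<lambda>n. L2_norm \<mu> (\<lambda>x. F n x - f x)) \<longlonglongrightarrow> 0"
      "(\<lambda>n. L2_norm \<mu> (\<lambda>\<xi>. fourier_L1 \<mu> chi (F n) \<xi> - g \<xi>)) \<longlonglongrightarrow> 0"
    using g unfolding is_fourier_L2_def by blast
  have "(\<lambda>n. L2_inner \<mu> (fourier_L1 \<mu> chi (F n)) (freq_gabor i)) \<longlonglongrightarrow> L2_inner \<mu> g (freq_gabor i)"
    using freq_gabor_orthonormal by (intro L2_inner_tendsto F g2 lim) (simp add: orthonormal_def)
  moreover have "(\<lambda>n. L2_inner \<mu> (F n) (time_gabor i)) \<longlonglongrightarrow> L2_inner \<mu> f (time_gabor i)"
    using time_gabor_orthonormal by (intro L2_inner_tendsto F f lim) (simp add: orthonormal_def)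
  ultimately show ?thesis by (simp add: multiplication_formula[OF F(1)] LIMSEQ_unique)
qed

text \<open>
  \<open>f\<close> and \<open>g\<close> have the same coefficients with respect to two orthonormal bases.
\<close>

theorem Plancherel:
  assumes "f \<in> L2 \<mu>" "is_fourier_L2 \<mu> chi f g" "f' \<in> L2 \<mu>" "is_fourier_L2 \<mu> chi f' g'"
  shows "L2_inner \<mu> g g' = L2_inner \<mu> f f'"
proof -
  have "g \<in> L2 \<mu>" "g' \<in> L2 \<mu>" using assms by (auto simp: is_fourier_L2_def)
  from Parseval_identity[OF freq_gabor_orthonormal freq_gabor_total this]
  have "(\<lambda>i. L2_inner \<mu> f (time_gabor i) * cnj (L2_inner \<mu> f' (time_gabor i))) sums L2_inner \<mu> g g'"
    by (simp only: fourier_L2_coeff[OF assms(1,2)] fourier_L2_coeff[OF assms(3,4)])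
  then show ?thesis
    using Parseval_identity[OF time_gabor_orthonormal time_gabor_total assms(1,3)] by (rule sums_unique2)
qed

lemma time_gabor_integrable: "integrable \<mu> (time_gabor i)"
  by (simp add: time_gabor_def gabor_integrable split: prod.split)

lemma fourier_L1_time_gabor: "fourier_L1 \<mu> chi (time_gabor i) = freq_gabor i"
  by (auto simp: fun_eq_iff time_gabor_def freq_gabor_def fourier_L1_gabor split: prod.split)

lemma integrable_mult_cnj_chi:
  assumes "integrable \<mu> F"
  shows "integrable \<mu> (\<lambda>x. F x * cnj (chi (\<xi> * x)))"
proof (rule Bochner_Integration.integrable_bound[OF assms])
  note [measurable] = borel_measurable_integrable[OF assms]
  show "(\<lambda>x. F x * cnj (chi (\<xi> * x))) \<in> borel_measurable \<mu>" by measurable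
qed (simp add: norm_mult char_norm)

text \<open>
  Partial sums of the Gabor expansion of \<open>f\<close> approximate \<open>f\<close>, and their transforms are partial sums of the
  expansion with the same coefficients in the transformed basis.
\<close>

lemma fourier_L2_exists:
  assumes f: "f \<in> L2 \<mu>"
  shows "\<exists>g. is_fourier_L2 \<mu> chi f g"
proof -
  define a where "a i = L2_inner \<mu> f (time_gabor i)" for i
  define F where "F n x = (\<Sum>i<n. a i * time_gabor i x)" for n x
  have "summable (\<lambda>i. (norm (a i))\<^sup>2)"
    unfolding a_def by (rule orthonormal_coeffs_summable[OF time_gabor_orthonormal f])
  then obtain g where g: "g \<in> L2 \<mu>" "(\<lambda>n. L2_norm \<mu> (\<lambda>x. (\<Sum>i<n. a i * freq_gabor i x) - g x)) \<longlonglongrightarrow> 0"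
    by (rule orthonormal_series_converges[OF freq_gabor_orthonormal])
  have FT: "fourier_L1 \<mu> chi (F n) = (\<lambda>\<xi>. \<Sum>i<n. a i * freq_gabor i \<xi>)" for n
  proof
    fix \<xi>
    have "fourier_L1 \<mu> chi (F n) \<xi> = (\<integral>x. (\<Sum>i<n. a i * (time_gabor i x * cnj (chi (\<xi> * x)))) \<partial>\<mu>)"
      by (simp add: fourier_L1_def F_def sum_distrib_right mult.assoc)
    also have "\<dots> = (\<Sum>i<n. a i * fourier_L1 \<mu> chi (time_gabor i) \<xi>)"
      unfolding fourier_L1_def
      by (subst Bochner_Integration.integral_sum)
         (auto intro!: integrable_mult_right integrable_mult_cnj_chi time_gabor_integrable)
    finally show "fourier_L1 \<mu> chi (F n) \<xi> = (\<Sum>i<n. a i * freq_gabor i \<xi>)"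
      by (simp add: fourier_L1_time_gabor)
  qed
  have "integrable \<mu> (F n)" for n
    unfolding F_def[abs_def] by (auto intro!: integrable_mult_right time_gabor_integrable)
  moreover have "F n \<in> L2 \<mu>" "fourier_L1 \<mu> chi (F n) \<in> L2 \<mu>" for n
    unfolding FT unfolding F_def[abs_def]
    by (rule orthonormal_expansion_L2, rule time_gabor_orthonormal freq_gabor_orthonormal)+
  moreover have "(\<lambda>n. L2_norm \<mu> (\<lambda>x. F n x - f x)) \<longlonglongrightarrow> 0"
    unfolding F_def a_def by (rule orthonormal_basis_expansion[OF time_gabor_orthonormal time_gabor_total f])
  ultimately show ?thesis
    unfolding is_fourier_L2_def using g by (intro exI[of _ g] conjI exI[of _ F]) (auto simp: FT)
qed

lemma fourier_is_fourier: "f \<in> L2 \<mu> \<Longrightarrow> is_fourier_L2 \<mu> chi f (fourier \<mu> chi f)"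
  unfolding fourier_def using fourier_L2_exists by (rule someI_ex)

lemma fourier_L2: "f \<in> L2 \<mu> \<Longrightarrow> fourier \<mu> chi f \<in> L2 \<mu>"
  using fourier_is_fourier by (auto simp: is_fourier_L2_def)

lemma L2_translation: "f \<in> L2 \<mu> \<Longrightarrow> (\<lambda>x. f (x - b)) \<in> L2 \<mu>"
  using integrable_translation[of "\<lambda>x. (norm (f x))\<^sup>2" "- b"] measurable_diff_borel[of f b]
  by (simp add: L2_def)

lemma L2_norm_translation:
  assumes "f \<in> L2 \<mu>"
  shows "L2_norm \<mu> (\<lambda>x. f (x - b)) = L2_norm \<mu> f"
proof -
  note [measurable] = L2_measurable[OF assms]
  have "(\<integral>x. complex_of_real ((norm (f (- b + x)))\<^sup>2) \<partial>\<mu>) = (\<integral>x. complex_of_real ((norm (f x))\<^sup>2) \<partial>\<mu>)"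
    by (rule integral_translation) measurable
  then have "(\<integral>x. (norm (f (x - b)))\<^sup>2 \<partial>\<mu>) = (\<integral>x. (norm (f x))\<^sup>2 \<partial>\<mu>)"
    by (simp only: integral_complex_of_real of_real_eq_iff) simp
  then show ?thesis by (simp add: L2_norm_def)
qed

lemma is_fourier_L2_translation:
  assumes f: "f \<in> L2 \<mu>" and g: "is_fourier_L2 \<mu> chi f g"
  shows "is_fourier_L2 \<mu> chi (\<lambda>x. f (x - b)) (\<lambda>\<xi>. cnj (chi (b * \<xi>)) * g \<xi>)"
proof -
  obtain F where g2: "g \<in> L2 \<mu>"
    and F: "\<And>n. integrable \<mu> (F n)" "\<And>n. F n \<in> L2 \<mu>" "\<And>n. fourier_L1 \<mu> chi (F n) \<in> L2 \<mu>"
    and lim: "(\<lambda>n. L2_norm \<mu> (\<lambda>x. F n x - f x)) \<longlonglongrightarrow> 0"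
      "(\<lambda>n. L2_norm \<mu> (\<lambda>\<xi>. fourier_L1 \<mu> chi (F n) \<xi> - g \<xi>)) \<longlonglongrightarrow> 0"
    using g unfolding is_fourier_L2_def by blast
  have mod: "(\<lambda>\<xi>. cnj (chi (b * \<xi>)) * h \<xi>) \<in> L2 \<mu>" if "h \<in> L2 \<mu>" for h
  proof (rule L2_bound[OF that])
    note [measurable] = L2_measurable[OF that]
    show "(\<lambda>\<xi>. cnj (chi (b * \<xi>)) * h \<xi>) \<in> borel_measurable \<mu>" by measurable
  qed (simp add: norm_mult char_norm)
  have FT: "fourier_L1 \<mu> chi (\<lambda>x. F n (x - b)) = (\<lambda>\<xi>. cnj (chi (b * \<xi>)) * fourier_L1 \<mu> chi (F n) \<xi>)" for n
  proof
    fix \<xi>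
    note [measurable] = borel_measurable_integrable[OF F(1)]
    have "fourier_L1 \<mu> chi (\<lambda>x. F n (x - b)) \<xi> = (\<integral>x. F n ((b + x) - b) * cnj (chi (\<xi> * (b + x))) \<partial>\<mu>)"
      unfolding fourier_L1_def by (rule integral_translation[symmetric]) measurable
    also have "\<dots> = (\<integral>x. cnj (chi (b * \<xi>)) * (F n x * cnj (chi (\<xi> * x))) \<partial>\<mu>)"
      by (intro Bochner_Integration.integral_cong refl) (simp add: distrib_left char_add mult_ac)
    finally show "fourier_L1 \<mu> chi (\<lambda>x. F n (x - b)) \<xi> = cnj (chi (b * \<xi>)) * fourier_L1 \<mu> chi (F n) \<xi>"
      by (simp add: fourier_L1_def)
  qed
  have n1: "L2_norm \<mu> (\<lambda>x. F n (x - b) - f (x - b)) = L2_norm \<mu> (\<lambda>x. F n x - f x)" for n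
    using L2_norm_translation[OF L2_diff[OF F(2) f]] by simp
  have n2: "L2_norm \<mu> (\<lambda>\<xi>. cnj (chi (b * \<xi>)) * fourier_L1 \<mu> chi (F n) \<xi> - cnj (chi (b * \<xi>)) * g \<xi>)
      = L2_norm \<mu> (\<lambda>\<xi>. fourier_L1 \<mu> chi (F n) \<xi> - g \<xi>)" for n
    by (simp add: L2_norm_def norm_mult char_norm flip: right_diff_distrib)
  show ?thesis
    unfolding is_fourier_L2_def
    by (intro conjI exI[of _ "\<lambda>n x. F n (x - b)"] allI mod g2)
       (use F integrable_translation[OF F(1), of _ "- b"] L2_translation lim mod in \<open>auto simp: FT n1 n2\<close>)
qed

lemma fourier_char_coset:
  "is_fourier_L2 \<mu> chi (\<lambda>x. indicator (coset b n) x * chi (a * x))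
     (\<lambda>\<xi>. indicator (coset a (- n)) \<xi> * (chi ((a - \<xi>) * b) * of_real (real q powi (- n))))"
proof -
  have FT: "fourier_L1 \<mu> chi (\<lambda>x. indicator (coset b n) x * chi (a * x))
     = (\<lambda>\<xi>. indicator (coset a (- n)) \<xi> * (chi ((a - \<xi>) * b) * of_real (real q powi (- n))))"
    by (rule ext) (rule fourier_L1_char_coset)
  have L2: "(\<lambda>\<xi>. indicator (coset a (- n)) \<xi> * (chi ((a - \<xi>) * b) * complex_of_real (real q powi (- n)))) \<in> L2 \<mu>"
  proof (rule bounded_coset_L2[where B="real q powi (- n)"])
    have "(\<lambda>\<xi>. chi (a * b) * cnj (chi (b * \<xi>)) * complex_of_real (real q powi (- n))) \<in> borel_measurable \<mu>"
      by measurable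
    then show "(\<lambda>\<xi>. chi ((a - \<xi>) * b) * complex_of_real (real q powi (- n))) \<in> borel_measurable \<mu>"
      by (simp add: left_diff_distrib chi_diff mult.commute[of b])
  qed (use q_pos in \<open>auto simp: norm_mult char_norm norm_power_int\<close>)
  show ?thesis
    unfolding is_fourier_L2_def
    by (intro conjI L2 exI[of _ "\<lambda>n' x. indicator (coset b n) x * chi (a * x)"])
       (use L2 in \<open>simp_all add: FT integrable_char_coset char_coset_L2 L2_norm_def\<close>)
qed

text \<open>
  Plancherel for the pairing of \<open>\<eta>\<close> with a modulated indicator of a coset, whose transform is again of this kind.
\<close>

lemma char_coset_pairing:
  assumes \<eta>: "\<eta> \<in> L2 \<mu>"
  shows "(\<integral>x. indicator (coset b n) x * chi (a * x) * cnj (\<eta> x) \<partial>\<mu>)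
    = of_real (real q powi (- n)) * chi (a * b) *
        (\<integral>\<xi>. indicator (coset a (- n)) \<xi> * cnj (chi (b * \<xi>)) * cnj (fourier \<mu> chi \<eta> \<xi>) \<partial>\<mu>)"
proof -
  have "(\<integral>x. indicator (coset b n) x * chi (a * x) * cnj (\<eta> x) \<partial>\<mu>)
      = L2_inner \<mu> (\<lambda>\<xi>. indicator (coset a (- n)) \<xi> * (chi ((a - \<xi>) * b) * of_real (real q powi (- n)))) (fourier \<mu> chi \<eta>)"
    by (subst Plancherel[OF char_coset_L2 fourier_char_coset \<eta> fourier_is_fourier[OF \<eta>]]) (simp add: L2_inner_def)
  also have "\<dots> = (\<integral>\<xi>. of_real (real q powi (- n)) * chi (a * b) *
      (indicator (coset a (- n)) \<xi> * cnj (chi (b * \<xi>)) * cnj (fourier \<mu> chi \<eta> \<xi>)) \<partial>\<mu>)"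
    unfolding L2_inner_def
    by (intro Bochner_Integration.integral_cong refl) (simp add: left_diff_distrib right_diff_distrib chi_diff mult_ac)
  finally show ?thesis by simp
qed

section \<open>The periodic weight and translation correlations\<close>

text \<open>
  The open subgroup \<open>\<PP>\<^sup>n + \<Lambda>\<close>.
\<close>

definition lattice_nbhd :: "nat \<Rightarrow> 'a set" where
  "lattice_nbhd n = (\<Union>l. coset (rep l) (int n))"

lemma measurable_lattice_nbhd [measurable]: "lattice_nbhd n \<in> sets \<mu>"
  unfolding lattice_nbhd_def by (intro sets.countable_UN) auto

lemma mem_lattice_nbhd_iff:
  assumes "\<xi> - rep l \<in> pideal 0"
  shows "\<xi> \<in> lattice_nbhd n \<longleftrightarrow> \<xi> - rep l \<in> pideal (int n)"
proof
  assume "\<xi> \<in> lattice_nbhd n"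
  then obtain l' where l': "\<xi> - rep l' \<in> pideal (int n)" by (auto simp: lattice_nbhd_def coset_def)
  then have "\<xi> - rep l' \<in> pideal 0" using pideal_antimono[of 0 "int n"] by auto
  then have "(\<xi> - rep l') - (\<xi> - rep l) \<in> pideal 0" using assms by (rule pideal_diff)
  then have "l = l'" by (intro rep_unique) simp
  with l' show "\<xi> - rep l \<in> pideal (int n)" by simp
qed (auto simp: lattice_nbhd_def coset_def)

text \<open>
  The finite group of the \<open>u(k)\<close>, \<open>k < q\<^sup>n\<close>, is the annihilator of \<open>\<PP>\<^sup>n + \<Lambda>\<close>.
\<close>

lemma indicator_lattice_nbhd:
  "(\<Sum>k<q ^ n. chi (rep k * \<xi>)) = of_nat (q ^ n) * indicator (lattice_nbhd n) \<xi>"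
proof -
  obtain l where l: "\<xi> - rep l \<in> pideal 0" by (rule rep_exists)
  have "(\<Sum>k<q ^ n. chi (rep k * \<xi>)) = (\<Sum>k<q ^ n. chi (rep k * (\<xi> - rep l)))"
    by (simp add: chi_rep_periodic)
  then show ?thesis
    using character_sum[OF l, of n] mem_lattice_nbhd_iff[OF l, of n] by (simp add: indicator_def)
qed

text \<open>
  The integral of the periodization of \<open>|f^|\<^sup>2\<close> over \<open>\<PP>\<^sup>n\<close>.
\<close>

definition spectral_mass :: "nat \<Rightarrow> ('a \<Rightarrow> complex) \<Rightarrow> real" where
  "spectral_mass n f = (\<integral>\<xi>. indicator (lattice_nbhd n) \<xi> * (norm (fourier \<mu> chi f \<xi>))\<^sup>2 \<partial>\<mu>)"

lemma translation_correlation_sum: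
  assumes f: "f \<in> L2 \<mu>"
  shows "(\<Sum>k<q ^ n. L2_inner \<mu> f (\<lambda>x. f (x - rep k))) = of_real (real (q ^ n) * spectral_mass n f)"
proof -
  define g where "g = fourier \<mu> chi f"
  have g: "g \<in> L2 \<mu>" and fg: "is_fourier_L2 \<mu> chi f g"
    unfolding g_def by (auto intro: fourier_L2 fourier_is_fourier f)
  note [measurable] = L2_measurable[OF g]
  have int: "integrable \<mu> (\<lambda>\<xi>. chi (rep k * \<xi>) * complex_of_real ((norm (g \<xi>))\<^sup>2))" for k
    by (rule Bochner_Integration.integrable_bound[OF L2_integrable[OF g]])
       (measurable, simp add: norm_mult char_norm norm_power)
  have "L2_inner \<mu> f (\<lambda>x. f (x - rep k)) = (\<integral>\<xi>. chi (rep k * \<xi>) * complex_of_real ((norm (g \<xi>))\<^sup>2) \<partial>\<mu>)" for k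
  proof -
    have "L2_inner \<mu> f (\<lambda>x. f (x - rep k)) = L2_inner \<mu> g (\<lambda>\<xi>. cnj (chi (rep k * \<xi>)) * g \<xi>)"
      by (rule Plancherel[OF f fg L2_translation[OF f] is_fourier_L2_translation[OF f fg], symmetric])
    then show ?thesis
      unfolding L2_inner_def complex_norm_square by (simp add: mult_ac)
  qed
  then have "(\<Sum>k<q ^ n. L2_inner \<mu> f (\<lambda>x. f (x - rep k)))
      = (\<integral>\<xi>. (\<Sum>k<q ^ n. chi (rep k * \<xi>)) * complex_of_real ((norm (g \<xi>))\<^sup>2) \<partial>\<mu>)"
    by (simp only: sum_distrib_right) (subst Bochner_Integration.integral_sum, simp_all only: int)
  also have "\<dots> = (\<integral>\<xi>. complex_of_real (real (q ^ n) * (indicator (lattice_nbhd n) \<xi> * (norm (g \<xi>))\<^sup>2)) \<partial>\<mu>)"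
    unfolding indicator_lattice_nbhd
    by (intro Bochner_Integration.integral_cong refl) (simp add: indicator_def)
  also have "\<dots> = of_real (real (q ^ n) * spectral_mass n f)"
    by (simp only: integral_complex_of_real spectral_mass_def g_def integral_mult_right_zero)
  finally show ?thesis .
qed

lemma spectral_mass_nn_integral:
  assumes f: "f \<in> L2 \<mu>"
  shows "ennreal (spectral_mass n f)
    = (\<integral>\<^sup>+\<xi>. indicator (lattice_nbhd n) \<xi> * ennreal ((norm (fourier \<mu> chi f \<xi>))\<^sup>2) \<partial>\<mu>)"
proof -
  have "integrable \<mu> (\<lambda>\<xi>. indicator (lattice_nbhd n) \<xi> *\<^sub>R (norm (fourier \<mu> chi f \<xi>))\<^sup>2)"
    by (intro integrable_mult_indicator L2_integrable fourier_L2 f) measurable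
  then show ?thesis
    unfolding spectral_mass_def
    by (subst nn_integral_eq_integral[symmetric]) (auto intro!: nn_integral_cong simp: indicator_def)
qed

text \<open>
  The heights of the layers in \<open>1 / |\<xi>| = \<Sum>\<^sub>n w\<^sub>n 1[\<xi> \<in> \<PP>\<^sup>n]\<close> for \<open>\<xi> \<in> \<OO>\<close>.
\<close>

definition layer_weight :: "nat \<Rightarrow> real" where
  "layer_weight n = (if n = 0 then 1 else real q ^ n - real q ^ (n - 1))"

lemma layer_weight_nonneg: "layer_weight n \<ge> 0"
  using q_gt_1 by (auto simp: layer_weight_def intro!: power_increasing)

lemma sum_layer_weight: "(\<Sum>n\<le>N. layer_weight n) = real q ^ N"
  by (induction N) (auto simp: layer_weight_def)

text \<open>
  The \<open>\<Lambda>\<close>-periodic extension of \<open>1 / |\<xi>|\<close> from \<open>\<OO>\<close>, the weight \<open>\<Omega>\<close>. As a sum of layers it can be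
  integrated term by term.
\<close>

definition layer_density :: "'a \<Rightarrow> ennreal" where
  "layer_density \<xi> = (\<Sum>n. ennreal (layer_weight n) * indicator (lattice_nbhd n) \<xi>)"

lemma measurable_layer_density [measurable]: "layer_density \<in> borel_measurable \<mu>"
  unfolding layer_density_def[abs_def] by measurable

lemma layer_density_translate:
  assumes "\<xi> \<in> pideal 0"
  shows "layer_density (\<xi> + rep l) = layer_density \<xi>"
proof -
  have "\<xi> + rep l \<in> lattice_nbhd n \<longleftrightarrow> \<xi> \<in> lattice_nbhd n" for n
    using mem_lattice_nbhd_iff[of "\<xi> + rep l" l n] mem_lattice_nbhd_iff[of \<xi> 0 n] assms by simp
  then show ?thesis by (simp add: layer_density_def indicator_def)
qed

lemma layer_density_on_integers:
  assumes \<xi>: "\<xi> \<in> pideal 0" "\<xi> \<noteq> 0"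
  shows "layer_density \<xi> = ennreal (1 / absv \<xi>)"
proof -
  obtain m where m: "absv \<xi> = real q powi m" using \<xi>(2) by (rule absv_value)
  have "m \<le> 0" using \<xi>(1) mem_pideal_absv_powi[OF m, of 0] by simp
  then obtain N where N: "m = - int N" by (metis nonpos_int_cases)
  have mem: "\<xi> \<in> lattice_nbhd n \<longleftrightarrow> n \<le> N" for n
    using mem_lattice_nbhd_iff[of \<xi> 0 n] mem_pideal_absv_powi[OF m, of "int n"] \<xi>(1) by (simp add: N)
  have "layer_density \<xi> = (\<Sum>n\<in>{..N}. ennreal (layer_weight n) * indicator (lattice_nbhd n) \<xi>)"
    unfolding layer_density_def by (rule suminf_finite) (auto simp: mem)
  also have "\<dots> = (\<Sum>n\<in>{..N}. ennreal (layer_weight n))"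
    by (intro sum.cong) (auto simp: mem)
  also have "\<dots> = ennreal (real q ^ N)"
    by (simp add: sum_ennreal layer_weight_nonneg sum_layer_weight)
  also have "real q ^ N = 1 / absv \<xi>" by (simp add: m N power_int_minus divide_inverse)
  finally show ?thesis .
qed

text \<open>
  Outside \<open>\<OO>\<close> the layer of level 0 alone contributes 1, while \<open>1 / |\<xi>| < 1\<close>.
\<close>

lemma layer_density_ge:
  assumes "\<xi> \<noteq> 0"
  shows "ennreal (1 / absv \<xi>) \<le> layer_density \<xi>"
proof (cases "\<xi> \<in> pideal 0")
  case True
  then show ?thesis using layer_density_on_integers assms by simp
next
  case False
  then have "absv \<xi> > 1" by (simp add: pideal_0 integer_ring_def)
  then have "ennreal (1 / absv \<xi>) \<le> ennreal (layer_weight 0) * indicator (lattice_nbhd 0) \<xi>"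
  proof -
    obtain l where "\<xi> - rep l \<in> pideal 0" by (rule rep_exists)
    then have "\<xi> \<in> lattice_nbhd 0" using mem_lattice_nbhd_iff[of \<xi> l 0] by simp
    with \<open>absv \<xi> > 1\<close> show ?thesis by (simp add: layer_weight_def)
  qed
  also have "\<dots> \<le> layer_density \<xi>"
  proof -
    have "t 0 \<le> suminf t" for t :: "nat \<Rightarrow> ennreal"
      using sum_le_suminf[OF summableI, of "{0}" t] by simp
    then show ?thesis unfolding layer_density_def .
  qed
  finally show ?thesis .
qed

lemma layer_density_integral:
  assumes f: "f \<in> L2 \<mu>"
  shows "(\<integral>\<^sup>+\<xi>. layer_density \<xi> * ennreal ((norm (fourier \<mu> chi f \<xi>))\<^sup>2) \<partial>\<mu>)
    = (\<Sum>n. ennreal (layer_weight n) * ennreal (spectral_mass n f))"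
proof -
  note [measurable] = L2_measurable[OF fourier_L2[OF f]]
  have "(\<integral>\<^sup>+\<xi>. layer_density \<xi> * ennreal ((norm (fourier \<mu> chi f \<xi>))\<^sup>2) \<partial>\<mu>)
      = (\<integral>\<^sup>+\<xi>. (\<Sum>n. ennreal (layer_weight n) * (indicator (lattice_nbhd n) \<xi> * ennreal ((norm (fourier \<mu> chi f \<xi>))\<^sup>2))) \<partial>\<mu>)"
    by (simp add: layer_density_def ennreal_suminf_multc[symmetric] mult.assoc)
  also have "\<dots> = (\<Sum>n. \<integral>\<^sup>+\<xi>. ennreal (layer_weight n) * (indicator (lattice_nbhd n) \<xi> * ennreal ((norm (fourier \<mu> chi f \<xi>))\<^sup>2)) \<partial>\<mu>)"
    by (rule nn_integral_suminf) measurable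
  finally show ?thesis by (simp add: nn_integral_cmult spectral_mass_nn_integral[OF f])
qed

text \<open>
  Unfolding of the periodization, using that the weight is periodic. The two sides are compared pointwise; at
  \<open>\<xi> = 0\<close> the right-hand integrand is infinite unless the periodization vanishes there.
\<close>

lemma periodization_integral_ge:
  assumes f: "f \<in> L2 \<mu>"
  shows "(\<integral>\<^sup>+\<xi>. layer_density \<xi> * ennreal ((norm (fourier \<mu> chi f \<xi>))\<^sup>2) \<partial>\<mu>)
    \<le> (\<integral>\<^sup>+\<xi>\<in>integer_ring absv.
          (\<Sum>k. ennreal ((norm (fourier \<mu> chi f (\<xi> + rep k)))\<^sup>2)) / ennreal (absv \<xi>) \<partial>\<mu>)"
proof -
  define g where "g \<xi> = ennreal ((norm (fourier \<mu> chi f \<xi>))\<^sup>2)" for \<xi>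
  have [measurable]: "g \<in> borel_measurable \<mu>"
    unfolding g_def[abs_def] using L2_measurable[OF fourier_L2[OF f]] by measurable
  define h where "h k \<xi> = indicator (coset (rep k) 0) \<xi> * (layer_density \<xi> * g \<xi>)" for k \<xi>
  have [measurable]: "h k \<in> borel_measurable \<mu>" for k
    unfolding h_def[abs_def] by measurable
  have shift: "h k (rep k + \<xi>) = indicator (pideal 0) \<xi> * (layer_density \<xi> * g (\<xi> + rep k))" for k \<xi>
    using layer_density_translate[of \<xi> k]
    by (auto simp: h_def coset_def indicator_def add.commute)
  have one: "(\<Sum>k. indicator (coset (rep k) 0) \<xi> :: ennreal) = 1" for \<xi>
    using suminf_indicator[OF unit_cosets_disjoint, of \<xi>] by (simp add: UN_unit_cosets)
  have "(\<integral>\<^sup>+\<xi>. layer_density \<xi> * g \<xi> \<partial>\<mu>) = (\<integral>\<^sup>+\<xi>. (\<Sum>k. h k \<xi>) \<partial>\<mu>)"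
    unfolding h_def by (simp only: ennreal_suminf_multc one) simp
  also have "\<dots> = (\<Sum>k. \<integral>\<^sup>+\<xi>. h k \<xi> \<partial>\<mu>)"
    by (rule nn_integral_suminf) measurable
  also have "\<dots> = (\<Sum>k. \<integral>\<^sup>+\<xi>. h k (rep k + \<xi>) \<partial>\<mu>)"
    by (simp add: nn_integral_translation)
  also have "\<dots> = (\<integral>\<^sup>+\<xi>. (\<Sum>k. h k (rep k + \<xi>)) \<partial>\<mu>)"
    by (rule nn_integral_suminf[symmetric]) measurable
  also have "\<dots> = (\<integral>\<^sup>+\<xi>. indicator (pideal 0) \<xi> * (layer_density \<xi> * (\<Sum>k. g (\<xi> + rep k))) \<partial>\<mu>)"
    by (simp add: shift)
  also have "\<dots> \<le> (\<integral>\<^sup>+\<xi>. (\<Sum>k. g (\<xi> + rep k)) / ennreal (absv \<xi>) * indicator (integer_ring absv) \<xi> \<partial>\<mu>)"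
  proof (rule nn_integral_mono)
    fix \<xi>
    let ?W = "\<Sum>k. g (\<xi> + rep k)"
    have "layer_density \<xi> * ?W \<le> ?W / ennreal (absv \<xi>)" if "\<xi> \<in> pideal 0"
    proof (cases "\<xi> = 0")
      case True
      then show ?thesis by (cases "?W = 0") (auto simp: ennreal_divide_zero)
    next
      case False
      then have "absv \<xi> > 0" using absv_nonneg[of \<xi>] absv_eq_0_iff[of \<xi>] by linarith
      then show ?thesis
        using layer_density_on_integers[OF that False]
        by (simp add: divide_ennreal_def inverse_ennreal mult.commute divide_inverse)
    qed
    then show "indicator (pideal 0) \<xi> * (layer_density \<xi> * ?W) \<le> ?W / ennreal (absv \<xi>) * indicator (integer_ring absv) \<xi>"
      by (simp add: indicator_def pideal_0)
  qed
  finally show ?thesis by (simp add: g_def)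
qed

section \<open>Invariance of the weighted mass under equivalence\<close>

lemma affine_0: "affine \<pp> c \<epsilon> 0 k f = (\<lambda>x. f (x - rep k))"
  using char_pos by (simp add: affine_def dilation_def translation_def fun_eq_iff)

text \<open>
  The translates \<open>T\<^sup>k \<psi>\<close> are the members of the affine system with \<open>j = 0\<close>, so the intertwining unitary
  maps them to the corresponding translates of the super-wavelet.
\<close>

lemma equivalent_correlations:
  assumes \<psi>: "\<psi> \<in> L2 \<mu>" and \<nu>: "\<And>i. i < m \<Longrightarrow> \<nu> i \<in> L2 \<mu>"
    and equiv: "super_wavelet_equivalent \<mu> \<pp> c \<epsilon> 1 (\<lambda>_. \<psi>) m \<nu>"
  shows "L2_inner \<mu> \<psi> (\<lambda>x. \<psi> (x - rep k)) = (\<Sum>i<m. L2_inner \<mu> (\<nu> i) (\<lambda>x. \<nu> i (x - rep k)))"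
proof -
  obtain U where U: "unitary_dsum \<mu> 1 m U"
    and Ueq: "\<And>k l. dsum_eq \<mu> m (U (\<lambda>i. affine \<pp> c \<epsilon> k l \<psi>)) (\<lambda>i. affine \<pp> c \<epsilon> k l (\<nu> i))"
    using equiv unfolding super_wavelet_equivalent_def by blast
  define F where "F l = (\<lambda>i::nat. \<lambda>x. \<psi> (x - rep l))" for l
  have F: "F l \<in> dsum \<mu> 1" for l by (simp add: dsum_def F_def L2_translation \<psi>)
  have UF: "U (F l) \<in> dsum \<mu> m" for l using U F unfolding unitary_dsum_def by blast
  have AE: "AE x in \<mu>. U (F l) i x = \<nu> i (x - rep l)" if "i < m" for l i
    using Ueq[of 0 l] that by (simp add: dsum_eq_def affine_0 F_def)
  have "L2_inner \<mu> \<psi> (\<lambda>x. \<psi> (x - rep k)) = dsum_inner \<mu> 1 (F 0) (F k)"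
    by (simp add: dsum_inner_def F_def)
  also have "\<dots> = dsum_inner \<mu> m (U (F 0)) (U (F k))"
    using U F unfolding unitary_dsum_def by metis
  also have "\<dots> = (\<Sum>i<m. L2_inner \<mu> (\<lambda>x. \<nu> i (x - rep 0)) (\<lambda>x. \<nu> i (x - rep k)))"
    unfolding dsum_inner_def
  proof (intro sum.cong refl)
    fix i assume "i \<in> {..<m}"
    then have i: "i < m" by simp
    have "U (F l) i \<in> L2 \<mu>" for l using UF[of l] i by (simp add: dsum_def)
    then show "L2_inner \<mu> (U (F 0) i) (U (F k) i) = L2_inner \<mu> (\<lambda>x. \<nu> i (x - rep 0)) (\<lambda>x. \<nu> i (x - rep k))"
      by (intro L2_inner_cong_AE AE i L2_translation \<nu>)
  qed
  finally show ?thesis by simp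
qed

lemma equivalent_spectral_mass:
  assumes \<psi>: "\<psi> \<in> L2 \<mu>" and \<nu>: "\<And>i. i < m \<Longrightarrow> \<nu> i \<in> L2 \<mu>"
    and equiv: "super_wavelet_equivalent \<mu> \<pp> c \<epsilon> 1 (\<lambda>_. \<psi>) m \<nu>"
  shows "spectral_mass n \<psi> = (\<Sum>i<m. spectral_mass n (\<nu> i))"
proof -
  have "complex_of_real (real (q ^ n) * spectral_mass n \<psi>)
      = (\<Sum>k<q ^ n. \<Sum>i<m. L2_inner \<mu> (\<nu> i) (\<lambda>x. \<nu> i (x - rep k)))"
    unfolding translation_correlation_sum[OF \<psi>, symmetric]
    by (intro sum.cong refl equivalent_correlations[OF \<psi> _ equiv] \<nu>)
  also have "\<dots> = (\<Sum>i<m. \<Sum>k<q ^ n. L2_inner \<mu> (\<nu> i) (\<lambda>x. \<nu> i (x - rep k)))"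
    by (rule sum.swap)
  also have "\<dots> = (\<Sum>i<m. complex_of_real (real (q ^ n) * spectral_mass n (\<nu> i)))"
    by (intro sum.cong refl translation_correlation_sum \<nu>) simp
  also have "\<dots> = complex_of_real (real (q ^ n) * (\<Sum>i<m. spectral_mass n (\<nu> i)))"
    by (simp only: of_real_sum sum_distrib_left)
  finally have "real (q ^ n) * spectral_mass n \<psi> = real (q ^ n) * (\<Sum>i<m. spectral_mass n (\<nu> i))"
    by (simp only: of_real_eq_iff)
  then show ?thesis using q_pos by simp
qed

lemma spectral_mass_nonneg: "spectral_mass n f \<ge> 0"
  unfolding spectral_mass_def by (intro integral_nonneg_AE) auto

lemma equivalent_layer_density_integral:
  assumes \<psi>: "\<psi> \<in> L2 \<mu>" and \<nu>: "\<And>i. i < m \<Longrightarrow> \<nu> i \<in> L2 \<mu>"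
    and equiv: "super_wavelet_equivalent \<mu> \<pp> c \<epsilon> 1 (\<lambda>_. \<psi>) m \<nu>"
  shows "(\<integral>\<^sup>+\<xi>. layer_density \<xi> * ennreal ((norm (fourier \<mu> chi \<psi> \<xi>))\<^sup>2) \<partial>\<mu>)
    = (\<Sum>i<m. \<integral>\<^sup>+\<xi>. layer_density \<xi> * ennreal ((norm (fourier \<mu> chi (\<nu> i) \<xi>))\<^sup>2) \<partial>\<mu>)"
proof -
  have "ennreal (spectral_mass n \<psi>) = (\<Sum>i<m. ennreal (spectral_mass n (\<nu> i)))" for n
    by (subst equivalent_spectral_mass[OF \<psi> _ equiv]) (simp_all add: \<nu> sum_ennreal spectral_mass_nonneg)
  then have "(\<Sum>n. ennreal (layer_weight n) * ennreal (spectral_mass n \<psi>))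
      = (\<Sum>n. \<Sum>i<m. ennreal (layer_weight n) * ennreal (spectral_mass n (\<nu> i)))"
    by (simp add: sum_distrib_left)
  also have "\<dots> = (\<Sum>i<m. \<Sum>n. ennreal (layer_weight n) * ennreal (spectral_mass n (\<nu> i)))"
    by (rule suminf_sum) (rule summableI)
  finally show ?thesis by (simp add: layer_density_integral \<psi> \<nu>)
qed

section \<open>Bessel inequalities on cosets\<close>

text \<open>
  A coset of \<open>\<PP>\<^sup>n\<close> with \<open>n \<ge> 0\<close> lies in one coset of \<open>\<OO>\<close>, on which the characters are orthonormal.
\<close>

lemma Bessel_unit_coset:
  assumes G: "G \<in> L2 \<mu>" and n: "n \<ge> 0" and K: "finite K"
  shows "(\<Sum>k\<in>K. (norm (\<integral>\<xi>. indicator (coset a n) \<xi> * chi (rep k * \<xi>) * cnj (G \<xi>) \<partial>\<mu>))\<^sup>2)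
    \<le> (L2_norm \<mu> (\<lambda>\<xi>. indicator (coset a n) \<xi> * G \<xi>))\<^sup>2"
proof -
  obtain l where "a - rep l \<in> pideal 0" by (rule rep_exists)
  then have "coset a n \<subseteq> coset (rep l) 0"
    using coset_mono[OF n, of a] coset_eq[of a "rep l" 0] by (simp add: coset_def)
  then have sub: "\<xi> \<in> coset (rep l) 0" if "\<xi> \<in> coset a n" for \<xi> using that by blast
  define H where "H \<xi> = indicator (coset a n) \<xi> * G \<xi>" for \<xi>
  have H: "H \<in> L2 \<mu>" unfolding H_def[abs_def] by (rule L2_restrict[OF G]) simp
  let ?i = "\<lambda>k. prod_encode (k, l)"
  have eq: "norm (\<integral>\<xi>. indicator (coset a n) \<xi> * chi (rep k * \<xi>) * cnj (G \<xi>) \<partial>\<mu>)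
      = norm (L2_inner \<mu> H (time_gabor (?i k)))" for k
  proof -
    have "(\<integral>\<xi>. indicator (coset a n) \<xi> * chi (rep k * \<xi>) * cnj (G \<xi>) \<partial>\<mu>)
        = L2_inner \<mu> (time_gabor (?i k)) H"
      unfolding L2_inner_def
      by (intro Bochner_Integration.integral_cong refl)
         (auto simp: H_def time_gabor_def gabor_def indicator_def sub)
    also have "\<dots> = cnj (L2_inner \<mu> H (time_gabor (?i k)))" by (rule L2_inner_commute)
    finally show ?thesis by simp
  qed
  have "(\<Sum>k\<in>K. (norm (L2_inner \<mu> H (time_gabor (?i k))))\<^sup>2)
      = (\<Sum>i\<in>?i ` K. (norm (L2_inner \<mu> H (time_gabor i)))\<^sup>2)"
    by (subst sum.reindex) (auto simp: inj_on_def)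
  also have "\<dots> \<le> (L2_norm \<mu> H)\<^sup>2"
    using K by (intro Bessel_inequality time_gabor_orthonormal H) simp
  finally show ?thesis by (simp add: eq H_def[abs_def])
qed

lemma coset_partition: "coset a (- int R) = (\<Union>r<q ^ R. coset (a + rep r) 0)"
proof (intro set_eqI)
  fix x
  have "x \<in> coset a (- int R) \<longleftrightarrow> x - a \<in> (\<Union>r<q ^ R. coset (rep r) 0)"
    using pideal_partition[of "- int R" R] by (simp add: coset_def)
  then show "x \<in> coset a (- int R) \<longleftrightarrow> x \<in> (\<Union>r<q ^ R. coset (a + rep r) 0)"
    by (simp add: coset_def algebra_simps)
qed

lemma indicator_coset_partition:
  "indicator (coset a (- int R)) x = (\<Sum>r<q ^ R. indicator (coset (a + rep r) 0) x :: 'b::{comm_semiring_1})"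
proof -
  have "disjoint_family_on (\<lambda>r. coset (a + rep r) 0) {..<q ^ R}"
    unfolding disjoint_family_on_def
  proof (intro ballI impI)
    fix r s :: nat assume "r \<noteq> s"
    then have "coset (rep r) 0 \<inter> coset (rep s) 0 = {}"
      using unit_cosets_disjoint by (auto simp: disjoint_family_on_def)
    moreover have "x \<in> coset (a + rep r) 0 \<longleftrightarrow> x - a \<in> coset (rep r) 0" for x r
      by (simp add: coset_def algebra_simps)
    ultimately show "coset (a + rep r) 0 \<inter> coset (a + rep s) 0 = {}" by blast
  qed
  then show ?thesis
    unfolding coset_partition by (subst indicator_UN_disjoint) simp_all
qed

text \<open>
  A large coset consists of \<open>q\<^sup>-\<^sup>n\<close> cosets of \<open>\<OO>\<close>; the Cauchy-Schwarz inequality for the sum over these pieces costs the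
  factor \<open>q\<^sup>-\<^sup>n\<close>.
\<close>

lemma Bessel_coset:
  assumes G: "G \<in> L2 \<mu>" and K: "finite K"
  shows "(\<Sum>k\<in>K. (norm (\<integral>\<xi>. indicator (coset a n) \<xi> * chi (rep k * \<xi>) * cnj (G \<xi>) \<partial>\<mu>))\<^sup>2)
    \<le> max 1 (real q powi (- n)) * (L2_norm \<mu> (\<lambda>\<xi>. indicator (coset a n) \<xi> * G \<xi>))\<^sup>2"
proof (cases "n \<ge> 0")
  case True
  have "(L2_norm \<mu> (\<lambda>\<xi>. indicator (coset a n) \<xi> * G \<xi>))\<^sup>2
      \<le> max 1 (real q powi (- n)) * (L2_norm \<mu> (\<lambda>\<xi>. indicator (coset a n) \<xi> * G \<xi>))\<^sup>2"
    by (simp add: mult_le_cancel_right1)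
  with Bessel_unit_coset[OF G True K, of a] show ?thesis by linarith
next
  case False
  then obtain R where n: "n = - int R" by (metis int_cases4 less_imp_le neg_0_le_iff_le of_nat_0_le_iff not_le)
  define C where "C r = coset (a + rep r) 0" for r
  define z where "z k r = (\<integral>\<xi>. indicator (C r) \<xi> * chi (rep k * \<xi>) * cnj (G \<xi>) \<partial>\<mu>)" for k r
  have ind: "indicator (coset a n) x = (\<Sum>r<q ^ R. indicator (C r) x :: 'b::comm_semiring_1)" for x
    unfolding n C_def by (rule indicator_coset_partition)
  have int: "integrable \<mu> (\<lambda>\<xi>. indicator (C r) \<xi> * chi (rep k * \<xi>) * cnj (G \<xi>))" for k r
    unfolding C_def by (rule L2_product_integrable[OF char_coset_L2 G])
  have z: "(\<integral>\<xi>. indicator (coset a n) \<xi> * chi (rep k * \<xi>) * cnj (G \<xi>) \<partial>\<mu>) = (\<Sum>r<q ^ R. z k r)" for k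
    unfolding ind z_def by (simp only: sum_distrib_right) (rule Bochner_Integration.integral_sum, rule int)
  have "(L2_norm \<mu> (\<lambda>\<xi>. indicator (coset a n) \<xi> * G \<xi>))\<^sup>2
      = (\<integral>\<xi>. (\<Sum>r<q ^ R. (norm (indicator (C r) \<xi> * G \<xi>))\<^sup>2) \<partial>\<mu>)"
  proof -
    have "(norm (indicator (coset a n) \<xi> * G \<xi>))\<^sup>2 = (\<Sum>r<q ^ R. (norm (indicator (C r) \<xi> * G \<xi>))\<^sup>2)" for \<xi>
    proof -
      have *: "(norm (indicator A \<xi> * G \<xi>))\<^sup>2 = indicator A \<xi> * (norm (G \<xi>))\<^sup>2" for A
        by (simp add: indicator_def)
      show ?thesis unfolding * unfolding ind by (simp only: sum_distrib_right)
    qed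
    then show ?thesis by (simp add: L2_norm_squared)
  qed
  also have "\<dots> = (\<Sum>r<q ^ R. (L2_norm \<mu> (\<lambda>\<xi>. indicator (C r) \<xi> * G \<xi>))\<^sup>2)"
    unfolding L2_norm_squared C_def
    by (intro Bochner_Integration.integral_sum L2_integrable L2_restrict G measurable_coset)
  finally have norm: "(L2_norm \<mu> (\<lambda>\<xi>. indicator (coset a n) \<xi> * G \<xi>))\<^sup>2
      = (\<Sum>r<q ^ R. (L2_norm \<mu> (\<lambda>\<xi>. indicator (C r) \<xi> * G \<xi>))\<^sup>2)" .
  have "(\<Sum>k\<in>K. (norm (\<Sum>r<q ^ R. z k r))\<^sup>2) \<le> (\<Sum>k\<in>K. (\<Sum>r<q ^ R. (norm (z k r))\<^sup>2) * real (q ^ R))"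
  proof (rule sum_mono)
    fix k
    have "(norm (\<Sum>r<q ^ R. z k r))\<^sup>2 \<le> (\<Sum>r<q ^ R. norm (z k r))\<^sup>2"
      by (intro power_mono norm_sum) auto
    also have "\<dots> \<le> (\<Sum>r<q ^ R. (norm (z k r))\<^sup>2) * real (q ^ R)"
      using sum_squared_le_sum_of_squares[of "\<lambda>r. norm (z k r)" "{..<q ^ R}"] by simp
    finally show "(norm (\<Sum>r<q ^ R. z k r))\<^sup>2 \<le> (\<Sum>r<q ^ R. (norm (z k r))\<^sup>2) * real (q ^ R)" .
  qed
  also have "\<dots> = real (q ^ R) * (\<Sum>r<q ^ R. \<Sum>k\<in>K. (norm (z k r))\<^sup>2)"
    by (subst sum.swap) (simp only: sum_distrib_left mult.commute)
  also have "\<dots> \<le> real (q ^ R) * (\<Sum>r<q ^ R. (L2_norm \<mu> (\<lambda>\<xi>. indicator (C r) \<xi> * G \<xi>))\<^sup>2)"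
    unfolding z_def C_def by (intro mult_left_mono sum_mono Bessel_unit_coset G K) auto
  also have "\<dots> = real q powi (- n) * (L2_norm \<mu> (\<lambda>\<xi>. indicator (coset a n) \<xi> * G \<xi>))\<^sup>2"
    by (simp only: norm) (simp add: n)
  also have "\<dots> \<le> max 1 (real q powi (- n)) * (L2_norm \<mu> (\<lambda>\<xi>. indicator (coset a n) \<xi> * G \<xi>))\<^sup>2"
    by (intro mult_right_mono) auto
  finally show ?thesis unfolding z .
qed

section \<open>The weighted mass of a Parseval frame wavelet\<close>

text \<open>
  Dilation and translation carry the test function to a modulated indicator of a coset, and
  \<open>char_coset_pairing\<close> moves the pairing to the frequency side.
\<close>

lemma affine_coefficient:
  assumes \<eta>: "\<eta> \<in> L2 \<mu>"
  shows "(norm (L2_inner \<mu> (\<lambda>x. indicator (coset 0 (- int N)) x * chi (a * x)) (affine \<pp> c \<epsilon> j k \<eta>)))\<^sup>2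
    = real q powi (2 * int N + j) *
      (norm (\<integral>\<xi>. indicator (coset (a * \<pp> powi j) (int N + j)) \<xi> * chi (rep k * \<xi>) *
               cnj (fourier \<mu> chi \<eta> \<xi>) \<partial>\<mu>))\<^sup>2"
proof -
  note [measurable] = L2_measurable[OF \<eta>]
  let ?s = "real q powr (real_of_int j / 2)"
  let ?f = "\<lambda>x. indicator (coset 0 (- int N)) x * chi (a * x)"
  have [measurable]: "(\<lambda>y. cnj (\<eta> (y - rep k))) \<in> borel_measurable \<mu>"
    using measurable_diff_borel[OF L2_measurable[OF \<eta>]] by measurable
  define G where "G y = ?f (\<pp> powi j * y) * cnj (\<eta> (y - rep k))" for y
  have [measurable]: "G \<in> borel_measurable \<mu>"
    unfolding G_def[abs_def] mult.assoc[symmetric, of a] by measurable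
  have "L2_inner \<mu> ?f (affine \<pp> c \<epsilon> j k \<eta>) = (\<integral>x. of_real ?s * G (\<pp> powi (- j) * x) \<partial>\<mu>)"
    unfolding L2_inner_def
  proof (intro Bochner_Integration.integral_cong refl)
    fix x
    show "?f x * cnj (affine \<pp> c \<epsilon> j k \<eta> x) = of_real ?s * G (\<pp> powi (- j) * x)"
      unfolding G_def pp_powi_cancel
      by (simp add: affine_def dilation_def translation_def q_def mult_ac)
  qed
  also have "\<dots> = of_real ?s * (of_real (real q powi (- j)) * (\<integral>y. G y \<partial>\<mu>))"
    by (simp only: integral_mult_right_zero integral_scaling[OF \<open>G \<in> borel_measurable \<mu>\<close>])
  also have "(\<integral>y. G y \<partial>\<mu>) = (\<integral>y. G (rep k + y) \<partial>\<mu>)"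
    by (rule integral_translation[symmetric]) measurable
  also have "\<dots> = (\<integral>y. chi (a * \<pp> powi j * rep k) *
      (indicator (coset (- rep k) (- int N - j)) y * chi ((a * \<pp> powi j) * y) * cnj (\<eta> y)) \<partial>\<mu>)"
  proof (intro Bochner_Integration.integral_cong refl)
    fix y
    have "\<pp> powi j * (rep k + y) \<in> coset 0 (- int N) \<longleftrightarrow> y \<in> coset (- rep k) (- int N - j)"
      by (simp add: coset_def pp_powi_mult_mem_iff add.commute)
    then have i: "indicator (coset 0 (- int N)) (\<pp> powi j * (rep k + y))
        = (indicator (coset (- rep k) (- int N - j)) y :: complex)"
      by (simp only: indicator_def)
    have ch: "chi (a * (\<pp> powi j * (rep k + y))) = chi (a * \<pp> powi j * rep k) * chi (a * \<pp> powi j * y)"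
      by (simp only: distrib_left char_add mult.assoc)
    show "G (rep k + y) = chi (a * \<pp> powi j * rep k) *
      (indicator (coset (- rep k) (- int N - j)) y * chi ((a * \<pp> powi j) * y) * cnj (\<eta> y))"
      unfolding G_def i ch by (simp add: mult_ac)
  qed
  also have "\<dots> = chi (a * \<pp> powi j * rep k) * (of_real (real q powi (int N + j)) * chi (a * \<pp> powi j * (- rep k)) *
      (\<integral>\<xi>. indicator (coset (a * \<pp> powi j) (int N + j)) \<xi> * chi (rep k * \<xi>) * cnj (fourier \<mu> chi \<eta> \<xi>) \<partial>\<mu>))"
    using char_coset_pairing[OF \<eta>, of "- rep k" "- int N - j" "a * \<pp> powi j"]
    by (simp add: chi_minus add.commute)
  finally have "norm (L2_inner \<mu> ?f (affine \<pp> c \<epsilon> j k \<eta>))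
      = ?s * real q powi (- j) * real q powi (int N + j) *
        norm (\<integral>\<xi>. indicator (coset (a * \<pp> powi j) (int N + j)) \<xi> * chi (rep k * \<xi>) * cnj (fourier \<mu> chi \<eta> \<xi>) \<partial>\<mu>)"
    by (simp add: norm_mult char_norm norm_power_int mult.assoc)
  moreover have "(?s * real q powi (- j) * real q powi (int N + j))\<^sup>2 = real q powi (2 * int N + j)"
  proof -
    have "?s\<^sup>2 = real q powi j"
      using q_pos by (simp add: power2_eq_square powr_real_of_int' flip: powr_add)
    then have "(?s * real q powi (- j) * real q powi (int N + j))\<^sup>2
        = real q powi j * (real q powi (- j) * real q powi (int N + j))\<^sup>2"
      by (simp add: power_mult_distrib)
    also have "real q powi (- j) * real q powi (int N + j) = real q powi (int N)"
      using q_neq_0 by (simp add: power_int_add[symmetric] del: power_int_of_nat)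
    also have "real q powi j * (real q powi (int N))\<^sup>2 = real q powi (2 * int N + j)"
      using q_neq_0 by (simp add: power2_eq_square power_int_add[symmetric] add_ac del: power_int_of_nat)
    finally show ?thesis .
  qed
  ultimately show ?thesis by (simp only: power_mult_distrib)
qed

text \<open>
  For \<open>N \<ge> 1\<close> all elements of \<open>a + \<PP>\<^sup>N\<close> are units, so a dilate of it has a single absolute value.
\<close>

lemma absv_on_dilated_coset:
  assumes a: "absv a = 1" and N: "N \<ge> 1" and \<xi>: "\<xi> \<in> coset (a * \<pp> powi j) (int N + j)"
  shows "absv \<xi> = real q powi (- j)"
proof -
  define y where "y = \<pp> powi (- j) * \<xi>"
  have \<xi>y: "\<xi> = \<pp> powi j * y" unfolding y_def by (rule pp_powi_cancel[symmetric])
  have "\<pp> powi j * (y - a) \<in> pideal (int N + j)"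
    using \<xi> by (simp add: \<xi>y coset_def algebra_simps)
  then have "y - a \<in> pideal (int N)" by (simp add: pp_powi_mult_mem_iff)
  then have ya: "absv (y - a) < 1"
    using pideal_antimono[of 1 "int N"] N by (auto simp: pideal_1 max_ideal_def)
  have "absv y \<le> 1" using absv_ultrametric[of "y - a" a] ya a by simp
  moreover have "absv y \<ge> 1"
    using absv_ultrametric[of y "- (y - a)"] ya a absv_minus[of "y - a"] by (simp add: max_def split: if_splits)
  ultimately have "absv y = 1" by simp
  then show ?thesis by (simp add: \<xi>y absv_mult absv_pp_powi)
qed

text \<open>
  The union of all dilates \<open>\<pp>\<^sup>j(a + \<PP>\<^sup>N)\<close>.
\<close>

definition dilation_orbit :: "nat \<Rightarrow> 'a \<Rightarrow> 'a set" where
  "dilation_orbit N a = (\<Union>j. coset (a * \<pp> powi j) (int N + j))"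

lemma measurable_dilation_orbit [measurable]: "dilation_orbit N a \<in> sets \<mu>"
  unfolding dilation_orbit_def by (intro sets.countable_UN) auto

text \<open>
  The frame identity for the test function \<open>\<chi>(ax)\<close> on \<open>\<PP>\<^sup>-\<^sup>N\<close>, whose squared norm is \<open>q\<^sup>N\<close>. At scale \<open>j\<close> the
  coefficients contribute at most \<open>q\<^sup>2\<^sup>N\<^sup>+\<^sup>j max(1, q\<^sup>-\<^sup>N\<^sup>-\<^sup>j)\<close> times the mass of \<open>|\<eta>^|\<^sup>2\<close> on the dilated ball, and
  \<open>q\<^sup>j max(1, q\<^sup>-\<^sup>N\<^sup>-\<^sup>j) \<le> q\<^sup>j + q\<^sup>-\<^sup>N\<close>, where \<open>q\<^sup>j = 1 / |\<xi>|\<close> on this ball.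
\<close>

lemma wavelet_orbit_bound:
  assumes pfw: "parseval_frame_wavelet \<mu> \<pp> c \<epsilon> \<eta>" and a: "absv a = 1" and N: "N \<ge> 1"
  shows "ennreal (real q powi (- int N)) \<le> (\<integral>\<^sup>+\<xi>. indicator (dilation_orbit N a) \<xi> *
      ((layer_density \<xi> + ennreal (real q powi (- int N))) * ennreal ((norm (fourier \<mu> chi \<eta> \<xi>))\<^sup>2)) \<partial>\<mu>)"
    (is "_ \<le> ?M")
proof -
  have \<eta>: "\<eta> \<in> L2 \<mu>" using pfw by (simp add: parseval_frame_wavelet_def)
  define g where "g = fourier \<mu> chi \<eta>"
  have g: "g \<in> L2 \<mu>" unfolding g_def by (rule fourier_L2[OF \<eta>])
  note [measurable] = L2_measurable[OF g]
  let ?f = "\<lambda>x. indicator (coset 0 (- int N)) x * chi (a * x)"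
  let ?C = "\<lambda>j. coset (a * \<pp> powi j) (int N + j)"
  define t where "t = (\<lambda>(j :: int, k :: nat). (norm (L2_inner \<mu> ?f (affine \<pp> c \<epsilon> j k \<eta>)))\<^sup>2)"
  have fL2: "?f \<in> L2 \<mu>" by (rule char_coset_L2)
  have hs: "(t has_sum (L2_norm \<mu> ?f)\<^sup>2) UNIV"
    using pfw fL2 unfolding parseval_frame_wavelet_def t_def by blast
  have fnorm: "(L2_norm \<mu> ?f)\<^sup>2 = real q powi (int N)"
  proof -
    have "(norm (?f x))\<^sup>2 = indicator (coset 0 (- int N)) x" for x
      by (simp add: norm_mult char_norm indicator_def)
    then show ?thesis using measure_coset[of 0 "- int N"] by (simp add: L2_norm_squared)
  qed
  define h where "h \<xi> = (layer_density \<xi> + ennreal (real q powi (- int N))) * ennreal ((norm (g \<xi>))\<^sup>2)" for \<xi>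
  have [measurable]: "h \<in> borel_measurable \<mu>" unfolding h_def[abs_def] by measurable
  have piece: "ennreal (\<Sum>k\<in>K. t (j, k)) \<le> ennreal (real q powi (2 * int N)) * (\<integral>\<^sup>+\<xi>. indicator (?C j) \<xi> * h \<xi> \<partial>\<mu>)"
    if K: "finite K" for j K
  proof -
    have "(\<Sum>k\<in>K. t (j, k)) = real q powi (2 * int N + j) *
        (\<Sum>k\<in>K. (norm (\<integral>\<xi>. indicator (?C j) \<xi> * chi (rep k * \<xi>) * cnj (g \<xi>) \<partial>\<mu>))\<^sup>2)"
      by (simp add: t_def affine_coefficient[OF \<eta>] g_def sum_distrib_left)
    also have "\<dots> \<le> real q powi (2 * int N + j) *
        (max 1 (real q powi (- (int N + j))) * (L2_norm \<mu> (\<lambda>\<xi>. indicator (?C j) \<xi> * g \<xi>))\<^sup>2)"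
      using q_pos by (intro mult_left_mono Bessel_coset g K) auto
    also have "\<dots> \<le> real q powi (2 * int N) * ((real q powi j + real q powi (- int N)) * (L2_norm \<mu> (\<lambda>\<xi>. indicator (?C j) \<xi> * g \<xi>))\<^sup>2)"
    proof -
      have "real q powi j * max 1 (real q powi (- (int N + j))) \<le> real q powi j + real q powi (- int N)"
      proof -
        have "real q powi j * real q powi (- (int N + j)) = real q powi (- int N)"
          using q_neq_0 by (simp add: power_int_add[symmetric])
        then show ?thesis using q_pos by (simp add: max_def)
      qed
      then have "real q powi (2 * int N) * (real q powi j * max 1 (real q powi (- (int N + j))) * (L2_norm \<mu> (\<lambda>\<xi>. indicator (?C j) \<xi> * g \<xi>))\<^sup>2)
        \<le> real q powi (2 * int N) * ((real q powi j + real q powi (- int N)) * (L2_norm \<mu> (\<lambda>\<xi>. indicator (?C j) \<xi> * g \<xi>))\<^sup>2)"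
        using q_pos by (intro mult_left_mono mult_right_mono) auto
      then show ?thesis using q_neq_0 by (simp only: power_int_add mult.assoc simp_thms)
    qed
    finally have "ennreal (\<Sum>k\<in>K. t (j, k)) \<le> ennreal (real q powi (2 * int N)) *
        ((ennreal (real q powi j + real q powi (- int N))) * ennreal ((L2_norm \<mu> (\<lambda>\<xi>. indicator (?C j) \<xi> * g \<xi>))\<^sup>2))"
      using q_pos by (simp add: ennreal_mult[symmetric] ennreal_leI del: ennreal_plus)
    also have "(ennreal (real q powi j + real q powi (- int N))) * ennreal ((L2_norm \<mu> (\<lambda>\<xi>. indicator (?C j) \<xi> * g \<xi>))\<^sup>2)
        = (\<integral>\<^sup>+\<xi>. ennreal (real q powi j + real q powi (- int N)) * ennreal ((norm (indicator (?C j) \<xi> * g \<xi>))\<^sup>2) \<partial>\<mu>)"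
      by (subst L2_norm_squared_nn_integral) (auto intro!: L2_restrict g nn_integral_cmult[symmetric])
    also have "\<dots> \<le> (\<integral>\<^sup>+\<xi>. indicator (?C j) \<xi> * h \<xi> \<partial>\<mu>)"
    proof (rule nn_integral_mono)
      fix \<xi>
      have "ennreal (real q powi j + real q powi (- int N)) \<le> layer_density \<xi> + ennreal (real q powi (- int N))"
        if "\<xi> \<in> ?C j"
      proof -
        have v: "absv \<xi> = real q powi (- j)" using absv_on_dilated_coset[OF a N that] .
        then have "\<xi> \<noteq> 0" using q_pos by auto
        from layer_density_ge[OF this] have "ennreal (real q powi j) \<le> layer_density \<xi>"
          by (simp add: v power_int_minus divide_inverse)
        then show ?thesis using q_pos by (simp add: ennreal_plus add_right_mono)
      qed
      then show "ennreal (real q powi j + real q powi (- int N)) * ennreal ((norm (indicator (?C j) \<xi> * g \<xi>))\<^sup>2)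
          \<le> indicator (?C j) \<xi> * h \<xi>"
        by (auto simp: h_def indicator_def intro!: mult_right_mono)
    qed
    finally show ?thesis by (simp add: mult_left_mono)
  qed
  have disj: "disjoint_family ?C"
    unfolding disjoint_family_on_def
  proof (intro ballI impI)
    fix i j :: int assume "i \<noteq> j"
    have False if "\<xi> \<in> ?C i" "\<xi> \<in> ?C j" for \<xi>
    proof -
      have "real q powi (- i) = real q powi (- j)"
        using absv_on_dilated_coset[OF a N that(1)] absv_on_dilated_coset[OF a N that(2)] by simp
      then have "- i \<le> - j" "- j \<le> - i" using q_powi_le_iff order_refl by metis+
      with \<open>i \<noteq> j\<close> show False by simp
    qed
    then show "?C i \<inter> ?C j = {}" by blast
  qed
  have bound: "ennreal (sum t F) \<le> ennreal (real q powi (2 * int N)) * (\<integral>\<^sup>+\<xi>. indicator (dilation_orbit N a) \<xi> * h \<xi> \<partial>\<mu>)"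
    if F: "finite F" for F
  proof -
    \<comment> \<open>finite partial sums are compared scale by scale inside an enclosing rectangle\<close>
    define J K where "J = fst ` F" "K = snd ` F"
    have JK: "finite J" "finite K" "F \<subseteq> J \<times> K" using F by (auto simp: J_K_def image_iff) force+
    have t0: "t p \<ge> 0" for p by (simp add: t_def split: prod.split)
    have "sum t F \<le> sum t (J \<times> K)" using JK t0 by (intro sum_mono2) auto
    also have "\<dots> = (\<Sum>j\<in>J. \<Sum>k\<in>K. t (j, k))" by (simp add: sum.cartesian_product)
    finally have "ennreal (sum t F) \<le> (\<Sum>j\<in>J. ennreal (\<Sum>k\<in>K. t (j, k)))"
      by (subst sum_ennreal) (auto intro!: ennreal_leI sum_nonneg t0)
    also have "\<dots> \<le> (\<Sum>j\<in>J. ennreal (real q powi (2 * int N)) * (\<integral>\<^sup>+\<xi>. indicator (?C j) \<xi> * h \<xi> \<partial>\<mu>))"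
      by (intro sum_mono piece JK)
    also have "\<dots> = ennreal (real q powi (2 * int N)) * (\<integral>\<^sup>+\<xi>. (\<Sum>j\<in>J. indicator (?C j) \<xi>) * h \<xi> \<partial>\<mu>)"
      by (simp add: sum_distrib_left[symmetric] nn_integral_sum[symmetric] sum_distrib_right)
    also have "\<dots> \<le> ennreal (real q powi (2 * int N)) * (\<integral>\<^sup>+\<xi>. indicator (dilation_orbit N a) \<xi> * h \<xi> \<partial>\<mu>)"
    proof (intro mult_left_mono nn_integral_mono mult_right_mono)
      fix \<xi>
      have "(\<Sum>j\<in>J. indicator (?C j) \<xi>) = (indicator (\<Union>j\<in>J. ?C j) \<xi> :: ennreal)"
        using disj JK(1) by (intro indicator_UN_disjoint[symmetric]) (auto simp: disjoint_family_on_def)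
      also have "\<dots> \<le> indicator (dilation_orbit N a) \<xi>"
        by (auto simp: indicator_def dilation_orbit_def)
      finally show "(\<Sum>j\<in>J. indicator (?C j) \<xi>) \<le> (indicator (dilation_orbit N a) \<xi> :: ennreal)" .
    qed auto
    finally show ?thesis .
  qed
  have Mh: "?M = (\<integral>\<^sup>+\<xi>. indicator (dilation_orbit N a) \<xi> * h \<xi> \<partial>\<mu>)"
    by (simp add: h_def g_def)
  show ?thesis
  proof (cases "?M = top")
    case False
    then obtain B where B: "?M = ennreal B" "B \<ge> 0" by (cases ?M) auto
    have "sum t F \<le> real q powi (2 * int N) * B" if "finite F" for F
    proof -
      have "ennreal (sum t F) \<le> ennreal (real q powi (2 * int N) * B)"
        using bound[OF that] B q_pos by (simp add: Mh ennreal_mult)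
      then show ?thesis using B q_pos by (subst (asm) ennreal_le_iff) auto
    qed
    then have "real q powi (int N) \<le> real q powi (2 * int N) * B"
      using has_sum_le_finite_sums[OF hs] fnorm by simp
    moreover have "real q powi (2 * int N) = real q ^ N * real q ^ N"
      using power_int_add[of "real q" "int N" "int N"] q_neq_0 by simp
    ultimately have "real q ^ N * 1 \<le> real q ^ N * (real q ^ N * B)" by (simp add: mult.assoc)
    then have "1 \<le> real q ^ N * B" using q_pos by (subst (asm) mult_le_cancel_left_pos) auto
    then have "real q powi (- int N) \<le> B"
      using q_pos by (simp add: power_int_minus inverse_eq_divide divide_le_eq mult.commute)
    then show ?thesis unfolding B(1) by (rule ennreal_leI)
  qed simp
qed

text \<open>
  Stated in contrapositive form: the absolute value of a common element determines the scale, and dividing by the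
  power of \<open>\<pp>\<close> leaves an element common to the two cosets.
\<close>

lemma dilation_orbit_disjoint:
  assumes a: "absv a = 1" "absv b = 1" and N: "N \<ge> 1"
    and \<xi>: "\<xi> \<in> dilation_orbit N a" "\<xi> \<in> dilation_orbit N b"
  shows "coset a (int N) = coset b (int N)"
proof -
  obtain i j where i: "\<xi> \<in> coset (a * \<pp> powi i) (int N + i)" and j: "\<xi> \<in> coset (b * \<pp> powi j) (int N + j)"
    using \<xi> by (auto simp: dilation_orbit_def)
  have "real q powi (- i) = real q powi (- j)"
    using absv_on_dilated_coset[OF a(1) N i] absv_on_dilated_coset[OF a(2) N j] by simp
  then have "- i \<le> - j" "- j \<le> - i" using q_powi_le_iff order_refl by metis+
  then have ij: "i = j" by simp
  have "(\<xi> - b * \<pp> powi i) - (\<xi> - a * \<pp> powi i) \<in> pideal (int N + i)"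
    using i j unfolding ij coset_def by (intro pideal_diff[of "\<xi> - b * \<pp> powi j"]) simp_all
  then have "\<pp> powi i * (a - b) \<in> pideal (int N + i)" by (simp add: algebra_simps)
  then have "a - b \<in> pideal (int N)" by (simp add: pp_powi_mult_mem_iff)
  then show ?thesis by (intro coset_eq) (simp add: coset_def)
qed

text \<open>
  The cosets counted here cover the group of units, which has measure \<open>1 - 1 / q\<close>.
\<close>

lemma unit_coset_count:
  assumes N: "N \<ge> 1"
  defines "I \<equiv> {k \<in> {..<q ^ N}. absv (\<pp> powi (int N) * rep k) = 1}"
  shows "(real q - 1) / real q \<le> real (card I) * real q powi (- int N)"
proof -
  have "pideal 0 - pideal 1 \<subseteq> (\<Union>k\<in>I. coset (\<pp> powi int N * rep k) (int N))"
  proof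
    fix x assume x: "x \<in> pideal 0 - pideal 1"
    then obtain k where k: "k < q ^ N" "x \<in> coset (\<pp> powi int N * rep k) (int N)"
      using pideal_partition[of 0 N] by auto
    have "absv x = 1" using x by (auto simp: pideal_0 pideal_1 integer_ring_def max_ideal_def)
    moreover have "\<pp> powi int N * rep k \<in> coset (x * \<pp> powi 0) (int N + 0)"
      using coset_eq[OF k(2)] mem_coset_self[of "\<pp> powi int N * rep k" "int N"] by simp
    ultimately have "absv (\<pp> powi int N * rep k) = 1"
      using absv_on_dilated_coset[of x N "\<pp> powi int N * rep k" 0] N by simp
    with k show "x \<in> (\<Union>k\<in>I. coset (\<pp> powi int N * rep k) (int N))" by (auto simp: I_def)
  qed
  then have "emeasure \<mu> (pideal 0 - pideal 1) \<le> emeasure \<mu> (\<Union>k\<in>I. coset (\<pp> powi int N * rep k) (int N))"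
    by (intro emeasure_mono) (auto simp: I_def)
  also have "\<dots> \<le> (\<Sum>k\<in>I. emeasure \<mu> (coset (\<pp> powi int N * rep k) (int N)))"
    by (rule emeasure_subadditive_finite) (auto simp: I_def)
  also have "\<dots> = ennreal (real (card I) * real q powi (- int N))"
    using q_pos by (simp add: emeasure_coset ennreal_mult ennreal_of_nat_eq_real_of_nat)
  also have "emeasure \<mu> (pideal 0 - pideal 1) = ennreal ((real q - 1) / real q)"
  proof -
    have "emeasure \<mu> (pideal 0 - pideal 1) = emeasure \<mu> (pideal 0) - emeasure \<mu> (pideal 1)"
      using pideal_antimono[of 0 1] by (intro emeasure_Diff) (auto simp: emeasure_pideal)
    also have "\<dots> = ennreal (1 - 1 / real q)"
      using q_pos by (simp add: emeasure_pideal power_int_minus divide_inverse ennreal_minus flip: ennreal_1)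
    finally show ?thesis using q_pos by (simp add: diff_divide_distrib)
  qed
  finally show ?thesis using q_pos by (subst (asm) ennreal_le_iff) auto
qed

text \<open>
  The sum of the bounds for the orbits of the different balls of units of radius \<open>q\<^sup>-\<^sup>N\<close>.
\<close>

lemma wavelet_mass_approx:
  assumes pfw: "parseval_frame_wavelet \<mu> \<pp> c \<epsilon> \<eta>" and N: "N \<ge> 1"
  shows "ennreal ((real q - 1) / real q)
    \<le> (\<integral>\<^sup>+\<xi>. layer_density \<xi> * ennreal ((norm (fourier \<mu> chi \<eta> \<xi>))\<^sup>2) \<partial>\<mu>)
      + ennreal ((1 / real q) ^ N * (L2_norm \<mu> (fourier \<mu> chi \<eta>))\<^sup>2)"
proof -
  define g where "g = fourier \<mu> chi \<eta>"
  have g: "g \<in> L2 \<mu>" using pfw by (auto simp: g_def parseval_frame_wavelet_def intro: fourier_L2)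
  note [measurable] = L2_measurable[OF g]
  define I where "I = {k \<in> {..<q ^ N}. absv (\<pp> powi (int N) * rep k) = 1}"
  define h where "h \<xi> = (layer_density \<xi> + ennreal (real q powi (- int N))) * ennreal ((norm (g \<xi>))\<^sup>2)" for \<xi>
  have [measurable]: "h \<in> borel_measurable \<mu>" unfolding h_def[abs_def] by measurable
  let ?O = "\<lambda>k. dilation_orbit N (\<pp> powi int N * rep k)"
  have disj: "disjoint_family_on ?O I"
    unfolding disjoint_family_on_def
  proof (intro ballI impI)
    fix k l assume kl: "k \<in> I" "l \<in> I" "k \<noteq> l"
    have False if "\<xi> \<in> ?O k" "\<xi> \<in> ?O l" for \<xi>
    proof -
      have "coset (\<pp> powi int N * rep k) (int N) = coset (\<pp> powi int N * rep l) (int N)"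
        using kl that N by (intro dilation_orbit_disjoint[of _ _ N \<xi>]) (auto simp: I_def)
      moreover have "coset (\<pp> powi int N * rep k) (int N) \<inter> coset (\<pp> powi int N * rep l) (int N) = {}"
        using scaled_cosets_disjoint[of "int N"] kl(3) by (simp only: disjoint_family_on_def) blast
      ultimately show False using mem_coset_self by blast
    qed
    then show "?O k \<inter> ?O l = {}" by blast
  qed
  have "ennreal ((real q - 1) / real q) \<le> ennreal (real (card I) * real q powi (- int N))"
    using unit_coset_count[OF N] by (intro ennreal_leI) (simp add: I_def)
  also have "\<dots> = (\<Sum>k\<in>I. ennreal (real q powi (- int N)))"
    using q_pos by (simp add: ennreal_mult ennreal_of_nat_eq_real_of_nat)
  also have "\<dots> \<le> (\<Sum>k\<in>I. \<integral>\<^sup>+\<xi>. indicator (?O k) \<xi> * h \<xi> \<partial>\<mu>)"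
    unfolding h_def g_def by (intro sum_mono wavelet_orbit_bound[OF pfw _ N]) (simp add: I_def)
  also have "\<dots> = (\<integral>\<^sup>+\<xi>. (\<Sum>k\<in>I. indicator (?O k) \<xi>) * h \<xi> \<partial>\<mu>)"
    by (simp add: nn_integral_sum[symmetric] sum_distrib_right)
  also have "\<dots> \<le> (\<integral>\<^sup>+\<xi>. h \<xi> \<partial>\<mu>)"
  proof (rule nn_integral_mono)
    fix \<xi>
    have "(\<Sum>k\<in>I. indicator (?O k) \<xi>) = (indicator (\<Union>k\<in>I. ?O k) \<xi> :: ennreal)"
      using disj by (intro indicator_UN_disjoint[symmetric]) (auto simp: I_def)
    then show "(\<Sum>k\<in>I. indicator (?O k) \<xi>) * h \<xi> \<le> h \<xi>" by (simp add: indicator_def)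
  qed
  also have "\<dots> = (\<integral>\<^sup>+\<xi>. layer_density \<xi> * ennreal ((norm (g \<xi>))\<^sup>2) \<partial>\<mu>)
      + ennreal (real q powi (- int N)) * ennreal ((L2_norm \<mu> g)\<^sup>2)"
    by (simp add: h_def distrib_right nn_integral_add nn_integral_cmult L2_norm_squared_nn_integral g)
  also have "ennreal (real q powi (- int N)) * ennreal ((L2_norm \<mu> g)\<^sup>2) = ennreal ((1 / real q) ^ N * (L2_norm \<mu> g)\<^sup>2)"
    by (simp add: ennreal_mult power_int_minus power_divide divide_inverse power_inverse)
  finally show ?thesis by (simp add: g_def)
qed

lemma wavelet_mass:
  assumes pfw: "parseval_frame_wavelet \<mu> \<pp> c \<epsilon> \<eta>"
  shows "ennreal ((real q - 1) / real q)
    \<le> (\<integral>\<^sup>+\<xi>. layer_density \<xi> * ennreal ((norm (fourier \<mu> chi \<eta> \<xi>))\<^sup>2) \<partial>\<mu>)"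
    (is "_ \<le> ?A")
proof -
  let ?B = "(L2_norm \<mu> (fourier \<mu> chi \<eta>))\<^sup>2"
  have "(\<lambda>N. (1 / real q) ^ N * ?B) \<longlonglongrightarrow> 0 * ?B"
    using q_gt_1 by (intro tendsto_intros LIMSEQ_power_zero) simp
  then have "(\<lambda>N. ?A + ennreal ((1 / real q) ^ N * ?B)) \<longlonglongrightarrow> ?A + ennreal (0 * ?B)"
    by (intro tendsto_add tendsto_const tendsto_ennrealI)
  then have "ennreal ((real q - 1) / real q) \<le> ?A + ennreal (0 * ?B)"
    by (rule LIMSEQ_le_const) (use wavelet_mass_approx[OF pfw] in blast)
  then show ?thesis by simp
qed

section \<open>The bound for decomposable wavelets\<close>

lemma decomposable_periodization_bound:
  assumes \<psi>: "parseval_frame_wavelet \<mu> \<pp> c \<epsilon> \<psi>" and dec: "decomposable \<mu> \<pp> c \<epsilon> m \<psi>"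
  shows "ennreal (real m * ((real q - 1) / real q))
    \<le> (\<integral>\<^sup>+\<xi>\<in>integer_ring absv.
          (\<Sum>k. ennreal ((norm (fourier \<mu> chi \<psi> (\<xi> + rep k)))\<^sup>2)) / ennreal (absv \<xi>) \<partial>\<mu>)"
proof -
  obtain \<nu> where \<nu>: "\<And>i. i < m \<Longrightarrow> parseval_frame_wavelet \<mu> \<pp> c \<epsilon> (\<nu> i)"
    and equiv: "super_wavelet_equivalent \<mu> \<pp> c \<epsilon> 1 (\<lambda>_. \<psi>) m \<nu>"
    using dec unfolding decomposable_def parseval_frame_super_wavelet_def by blast
  have L2: "\<psi> \<in> L2 \<mu>" "\<And>i. i < m \<Longrightarrow> \<nu> i \<in> L2 \<mu>"
    using \<psi> \<nu> by (auto simp: parseval_frame_wavelet_def)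
  have "ennreal (real m * ((real q - 1) / real q)) = (\<Sum>i<m. ennreal ((real q - 1) / real q))"
    using q_gt_1 by (simp add: ennreal_of_nat_eq_real_of_nat ennreal_mult[symmetric])
  also have "\<dots> \<le> (\<Sum>i<m. \<integral>\<^sup>+\<xi>. layer_density \<xi> * ennreal ((norm (fourier \<mu> chi (\<nu> i) \<xi>))\<^sup>2) \<partial>\<mu>)"
    by (intro sum_mono wavelet_mass \<nu>) simp
  also have "\<dots> = (\<integral>\<^sup>+\<xi>. layer_density \<xi> * ennreal ((norm (fourier \<mu> chi \<psi> \<xi>))\<^sup>2) \<partial>\<mu>)"
    by (rule equivalent_layer_density_integral[OF L2 equiv, symmetric])
  also note periodization_integral_ge[OF L2(1)]
  finally show ?thesis .
qed

end

theorem proposition5p2: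
  fixes absv :: "'a::topological_field \<Rightarrow> real"
    and \<pp> :: 'a and c :: nat and \<epsilon> :: "nat \<Rightarrow> 'a"
    and \<mu> :: "'a measure" and chi :: "'a \<Rightarrow> complex"
    and \<psi> :: "'a \<Rightarrow> complex" and m q :: nat
  assumes "local_field_setting absv \<pp> c \<epsilon> \<mu> chi"
    and "q = CHAR('a) ^ c"
    and "parseval_frame_wavelet \<mu> \<pp> c \<epsilon> \<psi>"
    and "decomposable \<mu> \<pp> c \<epsilon> m \<psi>"
  shows "(\<integral>\<^sup>+\<xi>\<in>integer_ring absv.
            (\<Sum>k. ennreal ((norm (fourier \<mu> chi \<psi> (\<xi> + u \<pp> c \<epsilon> k)))\<^sup>2)) / ennreal (absv \<xi>) \<partial>\<mu>)
         \<ge> ennreal (real m * ((real q - 1) / real q))"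
proof -
  interpret local_field_setting absv \<pp> c \<epsilon> \<mu> chi by (rule assms(1))
  show ?thesis
    using decomposable_periodization_bound[OF assms(3,4)] unfolding q_def assms(2) .
qed

end
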